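(* Let $m\ge 2$. The complex structure $J_{\mathfrak q}$ on $\mathfrak{sl}(2m-1,\mathbb{R})$ defined by the complex subalgebra $\mathfrak q\subset\mathfrak{sl}(2m-1,\mathbb{C})$ described in the context admits compatible balanced metrics.
   Context: Let $\mathfrak g_0=\mathfrak{sl}(2m-1,\mathbb{R})$, $\mathfrak g=\mathfrak{sl}(2m-1,\mathbb{C})$, and let $\sigma$ be the complex conjugation of $\mathfrak g$ with respect to $\mathfrak g_0$. Let $\mathfrak g_0=\mathfrak k_0\oplus\mathfrak p_0$ be a Cartan decomposition with Cartan involution $\theta$, and let $\mathfrak h_0=\mathfrak t_0\oplus\mathfrak a_0$ ($\mathfrak t_0\subset\mathfrak k_0$, $\mathfrak a_0\subset\mathfrak p_0$) be a maximally compact $\theta$-stable Cartan subalgebra of $\mathfrak g_0$, with complexification $\mathfrak h\subset\mathfrak g$. Let $\Sigma$ be the root system of $(\mathfrak g,\mathfrak h)$, with root spaces $\mathfrak g_\alpha$. The conjugation $\sigma$ acts on roots by $\sigma(\mathfrak g_\alpha)=\mathfrak g_{\sigma(\alpha)}$. Positive roots $\Sigma^+$ and simple roots $\Delta=\{\alpha_1,\dots,\alpha_{2m-2}\}$ (labelled so that the Cartan matrix is the standard one of type $A_{2m-2}$) are chosen using a lexicographic ordering with respect to an ordered basis formed by a basis of $i\mathfrak t_0$ followed by a basis of $\mathfrak a_0$; then $$\Sigma^+=\{\alpha_j^k=\alpha_j+\alpha_{j+1}+\dots+\alpha_{j+k-1}:\ 1\le k\le 2m-2,\ 1\le j\le 2m-1-k\},$$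 $\theta(\alpha_j)=\alpha_{2m-1-j}$ and $\sigma(\alpha_j)=-\alpha_{2m-1-j}$ (hence $\sigma(\alpha_j^k)=-\alpha_{2m-k-j}^k$). Choose generators $e_\alpha$ of $\mathfrak g_\alpha$, $\alpha\in\Sigma^+$, such that $[e_\alpha,e_\beta]=e_{\alpha+\beta}$ whenever $\alpha,\beta,\alpha+\beta\in\Sigma^+$ and $\alpha<\beta$ in lexicographic order. For $\alpha\in\Sigma$ let $H_\alpha\in\mathfrak h$ be defined by $B(H,H_\alpha)=\alpha(H)$ for all $H\in\mathfrak h$, where $B$ is the Killing form of $\mathfrak g$, and put $H_j=H_{\alpha_j}$; thus $\sigma(H_j)=-H_{2m-1-j}$. Define $$\tilde H_k=H_k-2H_{2m-1-k}=H_k+2\sigma(H_k)\quad(1\le k\le m-3),$$ $$\tilde H_{m-2}=2H_{m-2}+H_{m-1}\ (\text{if } m\ge 3),\qquad \tilde H_{m-1}=H_{m-1}+2H_m=H_{m-1}-2\sigma(H_{m-1}),$$ $\tilde{\mathcal H}=\{\tilde H_k:1\le k\le m-1\}$, $\hat\Sigma^+=\Sigma^+\setminus\{\alpha_{m-1}\}$, and $e_0=e_{\alpha_{m-1}}+\sigma(e_{\alpha_m})$. Let $\mathfrak q$ be the complex span of $\tilde{\mathcal H}\cup\{e_\alpha:\alpha\in\hat\Sigma^+\}\cup\{e_0\}$. It is a complex subalgebra of $\mathfrak g$ with $\mathfrak g=\mathfrak q\oplus\sigma(\mathfrak q)$, and $J_{\mathfrak q}$ denotes the complex structure on $\mathfrak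 g_0$ whose $i$-eigenspace $\mathfrak g_0^{1,0}$ is $\mathfrak q$ and whose $(-i)$-eigenspace is $\sigma(\mathfrak q)$. A compatible metric on $(\mathfrak g_0,J)$ is a positive definite inner product $g$ on $\mathfrak g_0$ with $g(J\cdot,J\cdot)=g$ (equivalently a left-invariant Hermitian metric on a corresponding Lie group), with fundamental form $\omega$. It is balanced if $d\omega^{n-1}=0$, where $2n=\dim_{\mathbb{R}}\mathfrak g_0$ and $d$ is the Chevalley–Eilenberg differential. *)

theory Defs
  imports "HOL-Analysis.Analysis"
begin

definition linear_on ::
  "('k \<Rightarrow> 'v \<Rightarrow> 'v) \<Rightarrow> ('k \<Rightarrow> 'w \<Rightarrow> 'w) \<Rightarrow> 'v::plus set \<Rightarrow> ('v \<Rightarrow> 'w::plus) \<Rightarrow> bool" where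
  "linear_on s1 s2 V f \<longleftrightarrow>
     (\<forall>x\<in>V. \<forall>y\<in>V. f (x + y) = f x + f y) \<and> (\<forall>c. \<forall>x\<in>V. f (s1 c x) = s2 c (f x))"

text \<open>For a finite-dimensional \<open>V\<close> invariant under \<open>f\<close>; independent of the chosen basis.\<close>

definition trace_on ::
  "('k::field \<Rightarrow> 'v::ab_group_add \<Rightarrow> 'v) \<Rightarrow> 'v set \<Rightarrow> ('v \<Rightarrow> 'v) \<Rightarrow> 'k" where
  "trace_on s V f =
     (let B = (SOME B. B \<subseteq> V \<and> \<not> module.dependent s B \<and> module.span s B = V)
      in \<Sum>b\<in>B. module.representation s B (f b) b)"

definition killing_form ::
  "('k::field \<Rightarrow> 'v::ab_group_add \<Rightarrow> 'v) \<Rightarrow> ('v \<Rightarrow> 'v \<Rightarrow> 'v) \<Rightarrow> 'v set \<Rightarrow> 'v \<Rightarrow> 'v \<Rightarrow> 'k" where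
  "killing_form s br L X Y = trace_on s L (\<lambda>Z. br X (br Y Z))"

definition lie_subalgebra ::
  "('k::field \<Rightarrow> 'v::ab_group_add \<Rightarrow> 'v) \<Rightarrow> ('v \<Rightarrow> 'v \<Rightarrow> 'v) \<Rightarrow> 'v set \<Rightarrow> 'v set \<Rightarrow> bool" where
  "lie_subalgebra s br L K \<longleftrightarrow>
     K \<subseteq> L \<and> module.subspace s K \<and> (\<forall>X\<in>K. \<forall>Y\<in>K. br X Y \<in> K)"

primrec lower_central ::
  "('k::field \<Rightarrow> 'v::ab_group_add \<Rightarrow> 'v) \<Rightarrow> ('v \<Rightarrow> 'v \<Rightarrow> 'v) \<Rightarrow> 'v set \<Rightarrow> nat \<Rightarrow> 'v set" where
  "lower_central s br K 0 = K"
| "lower_central s br K (Suc i) =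
     module.span s {br X Y |X Y. X \<in> K \<and> Y \<in> lower_central s br K i}"

definition cartan_subalgebra ::
  "('k::field \<Rightarrow> 'v::ab_group_add \<Rightarrow> 'v) \<Rightarrow> ('v \<Rightarrow> 'v \<Rightarrow> 'v) \<Rightarrow> 'v set \<Rightarrow> 'v set \<Rightarrow> bool" where
  "cartan_subalgebra s br L K \<longleftrightarrow>
     lie_subalgebra s br L K \<and>
     (\<exists>i. lower_central s br K i = {0}) \<and>
     {X\<in>L. \<forall>Y\<in>K. br X Y \<in> K} = K"

definition cscale :: "complex \<Rightarrow> complex^'n^'n \<Rightarrow> complex^'n^'n" where
  "cscale c A = (\<chi> i j. c * A $ i $ j)"

interpretation cmat: vector_space cscale
  by unfold_locales (simp_all add: cscale_def vec_eq_iff algebra_simps)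

definition lie :: "'a::ring_1^'n^'n \<Rightarrow> 'a^'n^'n \<Rightarrow> 'a^'n^'n" where
  "lie A B = A ** B - B ** A"

definition sl :: "('a::comm_ring_1^'n^'n) set" where
  "sl = {A. trace A = 0}"

definition cmat_of :: "real^'n^'n \<Rightarrow> complex^'n^'n" where
  "cmat_of X = (\<chi> i j. complex_of_real (X $ i $ j))"

definition re_mat :: "complex^'n^'n \<Rightarrow> real^'n^'n" where
  "re_mat Z = (\<chi> i j. Re (Z $ i $ j))"

definition im_mat :: "complex^'n^'n \<Rightarrow> real^'n^'n" where
  "im_mat Z = (\<chi> i j. Im (Z $ i $ j))"

definition conj_mat :: "complex^'n^'n \<Rightarrow> complex^'n^'n" where
  "conj_mat Z = (\<chi> i j. cnj (Z $ i $ j))"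

definition complexification :: "(real^'n^'n) set \<Rightarrow> (complex^'n^'n) set" where
  "complexification V = {Z. re_mat Z \<in> V \<and> im_mat Z \<in> V}"

definition complexify_map ::
  "(real^'n^'n \<Rightarrow> real^'n^'n) \<Rightarrow> complex^'n^'n \<Rightarrow> complex^'n^'n" where
  "complexify_map f Z = cmat_of (f (re_mat Z)) + cscale \<i> (cmat_of (f (im_mat Z)))"

abbreviation killing_C :: "complex^'n^'n \<Rightarrow> complex^'n^'n \<Rightarrow> complex" where
  "killing_C \<equiv> killing_form cscale lie sl"

abbreviation killing_R :: "real^'n^'n \<Rightarrow> real^'n^'n \<Rightarrow> real" where
  "killing_R \<equiv> killing_form (*\<^sub>R) lie sl"

text \<open>
  Maps on \<open>sl\<close> are total functions on matrices; only their values on \<open>sl\<close> are constrained.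
\<close>

definition cartan_involution :: "(real^'n^'n \<Rightarrow> real^'n^'n) \<Rightarrow> bool" where
  "cartan_involution \<theta> \<longleftrightarrow>
     linear_on (*\<^sub>R) (*\<^sub>R) sl \<theta> \<and>
     (\<forall>X\<in>sl. \<theta> X \<in> sl \<and> \<theta> (\<theta> X) = X) \<and>
     (\<forall>X\<in>sl. \<forall>Y\<in>sl. \<theta> (lie X Y) = lie (\<theta> X) (\<theta> Y)) \<and>
     (\<forall>X\<in>sl. X \<noteq> 0 \<longrightarrow> - killing_R X (\<theta> X) > 0)"

definition fixed_part :: "(real^'n^'n \<Rightarrow> real^'n^'n) \<Rightarrow> (real^'n^'n) set" where
  "fixed_part \<theta> = {X\<in>sl. \<theta> X = X}"

definition antifixed_part :: "(real^'n^'n \<Rightarrow> real^'n^'n) \<Rightarrow> (real^'n^'n) set" where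
  "antifixed_part \<theta> = {X\<in>sl. \<theta> X = - X}"

definition stable_cartan ::
  "(real^'n^'n \<Rightarrow> real^'n^'n) \<Rightarrow> (real^'n^'n) set \<Rightarrow> bool" where
  "stable_cartan \<theta> h0 \<longleftrightarrow> cartan_subalgebra (*\<^sub>R) lie sl h0 \<and> \<theta> ` h0 \<subseteq> h0"

definition maximally_compact_cartan ::
  "(real^'n^'n \<Rightarrow> real^'n^'n) \<Rightarrow> (real^'n^'n) set \<Rightarrow> bool" where
  "maximally_compact_cartan \<theta> h0 \<longleftrightarrow>
     stable_cartan \<theta> h0 \<and>
     (\<forall>h'. stable_cartan \<theta> h' \<longrightarrow> dim (h' \<inter> fixed_part \<theta>) \<le> dim (h0 \<inter> fixed_part \<theta>))"

text \<open>
  A linear functional on \<open>h\<close> is a function on matrices that is linear on \<open>h\<close> and zero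
  outside \<open>h\<close>; thus equality and pointwise operations of such functions are those of the
  dual space of \<open>h\<close>.
\<close>

type_synonym 'n functional = "complex^'n^'n \<Rightarrow> complex"

definition dual_space :: "(complex^'n^'n) set \<Rightarrow> 'n functional set" where
  "dual_space h = {\<alpha>. linear_on cscale (*) h \<alpha> \<and> (\<forall>Z. Z \<notin> h \<longrightarrow> \<alpha> Z = 0)}"

definition root_space ::
  "(complex^'n^'n) set \<Rightarrow> 'n functional \<Rightarrow> (complex^'n^'n) set" where
  "root_space h \<alpha> = {X\<in>sl. \<forall>H\<in>h. lie H X = cscale (\<alpha> H) X}"

definition roots :: "(complex^'n^'n) set \<Rightarrow> 'n functional set" where
  "roots h = {\<alpha>\<in>dual_space h. \<alpha> \<noteq> (\<lambda>H. 0) \<and> root_space h \<alpha> \<noteq> {0}}"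

definition killing_dual ::
  "(complex^'n^'n) set \<Rightarrow> 'n functional \<Rightarrow> complex^'n^'n" where
  "killing_dual h \<alpha> = (THE H. H \<in> h \<and> (\<forall>H'\<in>h. killing_C H' H = \<alpha> H'))"

text \<open>Roots take real values on \<open>\<i> t\<^sub>0 \<oplus> a\<^sub>0\<close>, the real span of the list below.\<close>

definition lex_positive :: "(complex^'n^'n) list \<Rightarrow> 'n functional \<Rightarrow> bool" where
  "lex_positive bs \<alpha> \<longleftrightarrow>
     (\<exists>i<length bs. (\<forall>j<i. \<alpha> (bs ! j) = 0) \<and> \<alpha> (bs ! i) \<in> \<real> \<and> Re (\<alpha> (bs ! i)) > 0)"

definition positive_roots ::
  "(complex^'n^'n) set \<Rightarrow> (complex^'n^'n) list \<Rightarrow> 'n functional set" where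
  "positive_roots h bs = {\<alpha>\<in>roots h. lex_positive bs \<alpha>}"

definition simple_roots :: "'n functional set \<Rightarrow> 'n functional set" where
  "simple_roots P = {\<alpha>\<in>P. \<not> (\<exists>\<beta>\<in>P. \<exists>\<gamma>\<in>P. \<alpha> = (\<lambda>H. \<beta> H + \<gamma> H))}"

definition real_basis :: "(complex^'n^'n) list \<Rightarrow> (complex^'n^'n) set \<Rightarrow> bool" where
  "real_basis bs V \<longleftrightarrow> distinct bs \<and> independent (set bs) \<and> span (set bs) = V"

definition cartan_matrix_entry ::
  "(complex^'n^'n) set \<Rightarrow> 'n functional \<Rightarrow> 'n functional \<Rightarrow> complex" where
  "cartan_matrix_entry h \<alpha> \<beta> =
     2 * killing_C (killing_dual h \<alpha>) (killing_dual h \<beta>)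
       / killing_C (killing_dual h \<alpha>) (killing_dual h \<alpha>)"

definition type_A_entry :: "nat \<Rightarrow> nat \<Rightarrow> complex" where
  "type_A_entry i j = (if i = j then 2 else if i = j + 1 \<or> j = i + 1 then - 1 else 0)"

text \<open>\<open>chain \<alpha> j k\<close> is \<open>\<alpha>\<^sub>j + \<dots> + \<alpha>\<^bsub>j+k-1\<^esub>\<close>.\<close>

definition chain :: "(nat \<Rightarrow> 'n functional) \<Rightarrow> nat \<Rightarrow> nat \<Rightarrow> 'n functional" where
  "chain \<alpha> j k = (\<lambda>H. \<Sum>i=j..<j+k. \<alpha> i H)"

definition chain_indices :: "nat \<Rightarrow> (nat \<times> nat) set" where
  "chain_indices m = {(j, k). 1 \<le> k \<and> k \<le> 2*m-2 \<and> 1 \<le> j \<and> j \<le> 2*m-1-k}"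

definition H_tilde ::
  "nat \<Rightarrow> (nat \<Rightarrow> complex^'n^'n) \<Rightarrow> nat \<Rightarrow> complex^'n^'n" where
  "H_tilde m H k =
     (if k = m-1 then H (m-1) + 2 *\<^sub>R H m
      else if k = m-2 then 2 *\<^sub>R H (m-2) + H (m-1)
      else H k - 2 *\<^sub>R H (2*m-1-k))"

definition q_algebra ::
  "nat \<Rightarrow> (complex^'n^'n) set \<Rightarrow> 'n functional set \<Rightarrow> (nat \<Rightarrow> 'n functional) \<Rightarrow>
   ('n functional \<Rightarrow> complex^'n^'n) \<Rightarrow> (complex^'n^'n) set" where
  "q_algebra m h P \<alpha> e = cmat.span
     (H_tilde m (\<lambda>j. killing_dual h (\<alpha> j)) ` {1..m-1}
      \<union> e ` (P - {\<alpha> (m-1)})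
      \<union> {e (\<alpha> (m-1)) + conj_mat (e (\<alpha> m))})"

definition complex_structure :: "(real^'n^'n \<Rightarrow> real^'n^'n) \<Rightarrow> bool" where
  "complex_structure J \<longleftrightarrow>
     linear_on (*\<^sub>R) (*\<^sub>R) sl J \<and>
     (\<forall>X\<in>sl. J X \<in> sl \<and> J (J X) = - X) \<and>
     (\<forall>X\<in>sl. \<forall>Y\<in>sl.
        lie X Y + J (lie (J X) Y) + J (lie X (J Y)) - lie (J X) (J Y) = 0)"

definition eigenspace_C ::
  "(real^'n^'n \<Rightarrow> real^'n^'n) \<Rightarrow> complex \<Rightarrow> (complex^'n^'n) set" where
  "eigenspace_C J c = {Z\<in>sl. complexify_map J Z = cscale c Z}"

definition compatible_metric ::
  "(real^'n^'n \<Rightarrow> real^'n^'n) \<Rightarrow> (real^'n^'n \<Rightarrow> real^'n^'n \<Rightarrow> real) \<Rightarrow> bool" where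
  "compatible_metric J g \<longleftrightarrow>
     (\<forall>X\<in>sl. linear_on (*\<^sub>R) (*) sl (g X)) \<and>
     (\<forall>X\<in>sl. \<forall>Y\<in>sl. g X Y = g Y X) \<and>
     (\<forall>X\<in>sl. X \<noteq> 0 \<longrightarrow> g X X > 0) \<and>
     (\<forall>X\<in>sl. \<forall>Y\<in>sl. g (J X) (J Y) = g X Y)"

text \<open>
  A \<open>p\<close>-form is represented by its values on lists of \<open>p\<close> vectors; its values on lists of
  other lengths are irrelevant.
\<close>

type_synonym 'v form = "'v list \<Rightarrow> real"

definition wedge :: "nat \<Rightarrow> nat \<Rightarrow> 'v form \<Rightarrow> 'v form \<Rightarrow> 'v form" where
  "wedge p q a b xs =
     (\<Sum>\<pi> | \<pi> permutes {..<p+q}.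
        of_int (sign \<pi>) * a (map (\<lambda>i. xs ! \<pi> i) [0..<p]) * b (map (\<lambda>i. xs ! \<pi> i) [p..<p+q]))
     / (fact p * fact q)"

primrec two_form_power :: "'v form \<Rightarrow> nat \<Rightarrow> 'v form" where
  "two_form_power a 0 = (\<lambda>xs. 1)"
| "two_form_power a (Suc r) = wedge 2 (2 * r) a (two_form_power a r)"

definition ce_differential :: "('v \<Rightarrow> 'v \<Rightarrow> 'v) \<Rightarrow> nat \<Rightarrow> 'v form \<Rightarrow> 'v form" where
  "ce_differential br p a xs =
     (\<Sum>(i, j) | i < j \<and> j \<le> p.
        (-1) ^ (i + j) * a (br (xs ! i) (xs ! j) # nths xs (- {i, j})))"

definition fundamental_form ::
  "('v \<Rightarrow> 'v) \<Rightarrow> ('v \<Rightarrow> 'v \<Rightarrow> real) \<Rightarrow> 'v form" where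
  "fundamental_form J g xs = g (J (xs ! 0)) (xs ! 1)"

definition balanced ::
  "(real^'n^'n \<Rightarrow> real^'n^'n) \<Rightarrow> (real^'n^'n \<Rightarrow> real^'n^'n \<Rightarrow> real) \<Rightarrow> bool" where
  "balanced J g \<longleftrightarrow>
     (let n = dim (sl :: (real^'n^'n) set) div 2 in
      \<forall>xs. set xs \<subseteq> sl \<and> length xs = 2 * (n - 1) + 1 \<longrightarrow>
        ce_differential lie (2 * (n - 1)) (two_form_power (fundamental_form J g) (n - 1)) xs = 0)"

end

theory Submission
  imports Defs
begin

text \<open>
  Since \<open>sl\<close> is unimodular, a metric is balanced iff \<open>\<Sum>[u\<^sub>i, J u\<^sub>i] = 0\<close> for an orthonormal frame
  \<open>u\<^sub>i, J u\<^sub>i\<close>; indeed \<open>\<omega>\<^bsup>n-1\<^esup>\<close> is a multiple of \<open>\<Sum> \<iota>(J u\<^sub>i) \<iota>(u\<^sub>i) vol\<close>. So it suffices to find a basis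
  \<open>Z\<^sub>i\<close> of \<open>q\<close> with \<open>\<Sum>[Z\<^sub>i, \<sigma> Z\<^sub>i] = 0\<close> and to declare it unitary.

  In the given basis of \<open>q\<close>, the only nonzero brackets \<open>[Z, \<sigma> Z]\<close> come from \<open>e\<^sub>0\<close> and from the
  symmetric roots \<open>\<beta>\<^sub>j = \<gamma>\<^sub>j + \<gamma>'\<^sub>j\<close>, where \<open>\<gamma>\<^sub>j = \<alpha>\<^sub>j + \<dots> + \<alpha>\<^bsub>m-1\<^esub>\<close> and \<open>\<gamma>'\<^sub>j = -\<sigma>(\<gamma>\<^sub>j)\<close>. With
  \<open>A = [e(\<gamma>\<^sub>j), \<sigma> e(\<gamma>'\<^sub>j)]\<close> and \<open>s = \<gamma>'\<^sub>j(A)\<close>, Jacobi's identity gives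
  \<open>[e(\<beta>\<^sub>j), \<sigma> e(\<beta>\<^sub>j)] = s \<sigma>(A) - cnj s A\<close>, which is cancelled by replacing \<open>e(\<gamma>\<^sub>j)\<close> with
  \<open>e(\<gamma>\<^sub>j) + s e(\<gamma>'\<^sub>j)\<close>. For \<open>j = m - 1\<close> the vector \<open>e(\<gamma>\<^sub>j)\<close> is not in \<open>q\<close> but \<open>e\<^sub>0\<close> takes its place; the extra term
  \<open>[e\<^sub>0, \<sigma> e\<^sub>0] = e(\<beta>) - \<sigma> e(\<beta>)\<close> is cancelled by adding a multiple of \<open>e(\<beta>)\<close> to the last \<open>H_tilde\<close>.
\<close>

section \<open>Alternating forms on unimodular Lie algebras\<close>

text \<open>All control over brackets comes from one grading. A vector \<open>\<rho>\<close> acts on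
  \<open>E j k\<close> by \<open>k * b\<close> and on its conjugate by \<open>- k * b\<close>. Since
  \<open>q\<close> and its conjugate span the complexification, whatever commutes with
  \<open>\<rho>\<close> is a combination of the Cartan generators and their conjugates. So
  \<open>[e(\<alpha>), \<sigma> e(\<alpha>)]\<close>, which has degree 0, is central in
  \<open>h\<close>, and its weight \<open>\<alpha> + \<sigma>(\<alpha>)\<close> must vanish if it is
  nonzero: this singles out the symmetric roots. The middle of the diagram is the obstacle.
  \<open>e\<^sub>0\<close> mixes the degrees 1 and -1, and the correction of the last
  \<open>H_tilde\<close> by \<open>t e(\<beta>)\<close> removes the surplus
  \<open>e(\<beta>) - \<sigma> e(\<beta>)\<close> only at the price of a second copy of
  \<open>[e(\<beta>), \<sigma> e(\<beta>)]\<close>, scaled by \<open>|t|^2\<close>. The shear for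
  \<open>j = m - 1\<close> has to cancel both copies, whence its coefficient
  \<open>s (1 + |t|^2)\<close>. A suitable \<open>t\<close> exists because \<open>\<beta>\<close>
  takes the value \<open>3 * b / 2\<close> on that \<open>H_tilde\<close>.\<close>

definition multilinear_form :: "'v::real_vector set \<Rightarrow> nat \<Rightarrow> 'v form \<Rightarrow> bool" where
  "multilinear_form V p a \<longleftrightarrow>
     (\<forall>w k x y c d. length w = p \<and> set w \<subseteq> V \<and> k < p \<and> x \<in> V \<and> y \<in> V \<longrightarrow>
        a (w[k := c *\<^sub>R x + d *\<^sub>R y]) = c * a (w[k := x]) + d * a (w[k := y]))"

text \<open>Only swaps of neighbours are required. They generate all permutations, and they are the
  easiest swaps to check for wedge products.\<close>

definition alternating_form :: "'v::real_vector set \<Rightarrow> nat \<Rightarrow> 'v form \<Rightarrow> bool" where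
  "alternating_form V p a \<longleftrightarrow> multilinear_form V p a \<and>
     (\<forall>as x y bs. set (as @ x # y # bs) \<subseteq> V \<and> length (as @ x # y # bs) = p \<longrightarrow>
        a (as @ y # x # bs) = - a (as @ x # y # bs))"

lemma multilinear_formD:
  assumes "multilinear_form V p a" "length w = p" "set w \<subseteq> V" "k < p" "x \<in> V" "y \<in> V"
  shows "a (w[k := c *\<^sub>R x + d *\<^sub>R y]) = c * a (w[k := x]) + d * a (w[k := y])"
  using assms unfolding multilinear_form_def by blast

lemma multilinear_form_slot:
  assumes "multilinear_form V p a" "length as + length bs + 1 = p" "set as \<subseteq> V" "set bs \<subseteq> V"
    "x \<in> V" "y \<in> V"
  shows "a (as @ (c *\<^sub>R x + d *\<^sub>R y) # bs) = c * a (as @ x # bs) + d * a (as @ y # bs)"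
  using multilinear_formD[OF assms(1), of "as @ x # bs" "length as" x y c d] assms(2-) by simp

lemma alternating_form_swap:
  assumes "alternating_form V p a" "length as + length bs + 2 = p" "set as \<subseteq> V" "set bs \<subseteq> V"
    "x \<in> V" "y \<in> V"
  shows "a (as @ y # x # bs) = - a (as @ x # y # bs)"
proof -
  have "set (as @ x # y # bs) \<subseteq> V \<and> length (as @ x # y # bs) = p" using assms by auto
  then show ?thesis using assms(1) unfolding alternating_form_def by blast
qed

lemma multilinear_form_sum:
  assumes "multilinear_form V p a" "subspace V" "finite K"
    "length as + length bs + 1 = p" "set as \<subseteq> V" "set bs \<subseteq> V" "\<And>k. k \<in> K \<Longrightarrow> v k \<in> V"
  shows "a (as @ (\<Sum>k\<in>K. c k *\<^sub>R v k) # bs) = (\<Sum>k\<in>K. c k * a (as @ v k # bs))"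
  using assms(3,7)
proof (induction K rule: finite_induct)
  case empty
  have "0 \<in> V" using assms(2) by (simp add: subspace_0)
  then have "a (as @ (0 *\<^sub>R 0 + 0 *\<^sub>R 0) # bs) = 0"
    using multilinear_form_slot[OF assms(1,4,5,6), of 0 0 0 0] by simp
  then show ?case by simp
next
  case (insert k K)
  have "(\<Sum>k\<in>K. c k *\<^sub>R v k) \<in> V"
    using assms(2) insert.prems by (intro subspace_sum subspace_scale) auto
  then show ?case
    using multilinear_form_slot[OF assms(1,4,5,6), of "v k" "\<Sum>k\<in>K. c k *\<^sub>R v k" "c k" 1] insert
    by simp
qed

lemma alternating_form_move:
  assumes "alternating_form V p a" "length as + length bs + length cs + 1 = p"
    "set as \<subseteq> V" "set bs \<subseteq> V" "set cs \<subseteq> V" "x \<in> V"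
  shows "a (as @ x # bs @ cs) = (-1) ^ length bs * a (as @ bs @ x # cs)"
  using assms(2-5)
proof (induction bs arbitrary: as)
  case (Cons b bs)
  have "a (as @ x # b # bs @ cs) = - a (as @ b # x # bs @ cs)"
    using alternating_form_swap[OF assms(1), of as "bs @ cs" b x] Cons.prems assms(6) by simp
  also have "a (as @ b # x # bs @ cs) = (-1) ^ length bs * a (as @ b # bs @ x # cs)"
    using Cons.IH[of "as @ [b]"] Cons.prems by simp
  finally show ?case by simp
qed simp

lemma alternating_form_not_distinct:
  assumes "alternating_form V p a" "length w = p" "set w \<subseteq> V" "\<not> distinct w"
  shows "a w = 0"
proof -
  obtain xs ys zs y where w: "w = xs @ [y] @ ys @ [y] @ zs"
    using not_distinct_decomp[OF assms(4)] by blast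
  have "a w = (-1) ^ length ys * a (xs @ ys @ y # y # zs)"
    using alternating_form_move[OF assms(1), of xs ys "y # zs" y] assms(2,3) w by simp
  moreover have "a (xs @ ys @ y # y # zs) = 0"
    using alternating_form_swap[OF assms(1), of "xs @ ys" zs y y] assms(2,3) w by simp
  ultimately show ?thesis by simp
qed

text \<open>Only vanishing is carried along a reordering, so the sign of the permutation between the
  two lists is never computed.\<close>

lemma alternating_form_perm_zero:
  assumes "alternating_form V p a" "length w = p" "set w \<subseteq> V" "mset w = mset w'" "a w' = 0"
  shows "a w = 0"
proof -
  have *: "a (as @ w) = 0"
    if "mset w = mset w'" "length as + length w = p" "set as \<subseteq> V" "set w \<subseteq> V" "a (as @ w') = 0"
    for as w w'
    using that
  proof (induction w arbitrary: as w')
    case (Cons x w)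
    then have "x \<in> set w'" by (metis list.set_intros(1) mset_eq_setD)
    then obtain bs cs where w': "w' = bs @ x # cs" by (meson split_list)
    have m: "mset w = mset (bs @ cs)" using Cons.prems(1) w' by simp
    have s: "set w = set bs \<union> set cs" using m by (metis mset_eq_setD set_append)
    have l: "length w = length bs + length cs" using m by (metis length_append mset_eq_length)
    have "a (as @ x # bs @ cs) = 0"
      using alternating_form_move[OF assms(1), of as bs cs x] Cons.prems w' s l by simp
    then show ?case using Cons.IH[OF m, of "as @ [x]"] Cons.prems by simp
  qed simp
  show ?thesis using *[of w w' "[]"] assms(2-5) by simp
qed

text \<open>Multilinearity reduces to tuples of frame vectors, and a repetition gives 0, so distinct
  index lists remain. Two forms are later identified by applying this to their difference.\<close>

lemma alternating_form_eq_0I: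
  assumes a: "alternating_form V p a" and V: "subspace V" and K: "finite K"
    and v: "\<And>k. k \<in> K \<Longrightarrow> v k \<in> V" and expand: "\<And>x. x \<in> V \<Longrightarrow> x = (\<Sum>k\<in>K. c k x *\<^sub>R v k)"
    and zero: "\<And>ks. distinct ks \<Longrightarrow> set ks \<subseteq> K \<Longrightarrow> length ks = p \<Longrightarrow> a (map v ks) = 0"
    and w: "length w = p" "set w \<subseteq> V"
  shows "a w = 0"
proof -
  have m: "multilinear_form V p a" using a by (simp add: alternating_form_def)
  have all: "a (map v ks) = 0" if "set ks \<subseteq> K" "length ks = p" for ks
  proof (cases "distinct ks")
    case False
    then have "\<not> distinct (map v ks)" by (simp add: distinct_map)
    then show ?thesis using alternating_form_not_distinct[OF a, of "map v ks"] that v by auto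
  qed (use zero that in auto)
  \<comment> \<open>Arguments are expanded from the last to the first: \<open>w\<close> is the part
    still arbitrary, \<open>map v ks\<close> the part already replaced by frame vectors.\<close>
  have "a (w @ map v ks) = 0" if "set ks \<subseteq> K" "length w + length ks = p" "set w \<subseteq> V" for w ks
    using that
  proof (induction w arbitrary: ks rule: rev_induct)
    case (snoc x w)
    have "a (w @ (\<Sum>k\<in>K. c k x *\<^sub>R v k) # map v ks) = (\<Sum>k\<in>K. c k x * a (w @ v k # map v ks))"
      by (rule multilinear_form_sum[OF m V K]) (use snoc.prems v in auto)
    also have "\<dots> = 0"
      using snoc.IH[of "_ # ks"] snoc.prems by (intro sum.neutral) auto
    finally show ?case using expand[of x] snoc.prems by simp
  qed (use all in simp)
  from this[of "[]" w] w show ?thesis by simp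
qed

section \<open>Wedge products of multilinear forms\<close>

lemma map_permuted_update:
  assumes "\<pi> permutes {..<n}" "length w = n" "k < n" "r \<le> s" "s \<le> n"
  shows "map (\<lambda>i. w[k := z] ! \<pi> i) [r..<s] =
    (if r \<le> inv \<pi> k \<and> inv \<pi> k < s then (map (\<lambda>i. w ! \<pi> i) [r..<s])[inv \<pi> k - r := z]
     else map (\<lambda>i. w ! \<pi> i) [r..<s])" (is "?l = ?r")
proof (rule nth_equalityI)
  show "length ?l = length ?r" by simp
next
  fix i assume "i < length ?l"
  then have i: "i < s - r" by simp
  have "\<pi> (r + i) < n" using permutes_in_image[OF assms(1), of "r + i"] i assms by simp
  moreover have "\<pi> (r + i) = k \<longleftrightarrow> inv \<pi> k = r + i"
    using permutes_inverses[OF assms(1)] by metis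
  ultimately show "?l ! i = ?r ! i"
    using i assms(2,3) by (cases "inv \<pi> k = r + i") (auto simp: nth_list_update)
qed

lemma multilinear_form_wedge:
  assumes a: "multilinear_form V p a" and b: "multilinear_form V q b"
  shows "multilinear_form V (p + q) (wedge p q a b)"
  unfolding multilinear_form_def
proof (intro allI impI, elim conjE)
  fix w :: "'a list" and k x y c d
  assume w: "length w = p + q" "set w \<subseteq> V" "k < p + q" "x \<in> V" "y \<in> V"
  let ?L = "\<lambda>\<pi> w. map (\<lambda>i. w ! \<pi> i) [0..<p]" and ?R = "\<lambda>\<pi> w. map (\<lambda>i. w ! \<pi> i) [p..<p+q]"
  have *: "a (?L \<pi> (w[k := c *\<^sub>R x + d *\<^sub>R y])) * b (?R \<pi> (w[k := c *\<^sub>R x + d *\<^sub>R y])) =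
      c * (a (?L \<pi> (w[k := x])) * b (?R \<pi> (w[k := x])))
      + d * (a (?L \<pi> (w[k := y])) * b (?R \<pi> (w[k := y])))"
    if \<pi>: "\<pi> permutes {..<p+q}" for \<pi>
  proof -
    have lt: "\<pi> i < p + q" if "i < p + q" for i
      using permutes_in_image[OF \<pi>, of i] that by simp
    have sub: "set (?L \<pi> w) \<subseteq> V" "set (?R \<pi> w) \<subseteq> V"
      using w lt by (auto intro!: subsetD[OF w(2)])
    have inv: "inv \<pi> k < p + q"
      using permutes_in_image[OF permutes_inv[OF \<pi>], of k] w(3) by simp
    note upd = map_permuted_update[OF \<pi> w(1) w(3), of 0 p] map_permuted_update[OF \<pi> w(1) w(3), of p "p+q"]
    \<comment> \<open>The altered argument sits at position \<open>inv \<pi> k\<close> of the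
      permuted list, so exactly one of the two factors sees it and the other one is a
      constant.\<close>
    show ?thesis
    proof (cases "inv \<pi> k < p")
      case True
      then show ?thesis
        using multilinear_formD[OF a _ sub(1) True w(4,5), of c d]
        by (simp add: upd algebra_simps)
    next
      case False
      then show ?thesis
        using multilinear_formD[OF b _ sub(2) _ w(4,5), of "inv \<pi> k - p" c d] inv
        by (simp add: upd algebra_simps)
    qed
  qed
  have "wedge p q a b (w[k := c *\<^sub>R x + d *\<^sub>R y]) =
     (\<Sum>\<pi> | \<pi> permutes {..<p+q}. c * (of_int (sign \<pi>) * a (?L \<pi> (w[k := x])) * b (?R \<pi> (w[k := x])))
      + d * (of_int (sign \<pi>) * a (?L \<pi> (w[k := y])) * b (?R \<pi> (w[k := y])))) / (fact p * fact q)"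
    unfolding wedge_def mult.assoc
    by (intro arg_cong2[where f="(/)"] refl sum.cong) (simp add: * algebra_simps)
  then show "wedge p q a b (w[k := c *\<^sub>R x + d *\<^sub>R y]) = c * wedge p q a b (w[k := x]) + d * wedge p q a b (w[k := y])"
    unfolding wedge_def sum.distrib sum_distrib_left[symmetric] by (simp add: add_divide_distrib)
qed

lemma nth_swap_adjacent:
  "(as @ y # x # bs) ! i = (as @ x # y # bs) ! Transposition.transpose (length as) (Suc (length as)) i"
proof -
  consider "i < length as" | "i = length as" | "i = Suc (length as)" | "i > Suc (length as)" by linarith
  then show ?thesis
    by cases (auto simp: nth_append transpose_def nth_Cons split: nat.splits)
qed

lemma sum_permutations_swap:
  fixes G :: "(nat \<Rightarrow> nat) \<Rightarrow> real"
  assumes "i < n" "j < n" "i \<noteq> j"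
  shows "(\<Sum>\<pi> | \<pi> permutes {..<n}. of_int (sign \<pi>) * G (Transposition.transpose i j \<circ> \<pi>))
     = - (\<Sum>\<pi> | \<pi> permutes {..<n}. of_int (sign \<pi>) * G \<pi>)"
proof -
  let ?t = "Transposition.transpose i j"
  have t: "?t permutes {..<n}" using assms by (intro permutes_swap_id) auto
  have s: "sign (?t \<circ> \<pi>) = - sign \<pi>" if "\<pi> permutes {..<n}" for \<pi>
    using sign_compose[of ?t \<pi>] permutes_imp_permutation[OF _ t] permutes_imp_permutation[OF _ that] assms(3)
    by (simp add: sign_swap_id)
  have "(\<Sum>\<pi> | \<pi> permutes {..<n}. of_int (sign \<pi>) * G \<pi>)
      = (\<Sum>\<pi> | \<pi> permutes {..<n}. of_int (sign (?t \<circ> \<pi>)) * G (?t \<circ> \<pi>))"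
    by (rule setum_permutations_compose_left[OF t])
  also have "\<dots> = (\<Sum>\<pi> | \<pi> permutes {..<n}. - (of_int (sign \<pi>) * G (?t \<circ> \<pi>)))"
    by (intro sum.cong refl) (simp add: s)
  finally show ?thesis by (simp add: sum_negf)
qed

text \<open>The signed sum antisymmetrises whatever it is given, so multilinear factors suffice: a
  swap of neighbours is absorbed by composing every permutation with a transposition.\<close>

lemma alternating_form_wedge:
  assumes "multilinear_form V p a" "multilinear_form V q b"
  shows "alternating_form V (p + q) (wedge p q a b)"
  unfolding alternating_form_def
proof (intro conjI allI impI multilinear_form_wedge assms, elim conjE)
  fix as bs :: "'a list" and x y
  assume l: "length (as @ x # y # bs) = p + q"
  define G where "G \<pi> = a (map (\<lambda>i. (as @ x # y # bs) ! \<pi> i) [0..<p])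
    * b (map (\<lambda>i. (as @ x # y # bs) ! \<pi> i) [p..<p+q])" for \<pi>
  show "wedge p q a b (as @ y # x # bs) = - wedge p q a b (as @ x # y # bs)"
    using sum_permutations_swap[of "length as" "p + q" "Suc (length as)" G] l
    unfolding wedge_def mult.assoc nth_swap_adjacent[of as y x bs] by (simp add: G_def)
qed

section \<open>The volume form as a determinant of coordinates\<close>

definition vol :: "nat \<Rightarrow> (nat \<Rightarrow> 'v \<Rightarrow> real) \<Rightarrow> 'v form" where
  "vol n c w = (\<Sum>\<pi> | \<pi> permutes {..<n}. of_int (sign \<pi>) * (\<Prod>k<n. c k (w ! \<pi> k)))"

lemma alternating_form_vol:
  assumes lin: "\<And>k x y r s. k < n \<Longrightarrow> x \<in> V \<Longrightarrow> y \<in> V \<Longrightarrow> c k (r *\<^sub>R x + s *\<^sub>R y) = r * c k x + s * c k y"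
  shows "alternating_form V n (vol n c)"
  unfolding alternating_form_def
proof (intro conjI allI impI, goal_cases)
  case 1
  show ?case unfolding multilinear_form_def
  proof (intro allI impI, elim conjE)
    fix w :: "'a list" and j x y r s
    assume w: "length w = n" "set w \<subseteq> V" "j < n" "x \<in> V" "y \<in> V"
    have *: "(\<Prod>k<n. c k (w[j := z] ! \<pi> k)) = c (inv \<pi> j) z * (\<Prod>k\<in>{..<n} - {inv \<pi> j}. c k (w ! \<pi> k))"
      if \<pi>: "\<pi> permutes {..<n}" for \<pi> z
    proof -
      have i: "inv \<pi> j \<in> {..<n}" using permutes_in_image[OF permutes_inv[OF \<pi>], of j] w(3) by simp
      have "\<pi> (inv \<pi> j) = j" using permutes_inverses[OF \<pi>] by simp
      moreover have "j \<noteq> \<pi> k" if "k \<noteq> inv \<pi> j" for k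
        using permutes_inverses[OF \<pi>] that by auto
      then have "(\<Prod>k\<in>{..<n} - {inv \<pi> j}. c k (w[j := z] ! \<pi> k)) = (\<Prod>k\<in>{..<n} - {inv \<pi> j}. c k (w ! \<pi> k))"
        by (intro prod.cong) simp_all
      ultimately show ?thesis using w(1,3) by (subst prod.remove[OF _ i]) simp_all
    qed
    have i: "inv \<pi> j < n" if \<pi>: "\<pi> permutes {..<n}" for \<pi>
      using permutes_in_image[OF permutes_inv[OF \<pi>], of j] w(3) by simp
    have "vol n c (w[j := r *\<^sub>R x + s *\<^sub>R y]) = (\<Sum>\<pi> | \<pi> permutes {..<n}.
        r * (of_int (sign \<pi>) * (\<Prod>k<n. c k (w[j := x] ! \<pi> k)))
      + s * (of_int (sign \<pi>) * (\<Prod>k<n. c k (w[j := y] ! \<pi> k))))"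
      unfolding vol_def by (intro sum.cong refl) (simp add: * i lin w algebra_simps)
    then show "vol n c (w[j := r *\<^sub>R x + s *\<^sub>R y]) = r * vol n c (w[j := x]) + s * vol n c (w[j := y])"
      by (simp add: vol_def sum.distrib sum_distrib_left)
  qed
next
  case (2 as x y bs)
  define G where "G \<pi> = (\<Prod>k<n. c k ((as @ x # y # bs) ! \<pi> k))" for \<pi>
  show ?case
    using sum_permutations_swap[of "length as" n "Suc (length as)" G] 2
    unfolding vol_def nth_swap_adjacent[of as y x bs] by (simp add: G_def)
qed

lemma vol_basis:
  assumes "\<And>k l. k < n \<Longrightarrow> l < n \<Longrightarrow> c k (v l) = (if k = l then 1 else 0)"
  shows "vol n c (map v [0..<n]) = 1"
proof -
  have lt: "\<pi> k < n" if "\<pi> permutes {..<n}" "k < n" for \<pi> k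
    using permutes_in_image[OF that(1), of k] that(2) by simp
  have "(\<Prod>k<n. c k (map v [0..<n] ! \<pi> k)) = (if \<pi> = id then 1 else 0)" if \<pi>: "\<pi> permutes {..<n}" for \<pi>
  proof (cases "\<pi> = id")
    case False
    then obtain k where k: "\<pi> k \<noteq> k" by (auto simp: fun_eq_iff)
    then have "k < n" using \<pi> unfolding permutes_def by auto
    then have "\<exists>k<n. c k (map v [0..<n] ! \<pi> k) = 0"
      using k lt[OF \<pi>] by (intro exI[of _ k]) (auto simp: assms)
    then show ?thesis using False by auto
  qed (simp add: assms)
  then have "vol n c (map v [0..<n]) = (\<Sum>\<pi> | \<pi> permutes {..<n}. if \<pi> = id then 1 else 0)"
    unfolding vol_def by (intro sum.cong refl) auto
  also have "\<dots> = 1"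
    by (subst sum.delta) (auto simp: finite_permutations permutes_id)
  finally show ?thesis .
qed

section \<open>Endomorphisms acting on forms and the Chevalley-Eilenberg differential\<close>

definition derivation_form :: "('v \<Rightarrow> 'v) \<Rightarrow> 'v form \<Rightarrow> 'v form" where
  "derivation_form f a w = (\<Sum>k<length w. a (w[k := f (w ! k)]))"

lemma derivation_form_Cons:
  "derivation_form f a (x # w) = a (f x # w) + derivation_form f (\<lambda>u. a (x # u)) w"
  by (simp add: derivation_form_def sum.lessThan_Suc_shift del: sum.lessThan_Suc)

lemma derivation_form_append:
  "derivation_form f a (u @ w) = derivation_form f (\<lambda>u. a (u @ w)) u + derivation_form f (\<lambda>w. a (u @ w)) w"
  by (induction u arbitrary: a) (simp_all add: derivation_form_Cons, simp add: derivation_form_def)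

lemma alternating_form_derivation:
  assumes a: "alternating_form V p a" and f: "\<And>x. x \<in> V \<Longrightarrow> f x \<in> V" and V: "subspace V"
    and lin: "\<And>x y r s. x \<in> V \<Longrightarrow> y \<in> V \<Longrightarrow> f (r *\<^sub>R x + s *\<^sub>R y) = r *\<^sub>R f x + s *\<^sub>R f y"
  shows "alternating_form V p (derivation_form f a)"
  unfolding alternating_form_def
proof (intro conjI allI impI, goal_cases)
  case 1
  have m: "multilinear_form V p a" using a by (simp add: alternating_form_def)
  show ?case unfolding multilinear_form_def
  proof (intro allI impI, elim conjE)
    fix w :: "'a list" and j x y r s
    assume w: "length w = p" "set w \<subseteq> V" "j < p" "x \<in> V" "y \<in> V"
    have *: "a (w[j := r *\<^sub>R x + s *\<^sub>R y, k := f (w[j := r *\<^sub>R x + s *\<^sub>R y] ! k)])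
       = r * a (w[j := x, k := f (w[j := x] ! k)]) + s * a (w[j := y, k := f (w[j := y] ! k)])"
      if k: "k < p" for k
    proof (cases "k = j")
      case True
      then show ?thesis using multilinear_formD[OF m w(1,2,3), of "f x" "f y" r s] w f by (simp add: lin)
    next
      case False
      have "w ! k \<in> V" using w k by auto
      then have "set (w[k := f (w ! k)]) \<subseteq> V" using f[of "w ! k"] set_update_subset_insert[of w k] w(2) by blast
      then show ?thesis
        using multilinear_formD[OF m _ _ w(3-5), of "w[k := f (w ! k)]" r s] w(1) False
        by (simp add: list_update_swap[of j k])
    qed
    then show "derivation_form f a (w[j := r *\<^sub>R x + s *\<^sub>R y]) =
        r * derivation_form f a (w[j := x]) + s * derivation_form f a (w[j := y])"
      using w(1) by (simp add: derivation_form_def sum_distrib_left sum.distrib)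
  qed
next
  case (2 as x y bs)
  have upd: "set (u[k := f (u ! k)]) \<subseteq> V" if "k < length u" "set u \<subseteq> V" for u k
    using set_update_subset_insert[of u k "f (u ! k)"] f[of "u ! k"] that nth_mem[of k u] by blast
  from 2 have w: "set as \<subseteq> V" "set bs \<subseteq> V" "x \<in> V" "y \<in> V" "length as + length bs + 2 = p" by auto
  note swap = alternating_form_swap[OF a]
  have "a (as @ f y # x # bs) = - a (as @ x # f y # bs)" "a (as @ y # f x # bs) = - a (as @ f x # y # bs)"
    using swap[OF w(5,1,2), of x "f y"] swap[OF w(5,1,2), of "f x" y] w f by auto
  moreover have "a (as[k := f (as ! k)] @ y # x # bs) = - a (as[k := f (as ! k)] @ x # y # bs)"
    if "k < length as" for k using swap[of "as[k := f (as ! k)]" bs x y] upd[of k as] w that by simp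
  moreover have "a (as @ y # x # bs[k := f (bs ! k)]) = - a (as @ x # y # bs[k := f (bs ! k)])"
    if "k < length bs" for k using swap[of as "bs[k := f (bs ! k)]" x y] upd[of k bs] w that by simp
  ultimately show ?case
    unfolding derivation_form_append derivation_form_Cons
    by (simp add: derivation_form_def sum_negf)
qed

lemma alternating_form_lincomb:
  assumes a: "alternating_form V p a" and b: "alternating_form V p b"
  shows "alternating_form V p (\<lambda>w. r * a w + s * b w)"
  unfolding alternating_form_def
proof (intro conjI allI impI, goal_cases)
  case 1
  have m: "multilinear_form V p a" "multilinear_form V p b" using a b by (simp_all add: alternating_form_def)
  show ?case unfolding multilinear_form_def
  proof (intro allI impI, elim conjE)
    fix w :: "'a list" and k x y c d
    assume w: "length w = p" "set w \<subseteq> V" "k < p" "x \<in> V" "y \<in> V"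
    show "r * a (w[k := c *\<^sub>R x + d *\<^sub>R y]) + s * b (w[k := c *\<^sub>R x + d *\<^sub>R y]) =
        c * (r * a (w[k := x]) + s * b (w[k := x])) + d * (r * a (w[k := y]) + s * b (w[k := y]))"
      unfolding multilinear_formD[OF m(1) w] multilinear_formD[OF m(2) w] by (simp add: algebra_simps)
  qed
next
  case (2 as x y bs)
  then show ?case
    using alternating_form_swap[OF a, of as bs x y] alternating_form_swap[OF b, of as bs x y] by simp
qed

lemma nths_remove1: "nths (Q @ y # R) (- {length Q}) = Q @ R"
proof (induction Q)
  case Nil
  show ?case by (simp add: nths_Cons nths_all)
next
  case (Cons a Q)
  have "{j. Suc j \<in> - {length (a # Q)}} = - {length Q}" by auto
  then show ?case using Cons by (simp add: nths_Cons)
qed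

lemma nths_remove2:
  "nths (P @ x # Q @ y # R) (- {length P, Suc (length P + length Q)}) = P @ Q @ R"
proof (induction P)
  case Nil
  have "{j. Suc j \<in> - {0, Suc (length Q)}} = - {length Q}" by auto
  then show ?case using nths_remove1[of Q y R] by (simp add: nths_Cons)
next
  case (Cons a P)
  have "{j. Suc j \<in> - {length (a # P), Suc (length (a # P) + length Q)}} = - {length P, Suc (length P + length Q)}"
    by auto
  then show ?case using Cons by (simp add: nths_Cons)
qed

lemma list_split2:
  assumes "i < j" "j < length z"
  obtains P x Q y R where "z = P @ x # Q @ y # R" "length P = i" "Suc (length P + length Q) = j"
proof -
  have "z = take i z @ z ! i # take (j - Suc i) (drop (Suc i) z) @ z ! j # drop (Suc j) z"
    using id_take_nth_drop[of i z] id_take_nth_drop[of "j - Suc i" "drop (Suc i) z"] assms by simp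
  then show ?thesis by (rule that) (use assms in auto)
qed

abbreviation remove_nth :: "nat \<Rightarrow> 'a list \<Rightarrow> 'a list" where
  "remove_nth i z \<equiv> take i z @ drop (Suc i) z"

text \<open>Each pair \<open>i < j\<close> occurs twice on the right, once with \<open>z ! i\<close>
  acting on \<open>z ! j\<close> and once the other way round; hence the factor 2. Since
  \<open>derivation_form (br x)\<close> is minus the Lie derivative along \<open>x\<close>, the
  differential is expressed by Lie derivatives, and invariance of the volume form becomes
  usable.\<close>

lemma ce_differential_derivation:
  assumes a: "alternating_form V p a"
    and br: "\<And>x y. x \<in> V \<Longrightarrow> y \<in> V \<Longrightarrow> br x y \<in> V" "\<And>x y. x \<in> V \<Longrightarrow> y \<in> V \<Longrightarrow> br y x = - br x y"
    and V: "subspace V" and z: "length z = Suc p" "set z \<subseteq> V"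
  shows "2 * ce_differential br p a z =
    - (\<Sum>i\<le>p. (-1) ^ i * derivation_form (br (z ! i)) a (remove_nth i z))"
proof -
  define S where "S = {(i, j). i < j \<and> j \<le> p}"
  define T where "T i j = (-1) ^ (i + j) * a (br (z ! i) (z ! j) # nths z (- {i, j}))" for i j
  define t where "t i k = (-1) ^ i * a ((remove_nth i z)[k := br (z ! i) (remove_nth i z ! k)])" for i k
  \<comment> \<open>Removing entry \<open>i\<close> shifts the later ones down, so
    \<open>z ! j\<close> is at position \<open>j - 1\<close> of \<open>remove_nth i z\<close>, while
    \<open>z ! i\<close> keeps its position in \<open>remove_nth j z\<close>.\<close>
  have T: "T i j = - t j i" "T i j = - t i (j - 1)" if ij: "i < j" "j \<le> p" for i j
  proof -
    obtain P x Q y R where s: "z = P @ x # Q @ y # R" "length P = i" "Suc (length P + length Q) = j"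
      by (rule list_split2[of i j z]) (use ij z(1) in auto)
    have V': "set P \<subseteq> V" "set Q \<subseteq> V" "set R \<subseteq> V" "x \<in> V" "y \<in> V" using z(2) s(1) by auto
    have l: "length P + length Q + length R + 1 = p" using z(1) s(1) by simp
    have nth: "z ! i = x" "z ! j = y"
      using s(2,3) unfolding s(1) by (auto simp: nth_append)
    have T1: "T i j = (-1) ^ (i + j) * a (br x y # P @ Q @ R)"
      unfolding T_def nth unfolding s(1) using nths_remove2[of P x Q y R] s(2,3) by simp
    have ri: "remove_nth i z = P @ Q @ y # R" using s(1,2) by simp
    have rj: "remove_nth j z = P @ x # Q @ R"
    proof -
      have "take j z = P @ x # Q" "drop (Suc j) z = R" using s(3) unfolding s(1) by auto
      then show ?thesis by simp
    qed
    have j1: "j - 1 = length (P @ Q)" using s(3) by simp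
    have ti: "t i (j - 1) = (-1) ^ i * a (P @ Q @ br x y # R)"
      unfolding t_def nth ri unfolding j1
      using nth_append_length[of "P @ Q" y R] list_update_length[of "P @ Q" y R] by simp
    have tj: "t j i = (-1) ^ j * a (P @ (- br x y) # Q @ R)"
      unfolding t_def nth rj using s(2) br(2)[OF V'(4,5)]
        nth_append_length[of "P" x "Q @ R"] list_update_length[of P x "Q @ R"] by simp
    have m: "multilinear_form V p a" using a by (simp add: alternating_form_def)
    have neg: "a (P @ (- br x y) # Q @ R) = - a (P @ br x y # Q @ R)"
      using multilinear_form_slot[OF m, of P "Q @ R" "br x y" "br x y" "-1" 0] V' l br(1) by simp
    have m1: "a (br x y # P @ Q @ R) = (-1) ^ i * a (P @ br x y # Q @ R)"
      using alternating_form_move[OF a, of "[]" P "Q @ R" "br x y"] V' l br(1) s(2) by simp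
    have m2: "a (br x y # P @ Q @ R) = (-1) ^ (j - 1) * a (P @ Q @ br x y # R)"
      using alternating_form_move[OF a, of "[]" "P @ Q" R "br x y"] V' l br(1) j1 by simp
    show "T i j = - t j i"
      unfolding T1 tj m1 neg by (simp add: power_add flip: power_mult_distrib) 
    have "(-1::real) ^ (i + j) * (-1) ^ (j - 1) = - ((-1) ^ i)"
      using ij(1) by (cases j) (simp_all add: power_add flip: power_mult_distrib)
    then show "T i j = - t i (j - 1)"
      unfolding T1 ti m2 by (simp add: mult.assoc[symmetric])
  qed
  have neg: "(\<Sum>(i,j)\<in>S. - T i j) = - (\<Sum>(i,j)\<in>S. T i j)"
    unfolding sum_negf[symmetric] by (intro sum.cong refl) auto
  have len: "length (remove_nth i z) = p" if "i \<le> p" for i using that z(1) by simp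
  have 1: "(\<Sum>i\<le>p. (-1) ^ i * derivation_form (br (z ! i)) a (remove_nth i z)) = (\<Sum>(i,k)\<in>{..p} \<times> {..<p}. t i k)"
    unfolding derivation_form_def t_def sum.cartesian_product[symmetric]
    by (intro sum.cong refl) (simp add: len sum_distrib_left del: length_append)
  have 2: "{..p} \<times> {..<p} = {(i,k). i \<le> p \<and> k < i} \<union> {(i,k). i \<le> k \<and> k < p}" by auto
  have 3: "(\<Sum>(i,k)\<in>{(i,k). i \<le> p \<and> k < i} \<union> {(i,k). i \<le> k \<and> k < p}. t i k)
    = (\<Sum>(i,k)\<in>{(i,k). i \<le> p \<and> k < i}. t i k) + (\<Sum>(i,k)\<in>{(i,k). i \<le> k \<and> k < p}. t i k)"
    by (rule sum.union_disjoint; (rule finite_subset[of _ "{..p} \<times> {..p}"])?) auto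
  have 4: "(\<Sum>(i,k)\<in>{(i,k). i \<le> p \<and> k < i}. t i k) = (\<Sum>(i,j)\<in>S. - T i j)"
    by (rule sum.reindex_bij_witness[of _ "\<lambda>(i,j). (j,i)" "\<lambda>(i,j). (j,i)"]) (auto simp: S_def T(1))
  have 5: "(\<Sum>(i,k)\<in>{(i,k). i \<le> k \<and> k < p}. t i k) = (\<Sum>(i,j)\<in>S. - T i j)"
    by (rule sum.reindex_bij_witness[of _ "\<lambda>(i,j). (i,j-1)" "\<lambda>(i,k). (i,Suc k)"]) (auto simp: S_def T(2))
  have 6: "ce_differential br p a z = (\<Sum>(i,j)\<in>S. T i j)"
    unfolding ce_differential_def S_def T_def by (rule refl)
  show ?thesis unfolding 1 2 3 4 5 6 neg by (simp only: minus_add_distrib minus_minus mult_2)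
qed

text \<open>Moving \<open>g (z ! i)\<close> back into slot \<open>i\<close> turns the sum into minus
  the action of \<open>g\<close> on the arguments after \<open>y\<close>. As \<open>g\<close>
  annihilates \<open>a\<close>, this equals its action on \<open>y\<close>.\<close>

lemma alternating_form_derivation_contract:
  assumes a: "alternating_form V (Suc p) a"
    and g: "\<And>x. x \<in> V \<Longrightarrow> g x \<in> V"
    and zero: "\<And>w. length w = Suc p \<Longrightarrow> set w \<subseteq> V \<Longrightarrow> derivation_form g a w = 0"
    and z: "length z = p" "set z \<subseteq> V" "y \<in> V"
  shows "(\<Sum>i<p. (-1) ^ i * a (g (z ! i) # y # remove_nth i z)) = a (g y # z)"
proof -
  have "(-1) ^ i * a (g (z ! i) # y # remove_nth i z) = - a (y # z[i := g (z ! i)])" if i: "i < p" for i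
  proof -
    have s: "set (take i z) \<subseteq> V" "set (drop (Suc i) z) \<subseteq> V" "z ! i \<in> V"
      using z i set_take_subset[of i z] set_drop_subset[of "Suc i" z] by auto
    have "a (g (z ! i) # y # remove_nth i z) = (-1) ^ Suc i * a (y # take i z @ g (z ! i) # drop (Suc i) z)"
      using alternating_form_move[OF a, of "[]" "y # take i z" "drop (Suc i) z" "g (z ! i)"] s z i g by simp
    then show ?thesis using upd_conv_take_nth_drop[of i z "g (z ! i)"] i z(1)
      by (simp add: mult.assoc[symmetric] flip: power_mult_distrib)
  qed
  then have "(\<Sum>i<p. (-1) ^ i * a (g (z ! i) # y # remove_nth i z)) = - derivation_form g (\<lambda>u. a (y # u)) z"
    using z(1) by (simp add: derivation_form_def sum_negf)
  moreover have "derivation_form g a (y # z) = 0" using zero z by simp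
  ultimately show ?thesis by (simp add: derivation_form_Cons)
qed

text \<open>A basis \<open>v\<close> of \<open>V\<close> with its dual basis \<open>c\<close>.
  Everything is constrained on the set \<open>V\<close> only, because \<open>sl\<close> is a set of
  matrices and not a type.\<close>

locale dual_frame =
  fixes V :: "'v::real_vector set" and N :: nat and v :: "nat \<Rightarrow> 'v" and c :: "nat \<Rightarrow> 'v \<Rightarrow> real"
  assumes subspace: "subspace V"
    and frame: "\<And>k. k < N \<Longrightarrow> v k \<in> V"
    and coord_lincomb: "\<And>k x y r s. k < N \<Longrightarrow> x \<in> V \<Longrightarrow> y \<in> V \<Longrightarrow>
      c k (r *\<^sub>R x + s *\<^sub>R y) = r * c k x + s * c k y"
    and coord_frame: "\<And>k l. k < N \<Longrightarrow> l < N \<Longrightarrow> c k (v l) = (if k = l then 1 else 0)"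
    and expand: "\<And>x. x \<in> V \<Longrightarrow> x = (\<Sum>k<N. c k x *\<^sub>R v k)"
begin

lemma alternating_vol: "alternating_form V N (vol N c)"
  using coord_lincomb by (intro alternating_form_vol)

text \<open>A form of top degree is determined by its value on the frame. There, replacing slot
  \<open>k\<close> by \<open>f (v k)\<close> picks out the diagonal coefficient of \<open>f\<close>,
  so the total factor is the trace of \<open>f\<close>.\<close>

lemma derivation_vol:
  assumes f: "\<And>x. x \<in> V \<Longrightarrow> f x \<in> V"
    and lin: "\<And>x y r s. x \<in> V \<Longrightarrow> y \<in> V \<Longrightarrow> f (r *\<^sub>R x + s *\<^sub>R y) = r *\<^sub>R f x + s *\<^sub>R f y"
    and w: "length w = N" "set w \<subseteq> V"
  shows "derivation_form f (vol N c) w = (\<Sum>k<N. c k (f (v k))) * vol N c w"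
proof -
  define \<tau> where "\<tau> = (\<Sum>k<N. c k (f (v k)))"
  define F where "F w = 1 * derivation_form f (vol N c) w + (- \<tau>) * vol N c w" for w
  have F: "alternating_form V N F"
    unfolding F_def
    by (intro alternating_form_lincomb alternating_form_derivation alternating_vol f subspace lin)
  have m: "multilinear_form V N (vol N c)" using alternating_vol by (simp add: alternating_form_def)
  let ?b = "map v [0..<N]"
  have one: "vol N c ?b = 1" by (rule vol_basis) (simp add: coord_frame)
  have sb: "set ?b \<subseteq> V" using frame by auto
  have "vol N c (?b[k := f (v k)]) = c k (f (v k))" if k: "k < N" for k
  proof -
    have upd: "?b[k := x] = take k ?b @ x # drop (Suc k) ?b" for x
      using upd_conv_take_nth_drop[of k ?b x] k by simp
    have z: "vol N c (?b[k := v l]) = (if l = k then 1 else 0)" if l: "l < N" for l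
    proof (cases "l = k")
      case True
      then have "?b[k := v l] = ?b" using k by (simp add: list_update_same_conv)
      then show ?thesis using True one by simp
    next
      case False
      have "\<not> distinct (?b[k := v l])"
        using nth_eq_iff_index_eq[of "?b[k := v l]" k l] False k l by auto
      moreover have "set (?b[k := v l]) \<subseteq> V" using sb frame[OF l] set_update_subset_insert[of ?b k "v l"] by blast
      ultimately show ?thesis using alternating_form_not_distinct[OF alternating_vol, of "?b[k := v l]"] False by simp
    qed
    have "vol N c (?b[k := f (v k)]) = vol N c (take k ?b @ (\<Sum>l<N. c l (f (v k)) *\<^sub>R v l) # drop (Suc k) ?b)"
      using expand[OF f[OF frame[OF k]]] upd by simp
    also have "\<dots> = (\<Sum>l<N. c l (f (v k)) * vol N c (take k ?b @ v l # drop (Suc k) ?b))"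
      by (rule multilinear_form_sum[OF m subspace])
        (use k frame f set_take_subset[of k ?b] set_drop_subset[of "Suc k" ?b] sb in \<open>auto simp del: set_map set_upt\<close>)
    also have "\<dots> = (\<Sum>l<N. c l (f (v k)) * (if l = k then 1 else 0))"
      by (intro sum.cong refl) (simp add: z flip: upd)
    finally show ?thesis using k by (simp add: sum.delta' if_distrib cong: if_cong)
  qed
  then have "derivation_form f (vol N c) ?b = \<tau>" by (simp add: derivation_form_def \<tau>_def)
  then have Fb: "F ?b = 0" unfolding F_def one by simp
  have "F w = 0"
  proof (rule alternating_form_eq_0I[OF F subspace, of "{..<N}" v c])
    fix ks assume ks: "distinct ks" "set ks \<subseteq> {..<N}" "length ks = N"
    then have "set ks = set [0..<N]"
      by (intro card_subset_eq) (auto simp: distinct_card atLeast0LessThan)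
    then have "mset ks = mset [0..<N]" using ks(1) set_eq_iff_mset_eq_distinct distinct_upt by blast
    then have "mset (map v ks) = mset ?b" by simp
    then show "F (map v ks) = 0"
      using alternating_form_perm_zero[OF F, of "map v ks" ?b] Fb ks frame by auto
  qed (use frame expand w in auto)
  then show ?thesis by (simp add: F_def \<tau>_def)
qed

end

section \<open>Powers of a two-form\<close>

lemma alternating_two_form_power:
  assumes "multilinear_form V 2 a"
  shows "alternating_form V (2 * r) (two_form_power a r)"
proof (induction r)
  case 0
  show ?case by (simp add: alternating_form_def multilinear_form_def)
next
  case (Suc r)
  then have "multilinear_form V (2 * r) (two_form_power a r)" by (simp add: alternating_form_def)
  from alternating_form_wedge[OF assms this] show ?case by simp
qed

text \<open>The power sees its arguments only through the matrix of their pairings. This allows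
  values on different tuples to be compared without evaluating any of them.\<close>

lemma two_form_power_cong:
  assumes "\<And>i j. i < 2 * r \<Longrightarrow> j < 2 * r \<Longrightarrow> a [w ! i, w ! j] = a [w' ! i, w' ! j]"
  shows "two_form_power a r w = two_form_power a r w'"
  using assms
proof (induction r arbitrary: w w')
  case (Suc r)
  have "a (map (\<lambda>i. w ! \<pi> i) [0..<2]) = a (map (\<lambda>i. w' ! \<pi> i) [0..<2])"
    "two_form_power a r (map (\<lambda>i. w ! \<pi> i) [2..<2+2*r]) = two_form_power a r (map (\<lambda>i. w' ! \<pi> i) [2..<2+2*r])"
    if \<pi>: "\<pi> permutes {..<2+2*r}" for \<pi>
  proof -
    have lt: "\<pi> i < 2 * Suc r" if "i < 2 * Suc r" for i
      using permutes_in_image[OF \<pi>, of i] that by simp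
    show "a (map (\<lambda>i. w ! \<pi> i) [0..<2]) = a (map (\<lambda>i. w' ! \<pi> i) [0..<2])"
      using Suc.prems[of "\<pi> 0" "\<pi> 1"] lt by (simp add: upt_rec)
    have nth: "map (\<lambda>i. u ! \<pi> i) [2..<2+2*r] ! i = u ! \<pi> (2 + i)" if "i < 2 * r" for u :: "'a list" and i
      by (rule nth_map_upt) (use that in simp)
    show "two_form_power a r (map (\<lambda>i. w ! \<pi> i) [2..<2+2*r]) = two_form_power a r (map (\<lambda>i. w' ! \<pi> i) [2..<2+2*r])"
    proof (rule Suc.IH)
      fix i j assume "i < 2 * r" "j < 2 * r"
      then show "a [map (\<lambda>i. w ! \<pi> i) [2..<2+2*r] ! i, map (\<lambda>i. w ! \<pi> i) [2..<2+2*r] ! j] =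
        a [map (\<lambda>i. w' ! \<pi> i) [2..<2+2*r] ! i, map (\<lambda>i. w' ! \<pi> i) [2..<2+2*r] ! j]"
        unfolding nth[OF \<open>i < 2 * r\<close>] nth[OF \<open>j < 2 * r\<close>] by (intro Suc.prems lt) simp_all
    qed
  qed
  then show ?case by (simp add: wedge_def)
qed simp

text \<open>In every term of the expanded power, entry \<open>t\<close> is paired with some entry by
  a factor \<open>a\<close>, and that factor vanishes. The pairing occurs either in the first factor
  or, by induction, in the smaller power.\<close>

lemma two_form_power_isotropic:
  assumes "t < 2 * r" "\<And>i. i < 2 * r \<Longrightarrow> a [w ! t, w ! i] = 0 \<and> a [w ! i, w ! t] = 0"
  shows "two_form_power a r w = 0"
  using assms
proof (induction r arbitrary: w t)
  case (Suc r)
  have "a (map (\<lambda>i. w ! \<pi> i) [0..<2]) * two_form_power a r (map (\<lambda>i. w ! \<pi> i) [2..<2+2*r]) = 0"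
    if \<pi>: "\<pi> permutes {..<2+2*r}" for \<pi>
  proof -
    have lt: "\<pi> i < 2 * Suc r" if "i < 2 * Suc r" for i
      using permutes_in_image[OF \<pi>, of i] that by simp
    define s where "s = inv \<pi> t"
    have s: "\<pi> s = t" "s < 2 + 2 * r"
      using permutes_inverses[OF \<pi>] permutes_in_image[OF permutes_inv[OF \<pi>], of t] Suc.prems(1)
      by (auto simp: s_def)
    consider "s = 0" | "s = 1" | "s \<ge> 2" by linarith
    then show ?thesis
    proof cases
      case 3
      have nth: "map (\<lambda>i. w ! \<pi> i) [2..<2+2*r] ! i = w ! \<pi> (2 + i)" if "i < 2 * r" for i
        by (rule nth_map_upt) (use that in simp)
      have "two_form_power a r (map (\<lambda>i. w ! \<pi> i) [2..<2+2*r]) = 0"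
      proof (rule Suc.IH[of "s - 2"])
        show s2: "s - 2 < 2 * r" using 3 s by simp
        fix i assume i: "i < 2 * r"
        have "2 + (s - 2) = s" using 3 by simp
        with s(1) have "\<pi> (2 + (s - 2)) = t" by (simp only:)
        then show "a [map (\<lambda>i. w ! \<pi> i) [2..<2+2*r] ! (s - 2), map (\<lambda>i. w ! \<pi> i) [2..<2+2*r] ! i] = 0 \<and>
          a [map (\<lambda>i. w ! \<pi> i) [2..<2+2*r] ! i, map (\<lambda>i. w ! \<pi> i) [2..<2+2*r] ! (s - 2)] = 0"
          unfolding nth[OF s2] nth[OF i] using Suc.prems(2)[of "\<pi> (2 + i)"] lt[of "2 + i"] i by simp
      qed
      then show ?thesis by simp
    qed (use s lt Suc.prems(2)[of "\<pi> 0"] Suc.prems(2)[of "\<pi> 1"] in \<open>simp_all add: upt_rec\<close>)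
  qed
  note zero = this
  show ?case unfolding two_form_power.simps wedge_def mult.assoc
    by (rule trans[OF arg_cong2[where f="(/)", OF sum.neutral refl] div_0])
      (intro ballI, drule CollectD, simp only: zero mult_zero_right)
qed simp

section \<open>Unitary frames and the reduction of the balanced condition to a sum of
  brackets\<close>

locale hermitian_frame = dual_frame V "2 * n" v c
  for V :: "'v::real_vector set" and n :: nat and v :: "nat \<Rightarrow> 'v" and c :: "nat \<Rightarrow> 'v \<Rightarrow> real" +
  fixes J :: "'v \<Rightarrow> 'v" and br :: "'v \<Rightarrow> 'v \<Rightarrow> 'v"
  assumes J_lincomb: "\<And>x y r s. x \<in> V \<Longrightarrow> y \<in> V \<Longrightarrow> J (r *\<^sub>R x + s *\<^sub>R y) = r *\<^sub>R J x + s *\<^sub>R J y"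
    and J_in: "\<And>x. x \<in> V \<Longrightarrow> J x \<in> V"
    and J_even: "\<And>i. i < n \<Longrightarrow> J (v (2 * i)) = v (Suc (2 * i))"
    and J_odd: "\<And>i. i < n \<Longrightarrow> J (v (Suc (2 * i))) = - v (2 * i)"
    and br_in: "\<And>x y. x \<in> V \<Longrightarrow> y \<in> V \<Longrightarrow> br x y \<in> V"
    and br_anti: "\<And>x y. x \<in> V \<Longrightarrow> y \<in> V \<Longrightarrow> br y x = - br x y"
    and br_lincomb: "\<And>x y z r s. x \<in> V \<Longrightarrow> y \<in> V \<Longrightarrow> z \<in> V \<Longrightarrow>
      br z (r *\<^sub>R x + s *\<^sub>R y) = r *\<^sub>R br z x + s *\<^sub>R br z y"
    and unimodular: "\<And>x. x \<in> V \<Longrightarrow> (\<Sum>k<2*n. c k (br x (v k))) = 0"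
    and sum_br_frame: "(\<Sum>i<n. br (v (2 * i)) (v (Suc (2 * i)))) = 0"
begin

definition metric :: "'v \<Rightarrow> 'v \<Rightarrow> real" where
  "metric x y = (\<Sum>k<2*n. c k x * c k y)"

abbreviation \<omega> :: "'v form" where "\<omega> \<equiv> fundamental_form J metric"

lemma metric_lincomb:
  assumes "x \<in> V" "y \<in> V" "z \<in> V"
  shows "metric z (r *\<^sub>R x + s *\<^sub>R y) = r * metric z x + s * metric z y"
    and "metric (r *\<^sub>R x + s *\<^sub>R y) z = r * metric x z + s * metric y z"
  using assms unfolding metric_def
  by (simp_all add: coord_lincomb algebra_simps sum.distrib sum_distrib_left)

lemma metric_frame: "k < 2 * n \<Longrightarrow> l < 2 * n \<Longrightarrow> metric (v k) (v l) = (if k = l then 1 else 0)"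
proof -
  assume kl: "k < 2 * n" "l < 2 * n"
  then have "metric (v k) (v l) = (\<Sum>j<2*n. if j = k then if k = l then 1 else 0 else 0)"
    unfolding metric_def by (intro sum.cong refl) (simp add: coord_frame)
  then show ?thesis using kl by simp
qed

lemma metric_sym: "metric x y = metric y x"
  by (simp add: metric_def mult.commute)

lemma metric_pos:
  assumes "x \<in> V" "x \<noteq> 0"
  shows "metric x x > 0"
proof -
  have "\<exists>k<2*n. c k x \<noteq> 0"
  proof (rule ccontr)
    assume "\<not> ?thesis"
    then have "(\<Sum>k<2*n. c k x *\<^sub>R v k) = 0" by (intro sum.neutral) auto
    then show False using expand[OF assms(1)] assms(2) by simp
  qed
  then obtain k where "k < 2 * n" "c k x \<noteq> 0" by blast
  then show ?thesis
    unfolding metric_def by (intro sum_pos2[of _ k]) (auto simp: zero_less_mult_iff)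
qed

lemma frame_even_odd:
  assumes "k < 2 * n"
  obtains i where "i < n" "k = 2 * i" | i where "i < n" "k = Suc (2 * i)"
proof (cases "even k")
  case True
  then obtain i where "k = 2 * i" by (elim evenE)
  then show ?thesis using that(1)[of i] assms by simp
next
  case False
  then obtain i where "k = Suc (2 * i)" by (auto elim!: oddE)
  then show ?thesis using that(2)[of i] assms by simp
qed

lemma metric_J_frame:
  assumes "k < 2 * n" "l < 2 * n"
  shows "metric (J (v k)) (v l) = (if even k then if l = Suc k then 1 else 0 else if k = Suc l then - 1 else 0)"
  using assms(1)
proof (cases k rule: frame_even_odd)
  case (1 i)
  then show ?thesis using assms by (auto simp: J_even metric_frame)
next
  case (2 i)
  have "metric (J (v k)) (v l) = - metric (v (2 * i)) (v l)"
    using metric_lincomb(2)[of "v (2 * i)" "v (2 * i)" "v l" "-1" 0] frame 2 assms by (simp add: J_odd)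
  then show ?thesis using 2 assms by (auto simp: metric_frame)
qed

lemma coord_sum:
  assumes "k < 2 * n" "finite K" "\<And>l. l \<in> K \<Longrightarrow> u l \<in> V"
  shows "c k (\<Sum>l\<in>K. r l *\<^sub>R u l) = (\<Sum>l\<in>K. r l * c k (u l))"
  using assms(2,3)
proof (induction K rule: finite_induct)
  case empty
  show ?case using coord_lincomb[OF assms(1), of 0 0 0 0] subspace_0[OF subspace] by simp
next
  case (insert l K)
  then show ?case
    using coord_lincomb[OF assms(1), of "u l" "\<Sum>l\<in>K. r l *\<^sub>R u l" "r l" 1]
      subspace_sum[OF subspace, of K "\<lambda>l. r l *\<^sub>R u l"] subspace_scale[OF subspace] by simp
qed

lemma J_sum:
  assumes "finite K" "\<And>l. l \<in> K \<Longrightarrow> u l \<in> V"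
  shows "J (\<Sum>l\<in>K. r l *\<^sub>R u l) = (\<Sum>l\<in>K. r l *\<^sub>R J (u l))"
  using assms
proof (induction K rule: finite_induct)
  case empty
  show ?case using J_lincomb[of 0 0 0 0] subspace_0[OF subspace] by simp
next
  case (insert l K)
  then show ?case
    using J_lincomb[of "u l" "\<Sum>l\<in>K. r l *\<^sub>R u l" "r l" 1]
      subspace_sum[OF subspace, of K "\<lambda>l. r l *\<^sub>R u l"] subspace_scale[OF subspace] by simp
qed

lemma coord_J:
  assumes "x \<in> V" "i < n"
  shows "c (2 * i) (J x) = - c (Suc (2 * i)) x" "c (Suc (2 * i)) (J x) = c (2 * i) x"
proof -
  have *: "c k (J x) = (\<Sum>l<2*n. c l x * c k (J (v l)))" if "k < 2 * n" for k
  proof -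
    have "J x = (\<Sum>l<2*n. c l x *\<^sub>R J (v l))"
      using expand[OF assms(1)] J_sum[of "{..<2*n}" v "\<lambda>l. c l x"] frame by simp
    then show ?thesis using coord_sum[OF that, of "{..<2*n}" "\<lambda>l. J (v l)"] frame J_in by simp
  qed
  have m: "c k (J (v l)) = metric (J (v l)) (v k)" if "k < 2 * n" "l < 2 * n" for k l
    using that by (simp add: metric_def coord_frame if_distrib cong: if_cong)
  have "(\<Sum>l<2*n. c l x * c (2 * i) (J (v l))) = (\<Sum>l<2*n. if l = Suc (2 * i) then - c l x else 0)"
    using assms(2) by (intro sum.cong refl) (auto simp: m metric_J_frame, presburger?)
  then show "c (2 * i) (J x) = - c (Suc (2 * i)) x" using * assms(2) by simp
  have "(\<Sum>l<2*n. c l x * c (Suc (2 * i)) (J (v l))) = (\<Sum>l<2*n. if l = 2 * i then c l x else 0)"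
    using assms(2) by (intro sum.cong refl) (auto simp: m metric_J_frame, presburger?)
  then show "c (Suc (2 * i)) (J x) = c (2 * i) x" using * assms(2) by simp
qed

lemma metric_J:
  assumes "x \<in> V" "y \<in> V"
  shows "metric (J x) (J y) = metric x y"
proof -
  have pairs: "(\<Sum>k<2*r. h k) = (\<Sum>i<r. h (2 * i) + h (Suc (2 * i)))" for h :: "nat \<Rightarrow> real" and r
    by (induction r) simp_all
  show ?thesis unfolding metric_def pairs using assms by (intro sum.cong refl) (simp add: coord_J)
qed

lemma multilinear_omega: "multilinear_form V 2 \<omega>"
  unfolding multilinear_form_def
proof (intro allI impI, elim conjE)
  fix w :: "'v list" and k :: nat and x y r s
  assume w: "length w = 2" "set w \<subseteq> V" "k < 2" "x \<in> V" "y \<in> V"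
  then obtain a b where ab: "w = [a, b]" by (metis One_nat_def Suc_1 length_0_conv length_Suc_conv)
  then have "a \<in> V" "b \<in> V" using w by auto
  moreover have "k = 0 \<or> k = 1" using w(3) by auto
  ultimately show "\<omega> (w[k := r *\<^sub>R x + s *\<^sub>R y]) = r * \<omega> (w[k := x]) + s * \<omega> (w[k := y])"
    using w(4,5) unfolding ab fundamental_form_def by (auto simp: metric_lincomb J_lincomb J_in)
qed

end

context hermitian_frame
begin

lemma omega_frame:
  assumes "k < 2 * n" "l < 2 * n"
  shows "\<omega> [v k, v l] = (if even k then if l = Suc k then 1 else 0 else if k = Suc l then - 1 else 0)"
  using metric_J_frame[OF assms] by (simp add: fundamental_form_def)

abbreviation pair_complement :: "nat \<Rightarrow> nat list" where
  "pair_complement i \<equiv> [0..<2*i] @ [2*i+2..<2*n]"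

lemma length_pair_complement: "i < n \<Longrightarrow> length (pair_complement i) = 2 * (n - 1)"
  by simp

text \<open>Each of the two leading vectors passes \<open>2 * i\<close> entries on the way to its
  place, an even number, so no sign appears.\<close>

lemma vol_pair_complement:
  assumes "i < n"
  shows "vol (2 * n) c (v (2 * i) # v (Suc (2 * i)) # map v (pair_complement i)) = 1"
proof -
  have s: "[0..<2*n] = [0..<2*i] @ 2 * i # Suc (2 * i) # [2*i+2..<2*n]"
    using assms upt_add_eq_append[of 0 "2*i" "2*n - 2*i"] by (simp add: upt_conv_Cons)
  let ?A = "map v [0..<2*i]" and ?B = "map v [2*i+2..<2*n]"
  have V: "set ?A \<subseteq> V" "set ?B \<subseteq> V" "v (2 * i) \<in> V" "v (Suc (2 * i)) \<in> V" using frame assms by auto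
  have "vol (2 * n) c (v (2 * i) # v (Suc (2 * i)) # ?A @ ?B) = vol (2 * n) c (v (2 * i) # ?A @ v (Suc (2 * i)) # ?B)"
    using alternating_form_move[OF alternating_vol, of "[v (2 * i)]" ?A ?B "v (Suc (2 * i))"] V assms by simp
  also have "\<dots> = vol (2 * n) c (?A @ v (2 * i) # v (Suc (2 * i)) # ?B)"
    using alternating_form_move[OF alternating_vol, of "[]" ?A "v (Suc (2 * i)) # ?B" "v (2 * i)"] V assms by simp
  also have "?A @ v (2 * i) # v (Suc (2 * i)) # ?B = map v [0..<2*n]" unfolding s by simp
  also have "vol (2 * n) c \<dots> = 1" by (rule vol_basis) (simp add: coord_frame)
  finally show ?thesis by simp
qed

lemma alternating_form_contract2:
  assumes "alternating_form V (Suc (Suc p)) a" "x \<in> V" "y \<in> V"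
  shows "alternating_form V p (\<lambda>w. a (x # y # w))"
  unfolding alternating_form_def
proof (intro conjI allI impI, goal_cases)
  case 1
  have m: "multilinear_form V (Suc (Suc p)) a" using assms by (simp add: alternating_form_def)
  show ?case unfolding multilinear_form_def
  proof (intro allI impI, elim conjE)
    fix w :: "'v list" and k z u r s
    assume "length w = p" "set w \<subseteq> V" "k < p" "z \<in> V" "u \<in> V"
    then show "a (x # y # w[k := r *\<^sub>R z + s *\<^sub>R u]) = r * a (x # y # w[k := z]) + s * a (x # y # w[k := u])"
      using multilinear_formD[OF m, of "x # y # w" "Suc (Suc k)" z u r s] assms by simp
  qed
next
  case (2 as z u bs)
  then show ?case using alternating_form_swap[OF assms(1), of "x # y # as" bs z u] assms(2,3) by simp
qed

lemma alternating_form_sum: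
  assumes "finite K" "\<And>k. k \<in> K \<Longrightarrow> alternating_form V p (a k)"
  shows "alternating_form V p (\<lambda>w. \<Sum>k\<in>K. a k w)"
  using assms
proof (induction K rule: finite_induct)
  case empty
  show ?case by (simp add: alternating_form_def multilinear_form_def)
next
  case (insert k K)
  then show ?case using alternating_form_lincomb[of V p "a k" "\<lambda>w. \<Sum>k\<in>K. a k w" 1 1] by simp
qed

text \<open>Both sides are alternating, so they are compared on distinct frame tuples. Such a tuple
  either omits a whole pair, and is then a reordering of that pair's complement, or it meets every
  pair, and then both sides vanish.\<close>

lemma omega_power_eq_vol:
  assumes n: "n > 0"
  obtains C where "\<And>w. length w = 2 * (n - 1) \<Longrightarrow> set w \<subseteq> V \<Longrightarrow>
    two_form_power \<omega> (n - 1) w = C * (\<Sum>i<n. vol (2 * n) c (v (2 * i) # v (Suc (2 * i)) # w))"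
proof
  let ?p = "2 * (n - 1)"
  let ?\<Phi> = "two_form_power \<omega> (n - 1)"
  define C where "C = ?\<Phi> (map v (pair_complement 0))"
  define \<Psi> where "\<Psi> w = (\<Sum>i<n. vol (2 * n) c (v (2 * i) # v (Suc (2 * i)) # w))" for w
  define F where "F w = 1 * ?\<Phi> w + (- C) * \<Psi> w" for w
  have n2: "Suc (Suc ?p) = 2 * n" using n by simp
  have F: "alternating_form V ?p F"
    unfolding F_def \<Psi>_def
    by (intro alternating_form_lincomb alternating_two_form_power multilinear_omega alternating_form_sum
        alternating_form_contract2) (use n2 alternating_vol frame in auto)
  \<comment> \<open>Whichever pair is deleted, \<open>\<omega>\<close> matches the remaining vectors
    in the same pattern of consecutive pairs, so one constant serves all complements.\<close>
  have \<Phi>C: "?\<Phi> (map v (pair_complement i)) = C" if i: "i < n" for i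
    unfolding C_def
  proof (rule two_form_power_cong)
    fix k l assume kl: "k < ?p" "l < ?p"
    have nth: "map v (pair_complement j) ! k = v (if k < 2 * j then k else k + 2)" if "k < ?p" "j < n" for k j
      using that by (auto simp: nth_append)
    show "\<omega> [map v (pair_complement i) ! k, map v (pair_complement i) ! l] =
      \<omega> [map v (pair_complement 0) ! k, map v (pair_complement 0) ! l]"
      unfolding nth[OF kl(1) i] nth[OF kl(2) i] nth[OF kl(1) n] nth[OF kl(2) n]
      using kl i n by (auto simp: omega_frame)
  qed
  have vol0: "vol (2 * n) c (v (2 * i) # v (Suc (2 * i)) # map v ks) = 0"
    if "i < n" "2 * i \<in> set ks \<or> Suc (2 * i) \<in> set ks" "set ks \<subseteq> {..<2*n}" "length ks = ?p" for i ks
  proof (rule alternating_form_not_distinct[OF alternating_vol])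
    show "length (v (2 * i) # v (Suc (2 * i)) # map v ks) = 2 * n" using that(4) n2 by simp
    show "set (v (2 * i) # v (Suc (2 * i)) # map v ks) \<subseteq> V"
      using frame[of "2 * i"] frame[of "Suc (2 * i)"] that(1,3) by (auto intro!: frame)
    show "\<not> distinct (v (2 * i) # v (Suc (2 * i)) # map v ks)" using that(2) by auto
  qed
  have \<Psi>1: "\<Psi> (map v (pair_complement i)) = 1" if i: "i < n" for i
  proof -
    have "vol (2 * n) c (v (2 * j) # v (Suc (2 * j)) # map v (pair_complement i)) = (if j = i then 1 else 0)"
      if "j < n" for j
    proof (cases "j = i")
      case False
      have "2 * j \<in> set (pair_complement i)"
        using False that by (cases "j < i") auto
      moreover have "set (pair_complement i) \<subseteq> {..<2*n}" using i by auto
      ultimately show ?thesis using vol0[OF that _ _ length_pair_complement[OF i]] False by simp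
    qed (use vol_pair_complement[OF i] in simp)
    then show ?thesis using i by (simp add: \<Psi>_def)
  qed
  have "F w = 0" if w: "length w = ?p" "set w \<subseteq> V" for w
  proof (rule alternating_form_eq_0I[OF F subspace, of "{..<2*n}" v c])
    fix ks assume ks: "distinct ks" "set ks \<subseteq> {..<2*n}" "length ks = ?p"
    have V: "set (map v ks) \<subseteq> V" using ks(2) by (auto intro!: frame)
    show "F (map v ks) = 0"
    proof (cases "\<exists>i<n. 2 * i \<notin> set ks \<and> Suc (2 * i) \<notin> set ks")
      case True
      then obtain i where i: "i < n" "2 * i \<notin> set ks" "Suc (2 * i) \<notin> set ks" by blast
      have "set ks \<subseteq> set (pair_complement i)"
      proof
        fix k assume k: "k \<in> set ks"
        then have "k \<noteq> 2 * i" "k \<noteq> Suc (2 * i)" "k < 2 * n" using i ks(2) by auto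
        then show "k \<in> set (pair_complement i)" by auto
      qed
      moreover have "distinct (pair_complement i)" by auto
      ultimately have "set ks = set (pair_complement i)"
        by (intro card_subset_eq)
          (simp_all only: distinct_card ks(1,3) length_pair_complement[OF i(1)] List.finite_set)
      then have "mset ks = mset (pair_complement i)"
        using ks(1) \<open>distinct (pair_complement i)\<close> set_eq_iff_mset_eq_distinct by blast
      then have "mset (map v ks) = mset (map v (pair_complement i))" by (metis mset_map)
      moreover have "F (map v (pair_complement i)) = 0" unfolding F_def \<Phi>C[OF i(1)] \<Psi>1[OF i(1)] by simp
      ultimately show ?thesis
        by (intro alternating_form_perm_zero[OF F _ V, of "map v (pair_complement i)"])
          (simp_all only: length_map ks(3))
    next
      case False
      then have "\<Psi> (map v ks) = 0" unfolding \<Psi>_def using vol0[of _ ks] ks by (intro sum.neutral) auto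
      \<comment> \<open>The tuple has two entries fewer than the frame, so some \<open>k\<close> is
        missing. Its partner \<open>k'\<close> is present because no pair is missing entirely, and
        \<open>v k'\<close> is \<open>\<omega>\<close>-orthogonal to every frame vector except
        \<open>v k\<close>.\<close>
      have "\<exists>k<2*n. k \<notin> set ks"
      proof (rule ccontr)
        assume "\<not> ?thesis"
        then have "card {..<2*n} \<le> card (set ks)" by (intro card_mono) auto
        then show False using ks n by (simp add: distinct_card)
      qed
      then obtain k where k: "k < 2 * n" "k \<notin> set ks" by blast
      define k' where "k' = (if even k then Suc k else k - 1)"
      have k': "k' \<in> set ks \<and> k' < 2 * n"
        using k(1)
      proof (cases k rule: frame_even_odd)
        case (1 i)
        then show ?thesis using False k(2) by (auto simp: k'_def)
      next
        case (2 i)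
        then show ?thesis using False k(2) by (auto simp: k'_def)
      qed
      then obtain t where t: "t < length ks" "ks ! t = k'" by (metis in_set_conv_nth)
      have "\<omega> [v k', v l] = 0 \<and> \<omega> [v l, v k'] = 0" if "l \<in> set ks" for l
      proof -
        have "l \<noteq> k" "l < 2 * n" using that k ks by auto
        then show ?thesis using k(1) k' by (auto simp: omega_frame k'_def) presburger+
      qed
      then have "?\<Phi> (map v ks) = 0"
        by (intro two_form_power_isotropic[of t]) (use t ks(3) in auto)
      then show ?thesis using \<open>\<Psi> (map v ks) = 0\<close> by (simp add: F_def)
    qed
  qed (use frame expand w in auto)
  then show "two_form_power \<omega> (n - 1) w = C * (\<Sum>i<n. vol (2 * n) c (v (2 * i) # v (Suc (2 * i)) # w))"
    if "length w = ?p" "set w \<subseteq> V" for w using that unfolding F_def \<Psi>_def by force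
qed

text \<open>Invariance of the volume form moves the action of each \<open>z ! a\<close> from the
  other entries of \<open>z\<close> to the two contracted frame vectors. Invariance under those
  frame vectors then collapses the alternating sum over \<open>a\<close> to the volume of
  \<open>br (v (2 * i)) (v (Suc (2 * i))) # z\<close>, and the sum over \<open>i\<close> is zero by
  \<open>sum_br_frame\<close>.\<close>

lemma ce_differential_omega_power:
  assumes n: "n > 0" and z: "length z = Suc (2 * (n - 1))" "set z \<subseteq> V"
  shows "ce_differential br (2 * (n - 1)) (two_form_power \<omega> (n - 1)) z = 0"
proof -
  let ?p = "2 * (n - 1)" and ?D = "vol (2 * n) c"
  obtain C where C: "\<And>w. length w = ?p \<Longrightarrow> set w \<subseteq> V \<Longrightarrow>
    two_form_power \<omega> (n - 1) w = C * (\<Sum>i<n. ?D (v (2 * i) # v (Suc (2 * i)) # w))"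
    using omega_power_eq_vol[OF n] by blast
  have n2: "2 * n = Suc (Suc ?p)" using n by simp
  have D0: "derivation_form (br x) ?D w = 0" if "x \<in> V" "length w = Suc (Suc ?p)" "set w \<subseteq> V" for x w
    using derivation_vol[of "br x" w] that br_in br_lincomb unimodular n2 by simp
  have D: "alternating_form V (Suc (Suc ?p)) ?D" using alternating_vol n2 by simp
  have m: "multilinear_form V (Suc (Suc ?p)) ?D" using D by (simp add: alternating_form_def)
  have rm: "length (remove_nth a z) = ?p" "set (remove_nth a z) \<subseteq> V" "z ! a \<in> V" if "a \<le> ?p" for a
    using that z set_take_subset[of a z] set_drop_subset[of "Suc a" z] nth_mem[of a z] by auto
  let ?x = "\<lambda>i. v (2 * i)" and ?y = "\<lambda>i. v (Suc (2 * i))"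
  have xy: "?x i \<in> V" "?y i \<in> V" if "i < n" for i using that frame by auto
  have der: "derivation_form (br (z ! a)) (two_form_power \<omega> (n - 1)) (remove_nth a z) =
     C * (\<Sum>i<n. ?D (br (?x i) (z ! a) # ?y i # remove_nth a z) - ?D (br (?y i) (z ! a) # ?x i # remove_nth a z))"
    if a: "a \<le> ?p" for a
  proof -
    let ?w = "remove_nth a z" and ?f = "br (z ! a)"
    note w = rm[OF a]
    have upd: "set (?w[k := ?f (?w ! k)]) \<subseteq> V" if "k < ?p" for k
    proof -
      have "?w ! k \<in> V" using nth_mem[of k ?w] w(1,2) that by (simp only: subsetD)
      then have "?f (?w ! k) \<in> V" using br_in w(3) by simp
      then show ?thesis
        by (intro order.trans[OF set_update_subset_insert] insert_subsetI w(2))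
    qed
    have neg: "?D (- u # r) = - ?D (u # r)" if "u \<in> V" "set r \<subseteq> V" "length r = Suc ?p" for u r
      using multilinear_form_slot[OF m, of "[]" r u u "-1" 0] that by simp
    have "derivation_form ?f (two_form_power \<omega> (n - 1)) ?w = (\<Sum>k<?p. C * (\<Sum>i<n. ?D (?x i # ?y i # ?w[k := ?f (?w ! k)])))"
      unfolding derivation_form_def w(1) by (intro sum.cong refl C upd) (use w(1) in \<open>simp_all only: length_list_update lessThan_iff\<close>)
    also have "\<dots> = C * (\<Sum>i<n. derivation_form ?f (\<lambda>u. ?D (?x i # ?y i # u)) ?w)"
      unfolding derivation_form_def w(1) sum_distrib_left[symmetric] by (subst sum.swap) (rule refl)
    also have "(\<Sum>i<n. derivation_form ?f (\<lambda>u. ?D (?x i # ?y i # u)) ?w) =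
      (\<Sum>i<n. ?D (br (?x i) (z ! a) # ?y i # ?w) - ?D (br (?y i) (z ! a) # ?x i # ?w))"
    proof (intro sum.cong refl)
      fix i assume "i \<in> {..<n}"
      then have V: "?x i \<in> V" "?y i \<in> V" using xy by auto
      \<comment> \<open>The zero is the full action on the volume form; splitting off the first two
        slots isolates the term in question.\<close>
      have "0 = derivation_form ?f ?D (?x i # ?y i # ?w)"
        using D0[OF w(3), of "?x i # ?y i # ?w"] w V by simp
      also have "\<dots> = ?D (?f (?x i) # ?y i # ?w) + ?D (?x i # ?f (?y i) # ?w)
          + derivation_form ?f (\<lambda>u. ?D (?x i # ?y i # u)) ?w"
        unfolding derivation_form_Cons by simp
      also have "?D (?f (?x i) # ?y i # ?w) = - ?D (br (?x i) (z ! a) # ?y i # ?w)"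
        unfolding br_anti[OF V(1) w(3)] by (rule neg) (use V w br_in in auto)
      also have "?D (?x i # ?f (?y i) # ?w) = - ?D (?f (?y i) # ?x i # ?w)"
        using alternating_form_swap[OF D, of "[]" ?w "?f (?y i)" "?x i"] w V br_in by simp
      also have "?D (?f (?y i) # ?x i # ?w) = - ?D (br (?y i) (z ! a) # ?x i # ?w)"
        unfolding br_anti[OF V(2) w(3)] by (rule neg) (use V w br_in in auto)
      finally show "derivation_form ?f (\<lambda>u. ?D (?x i # ?y i # u)) ?w =
        ?D (br (?x i) (z ! a) # ?y i # ?w) - ?D (br (?y i) (z ! a) # ?x i # ?w)" by simp
    qed
    finally show ?thesis .
  qed
  have con: "(\<Sum>a\<le>?p. (-1) ^ a * ?D (br u (z ! a) # y # remove_nth a z)) = ?D (br u y # z)"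
    if "u \<in> V" "y \<in> V" for u y
    using alternating_form_derivation_contract[OF D, of "br u" z y] D0[of u] that z br_in
    by (simp add: lessThan_Suc_atMost)
  have "2 * ce_differential br ?p (two_form_power \<omega> (n - 1)) z
     = - (\<Sum>a\<le>?p. (-1) ^ a * derivation_form (br (z ! a)) (two_form_power \<omega> (n - 1)) (remove_nth a z))"
    by (rule ce_differential_derivation[OF alternating_two_form_power[OF multilinear_omega] br_in br_anti subspace z])
  also have "\<dots> = - C * (\<Sum>i<n. (\<Sum>a\<le>?p. (-1) ^ a * ?D (br (?x i) (z ! a) # ?y i # remove_nth a z))
     - (\<Sum>a\<le>?p. (-1) ^ a * ?D (br (?y i) (z ! a) # ?x i # remove_nth a z)))"
  proof -
    define P where "P a i = ?D (br (?x i) (z ! a) # ?y i # remove_nth a z)" for a i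
    define Q where "Q a i = ?D (br (?y i) (z ! a) # ?x i # remove_nth a z)" for a i
    have "(\<Sum>a\<le>?p. (-1) ^ a * derivation_form (br (z ! a)) (two_form_power \<omega> (n - 1)) (remove_nth a z))
      = (\<Sum>a\<le>?p. (-1) ^ a * (C * (\<Sum>i<n. P a i - Q a i)))"
      by (intro sum.cong refl) (simp only: der P_def Q_def atMost_iff)
    also have "\<dots> = (\<Sum>a\<le>?p. \<Sum>i<n. C * ((-1) ^ a * P a i - (-1) ^ a * Q a i))"
      unfolding sum_distrib_left by (intro sum.cong refl) (simp add: algebra_simps)
    also have "\<dots> = (\<Sum>i<n. \<Sum>a\<le>?p. C * ((-1) ^ a * P a i - (-1) ^ a * Q a i))"
      by (rule sum.swap)
    also have "\<dots> = C * (\<Sum>i<n. (\<Sum>a\<le>?p. (-1) ^ a * P a i) - (\<Sum>a\<le>?p. (-1) ^ a * Q a i))"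
      unfolding sum_subtractf[symmetric] sum_distrib_left by (rule refl)
    finally show ?thesis unfolding P_def Q_def by simp
  qed
  also have "\<dots> = - C * (\<Sum>i<n. 2 * ?D (br (?x i) (?y i) # z))"
  proof -
    \<comment> \<open>The two sums collapse to brackets in opposite order, so by antisymmetry their
      difference doubles.\<close>
    have "?D (br (?y i) (?x i) # z) = - ?D (br (?x i) (?y i) # z)" if i: "i < n" for i
      using multilinear_form_slot[OF m, of "[]" z "br (?x i) (?y i)" "br (?x i) (?y i)" "-1" 0] z xy[OF i] br_in
        br_anti[of "?x i" "?y i"] by simp
    note swap = this
    have "(\<Sum>a\<le>?p. (-1) ^ a * ?D (br (?x i) (z ! a) # ?y i # remove_nth a z))
      - (\<Sum>a\<le>?p. (-1) ^ a * ?D (br (?y i) (z ! a) # ?x i # remove_nth a z))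
      = 2 * ?D (br (?x i) (?y i) # z)" if i: "i < n" for i
      unfolding con[OF xy(1)[OF i] xy(2)[OF i]] con[OF xy(2)[OF i] xy(1)[OF i]] swap[OF i] by simp
    then show ?thesis by (intro arg_cong[where f="\<lambda>u. - C * u"] sum.cong refl) (simp only: lessThan_iff)
  qed
  also have "\<dots> = - C * 2 * ?D ([] @ (\<Sum>i<n. 1 *\<^sub>R br (?x i) (?y i)) # z)"
    by (subst multilinear_form_sum[OF m subspace]) (use z xy br_in in \<open>auto simp: sum_distrib_left mult.assoc\<close>)
  also have "\<dots> = 0"
    using sum_br_frame multilinear_form_slot[OF m, of "[]" z 0 0 0 0] z subspace_0[OF subspace] by simp
  finally show ?thesis by simp
qed

end

section \<open>The Killing form of sl\<close>

lemma linear_on_sum: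
  assumes V: "module.subspace s V" and s: "vector_space s" and \<phi>: "linear_on s (*) V \<phi>"
    and K: "finite K" "\<And>k. k \<in> K \<Longrightarrow> v k \<in> V"
  shows "\<phi> (\<Sum>k\<in>K. s (r k) (v k)) = (\<Sum>k\<in>K. r k * (\<phi> (v k) :: 'a::field))"
proof -
  interpret vector_space s by (rule s)
  show ?thesis using K
  proof (induction K rule: finite_induct)
    case empty
    have "\<phi> (s 0 0) = 0 * \<phi> 0" using \<phi> subspace_0[OF V] unfolding linear_on_def by blast
    then show ?case by simp
  next
    case (insert k K)
    have "(\<Sum>k\<in>K. s (r k) (v k)) \<in> V" using insert.prems by (intro subspace_sum[OF V] subspace_scale[OF V]) auto
    moreover have "s (r k) (v k) \<in> V" using insert.prems by (intro subspace_scale[OF V]) auto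
    ultimately show ?case using insert \<phi> unfolding linear_on_def by simp
  qed
qed

text \<open>Writing \<open>f\<close> as a sum of rank-one maps makes the basis chosen by
  \<open>SOME\<close> in \<open>trace_on\<close> disappear after an exchange of sums. The vectors
  \<open>v k\<close> may be dependent: below they are images of all matrix units, or images of a
  frame.\<close>

lemma trace_on_eq_sum:
  fixes s :: "'a::field \<Rightarrow> 'v::ab_group_add \<Rightarrow> 'v"
  assumes s: "vector_space s" and V: "module.subspace s V"
    and fin: "finite T" "V \<subseteq> module.span s T"
    and K: "finite K" "\<And>k. k \<in> K \<Longrightarrow> v k \<in> V" "\<And>k. k \<in> K \<Longrightarrow> linear_on s (*) V (\<phi> k)"
    and f: "\<And>x. x \<in> V \<Longrightarrow> f x = (\<Sum>k\<in>K. s (\<phi> k x) (v k))"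
  shows "trace_on s V f = (\<Sum>k\<in>K. \<phi> k (v k))"
proof -
  interpret vector_space s by (rule s)
  define B where "B = (SOME B. B \<subseteq> V \<and> \<not> dependent B \<and> span B = V)"
  obtain B0 where "B0 \<subseteq> V" "independent B0" "V \<subseteq> span B0" using maximal_independent_subset by blast
  then have "B0 \<subseteq> V \<and> \<not> dependent B0 \<and> span B0 = V" using span_minimal[OF _ V] by blast
  then have B: "B \<subseteq> V" "independent B" "span B = V"
    unfolding B_def by (metis (mono_tags, lifting) someI_ex)+
  have "B \<subseteq> span T" using B(1) fin(2) by blast
  then have finB: "finite B" using independent_span_bound[OF fin(1) B(2)] by blast
  have "trace_on s V f = (\<Sum>b\<in>B. representation B (f b) b)"
    unfolding trace_on_def B_def[symmetric] Let_def ..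
  also have "\<dots> = (\<Sum>b\<in>B. \<Sum>k\<in>K. representation B (v k) b * \<phi> k b)"
  proof (rule sum.cong[OF refl])
    fix b assume "b \<in> B"
    then have "f b = (\<Sum>k\<in>K. s (\<phi> k b) (v k))" using f B(1) by blast
    moreover have "representation B (\<Sum>k\<in>K. s (\<phi> k b) (v k)) b = (\<Sum>k\<in>K. representation B (s (\<phi> k b) (v k)) b)"
      by (subst representation_sum[OF B(2)]) (use K(2) B(3) in \<open>auto intro: span_scale\<close>)
    moreover have "representation B (s (\<phi> k b) (v k)) b = representation B (v k) b * \<phi> k b" if "k \<in> K" for k
      using representation_scale[OF B(2), of "v k" "\<phi> k b"] K(2)[OF that] B(3) by simp
    ultimately show "representation B (f b) b = (\<Sum>k\<in>K. representation B (v k) b * \<phi> k b)" by simp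
  qed
  also have "\<dots> = (\<Sum>k\<in>K. \<Sum>b\<in>B. representation B (v k) b * \<phi> k b)" by (rule sum.swap)
  also have "\<dots> = (\<Sum>k\<in>K. \<phi> k (v k))"
  proof (rule sum.cong[OF refl])
    fix k assume k: "k \<in> K"
    have "\<phi> k (\<Sum>b\<in>B. s (representation B (v k) b) b) = (\<Sum>b\<in>B. representation B (v k) b * \<phi> k b)"
      by (rule linear_on_sum[OF V s K(3)[OF k] finB]) (use B(1) in blast)
    moreover have "(\<Sum>b\<in>B. s (representation B (v k) b) b) = v k"
      by (rule sum_representation_eq[OF B(2) _ finB order.refl]) (use K(2)[OF k] B(3) in simp)
    ultimately show "(\<Sum>b\<in>B. representation B (v k) b * \<phi> k b) = \<phi> k (v k)" by simp
  qed
  finally show ?thesis .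
qed

definition unit_mat :: "'n \<Rightarrow> 'n \<Rightarrow> 'a::ring_1^'n^'n" where
  "unit_mat i j = (\<chi> a b. if a = i \<and> b = j then 1 else 0)"

lemma matrix_mult_nth: "(A ** B) $ i $ j = (\<Sum>k\<in>UNIV. A $ i $ k * B $ k $ j)"
  by (simp add: matrix_matrix_mult_def)

lemma unit_mat_mult_nth:
  fixes A B :: "'a::comm_ring_1^'n^'n"
  shows "(A ** unit_mat i j ** B) $ a $ b = A $ a $ i * B $ j $ b"
proof -
  have "(A ** unit_mat i j) $ a $ k = (if k = j then A $ a $ i else 0)" for k
    by (simp add: matrix_matrix_mult_def unit_mat_def if_distrib cong: if_cong)
  then have "(A ** unit_mat i j ** B) $ a $ b = (\<Sum>k\<in>UNIV. if k = j then A $ a $ i * B $ j $ b else 0)"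
    unfolding matrix_mult_nth[of "A ** unit_mat i j"] by (intro sum.cong) auto
  then show ?thesis by simp
qed

lemma matrix_distrib:
  fixes A B C :: "'a::comm_ring_1^'n^'n"
  shows "A ** (B + C) = A ** B + A ** C" "(B + C) ** A = B ** A + C ** A"
    "A ** (B - C) = A ** B - A ** C" "(B - C) ** A = B ** A - C ** A"
  by (simp_all add: matrix_matrix_mult_def vec_eq_iff sum.distrib sum_subtractf algebra_simps)

lemma lie_add:
  fixes A B C :: "'a::comm_ring_1^'n^'n"
  shows "lie A (B + C) = lie A B + lie A C" "lie (B + C) A = lie B A + lie C A"
  by (simp_all add: lie_def matrix_distrib)

lemma trace_lie: "trace (lie A B) = 0" for A B :: "'a::comm_ring_1^'n^'n"
  by (simp add: lie_def trace_sub trace_mul_sym[of A])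

lemma lie_in_sl: "lie A B \<in> sl" for A B :: "'a::comm_ring_1^'n^'n"
  by (simp add: sl_def trace_lie)

text \<open>Both fields are treated at once: \<open>s\<close> will be \<open>cscale\<close> on
  complex matrices and the usual scaling on real ones.\<close>

context
  fixes s :: "'a::field_char_0 \<Rightarrow> 'a^'n^'n \<Rightarrow> 'a^'n^'n"
  assumes s: "\<And>c A. s c A = (\<chi> i j. c * A $ i $ j)"
begin

lemma vector_space_mat_scale: "vector_space s"
  by unfold_locales (simp_all add: s vec_eq_iff algebra_simps)

lemma mat_eq_sum_unit: "A = (\<Sum>(i,j)\<in>UNIV. s (A $ i $ j) (unit_mat i j))"
proof -
  have "(\<Sum>(i,j)\<in>UNIV. s (A $ i $ j) (unit_mat i j)) $ a $ b = A $ a $ b" for a b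
  proof -
    have "(\<Sum>(i,j)\<in>UNIV. s (A $ i $ j) (unit_mat i j)) $ a $ b
      = (\<Sum>x\<in>UNIV. if x = (a, b) then A $ a $ b else 0)"
      unfolding sum_component by (intro sum.cong refl) (auto simp: s unit_mat_def split: if_splits)
    then show ?thesis by simp
  qed
  then show ?thesis by (simp add: vec_eq_iff)
qed

lemma subspace_sl: "module.subspace s sl"
proof -
  interpret vector_space s by (rule vector_space_mat_scale)
  show ?thesis
    by (rule subspaceI) (auto simp: sl_def s trace_def sum.distrib simp flip: sum_distrib_left)
qed

text \<open>Diagonal matrix units lie outside \<open>sl\<close>, but all images under
  \<open>f\<close> lie inside. So the trace on \<open>sl\<close> agrees with the trace on all
  matrices; the one-dimensional quotient contributes 0.\<close>

lemma trace_on_sl: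
  assumes lin: "\<And>A B c. f (A + B) = f A + f B" "\<And>A c. f (s c A) = s c (f A)"
    and sl: "\<And>A. f A \<in> sl"
  shows "trace_on s sl f = (\<Sum>k\<in>UNIV. f (unit_mat (fst k) (snd k)) $ fst k $ snd k)"
proof -
  interpret vector_space s by (rule vector_space_mat_scale)
  have sum: "f (\<Sum>k\<in>K. g k) = (\<Sum>k\<in>K. f (g k))" if "finite K" for K :: "('n \<times> 'n) set" and g
    using that
  proof (induction K rule: finite_induct)
    case empty
    have "f (s 0 0) = s 0 (f 0)" by (rule lin)
    then show ?case by simp
  qed (simp add: lin)
  have f: "f A = (\<Sum>k\<in>UNIV. s (A $ fst k $ snd k) (f (unit_mat (fst k) (snd k))))" for A
  proof -
    have "f A = f (\<Sum>(i,j)\<in>UNIV. s (A $ i $ j) (unit_mat i j))" using mat_eq_sum_unit[of A] by simp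
    then show ?thesis by (simp add: sum lin case_prod_beta)
  qed
  have span: "sl \<subseteq> span (range (\<lambda>(i,j). unit_mat i j))"
  proof
    fix A :: "'a^'n^'n"
    have "(\<Sum>(i,j)\<in>UNIV. s (A $ i $ j) (unit_mat i j)) \<in> span (range (\<lambda>(i,j). unit_mat i j))"
      by (intro span_sum) (force intro: span_scale span_base)
    then show "A \<in> span (range (\<lambda>(i,j). unit_mat i j))" using mat_eq_sum_unit[of A] by simp
  qed
  show ?thesis
    by (rule trace_on_eq_sum[OF vector_space_mat_scale subspace_sl _ span])
      (simp_all add: sl linear_on_def flip: f, simp add: s)
qed

lemma lie_scale: "lie A (s c B) = s c (lie A B)" "lie (s c A) B = s c (lie A B)"
  by (simp_all add: lie_def s matrix_matrix_mult_def vec_eq_iff sum_distrib_left algebra_simps)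

text \<open>The left side is the trace of \<open>X \<mapsto> A ** X ** B\<close> on all
  matrices.\<close>

lemma sum_unit_conj:
  fixes A B :: "'a^'n^'n"
  shows "(\<Sum>k\<in>UNIV. (A ** unit_mat (fst k) (snd k) ** B) $ fst k $ snd k) = trace A * trace B"
  unfolding unit_mat_mult_nth trace_def sum_product sum.cartesian_product by (simp add: case_prod_beta)

lemma trace_on_lie:
  "trace_on s sl (lie X) = 0"
proof -
  have "trace_on s sl (lie X) = (\<Sum>k\<in>UNIV. lie X (unit_mat (fst k) (snd k)) $ fst k $ snd k)"
    by (rule trace_on_sl) (simp_all add: lie_scale lie_in_sl lie_add)
  also have "\<dots> = (\<Sum>k\<in>UNIV. (X ** unit_mat (fst k) (snd k) ** mat 1) $ fst k $ snd k - (mat 1 ** unit_mat (fst k) (snd k) ** X) $ fst k $ snd k)"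
    by (simp add: lie_def)
  also have "\<dots> = 0"
    unfolding sum_subtractf sum_unit_conj
    by (simp add: mult.commute)
  finally show ?thesis .
qed

text \<open>Of the four maps in the expansion of \<open>ad X ad Y\<close>, the two with an identity
  factor contribute \<open>CARD('n) * trace (X ** Y)\<close> each; the other two contribute products
  of the traces of \<open>X\<close> and \<open>Y\<close>, which are 0.\<close>

lemma killing_form_sl:
  assumes "X \<in> sl" "Y \<in> sl"
  shows "killing_form s lie sl X Y = 2 * of_nat CARD('n) * trace (X ** Y)"
proof -
  have "killing_form s lie sl X Y = (\<Sum>k\<in>UNIV. lie X (lie Y (unit_mat (fst k) (snd k))) $ fst k $ snd k)"
    unfolding killing_form_def
    by (rule trace_on_sl) (simp_all add: lie_scale lie_in_sl lie_add)
  also have "\<dots> = (\<Sum>k\<in>UNIV. ((X ** Y) ** unit_mat (fst k) (snd k) ** mat 1) $ fst k $ snd k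
     + (mat 1 ** unit_mat (fst k) (snd k) ** (Y ** X)) $ fst k $ snd k
     - (X ** unit_mat (fst k) (snd k) ** Y) $ fst k $ snd k - (Y ** unit_mat (fst k) (snd k) ** X) $ fst k $ snd k)"
    by (intro sum.cong refl) (simp add: lie_def matrix_mul_assoc matrix_distrib)
  also have "\<dots> = trace (X ** Y) * trace (mat 1 :: 'a^'n^'n) + trace (mat 1 :: 'a^'n^'n) * trace (Y ** X)"
    unfolding sum_subtractf sum.distrib sum_unit_conj using assms by (simp add: sl_def)
  finally show ?thesis by (simp add: trace_mul_sym[of Y] trace_I algebra_simps)
qed

end

lemma killing_C_eq: "X \<in> sl \<Longrightarrow> Y \<in> sl \<Longrightarrow> killing_C X Y = 2 * of_nat CARD('n) * trace (X ** Y)"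
  for X Y :: "complex^'n^'n"
  by (rule killing_form_sl) (simp_all add: cscale_def)

lemma scaleR_mat: "c *\<^sub>R A = (\<chi> i j. c * A $ i $ j)" for A :: "real^'n^'n"
  by (simp add: vec_eq_iff)

lemma killing_R_eq: "X \<in> sl \<Longrightarrow> Y \<in> sl \<Longrightarrow> killing_R X Y = 2 * of_nat CARD('n) * trace (X ** Y)"
  for X Y :: "real^'n^'n"
  by (rule killing_form_sl) (simp_all add: scaleR_mat)

text \<open>Unimodularity of \<open>sl\<close> in the form that a frame asks for: the sum is the
  trace of \<open>lie X\<close>.\<close>

lemma sum_coord_lie:
  fixes c :: "nat \<Rightarrow> real^'n^'n \<Rightarrow> real"
  assumes "\<And>k. k < N \<Longrightarrow> v k \<in> sl" "\<And>k. k < N \<Longrightarrow> linear_on (*\<^sub>R) (*) sl (c k)"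
    "\<And>x. x \<in> sl \<Longrightarrow> x = (\<Sum>k<N. c k x *\<^sub>R v k)"
  shows "(\<Sum>k<N. c k (lie X (v k))) = 0"
proof -
  note vs = vector_space_mat_scale[OF scaleR_mat] and sub = subspace_sl[OF scaleR_mat]
  have "trace_on (*\<^sub>R) sl (lie X) = (\<Sum>k<N. c k (lie X (v k)))"
  proof (rule trace_on_eq_sum[OF vs sub])
    show "finite (Basis :: (real^'n^'n) set)" by simp
    show "sl \<subseteq> module.span (*\<^sub>R) (Basis :: (real^'n^'n) set)"
      using span_Basis unfolding span_raw_def by auto
    fix x :: "real^'n^'n" assume x: "x \<in> sl"
    interpret L: linear "lie X"
      by (rule linearI) (simp_all add: lie_scale[OF scaleR_mat] lie_add)
    have "lie X x = lie X (\<Sum>k<N. c k x *\<^sub>R v k)" using assms(3)[OF x] by simp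
    then show "lie X x = (\<Sum>k<N. c k x *\<^sub>R lie X (v k))" by (simp add: L.sum L.scale)
  qed (use assms in \<open>auto intro: lie_in_sl\<close>)
  then show ?thesis using trace_on_lie[OF scaleR_mat, of X] by simp
qed

section \<open>Complex matrices and their real structure\<close>

lemma re_mat_simps [simp]:
  "re_mat (A + B) = re_mat A + re_mat B" "im_mat (A + B) = im_mat A + im_mat B"
  "re_mat (A - B) = re_mat A - re_mat B" "im_mat (A - B) = im_mat A - im_mat B"
  "re_mat (cscale c A) = Re c *\<^sub>R re_mat A - Im c *\<^sub>R im_mat A"
  "im_mat (cscale c A) = Re c *\<^sub>R im_mat A + Im c *\<^sub>R re_mat A"
  "re_mat 0 = 0" "im_mat 0 = 0"
  "re_mat (cmat_of X) = X" "im_mat (cmat_of X) = 0"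
  "re_mat (conj_mat A) = re_mat A" "im_mat (conj_mat A) = - im_mat A"
  by (simp_all add: re_mat_def im_mat_def cscale_def cmat_of_def conj_mat_def vec_eq_iff algebra_simps)

lemma mat_eq_re_im: "A = B \<longleftrightarrow> re_mat A = re_mat B \<and> im_mat A = im_mat B"
  by (auto simp: re_mat_def im_mat_def vec_eq_iff complex_eq_iff)

lemma cmat_of_simps [simp]:
  "cmat_of (X + Y) = cmat_of X + cmat_of Y" "cmat_of (r *\<^sub>R X) = cscale (of_real r) (cmat_of X)" "cmat_of 0 = 0"
  by (simp_all add: mat_eq_re_im)

lemma conj_mat_simps [simp]:
  "conj_mat (A + B) = conj_mat A + conj_mat B" "conj_mat (cscale c A) = cscale (cnj c) (conj_mat A)"
  "conj_mat 0 = 0" "conj_mat (conj_mat A) = A" "conj_mat (- A) = - conj_mat A" "conj_mat (A - B) = conj_mat A - conj_mat B"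
  by (simp_all add: conj_mat_def cscale_def vec_eq_iff)

lemma re_mat_sum: "re_mat (\<Sum>k\<in>K. f k) = (\<Sum>k\<in>K. re_mat (f k))"
  "im_mat (\<Sum>k\<in>K. f k) = (\<Sum>k\<in>K. im_mat (f k))"
  by (simp_all add: re_mat_def im_mat_def vec_eq_iff)

lemma re_mat_lie:
  "re_mat (lie A B) = lie (re_mat A) (re_mat B) - lie (im_mat A) (im_mat B)"
  "im_mat (lie A B) = lie (re_mat A) (im_mat B) + lie (im_mat A) (re_mat B)"
  by (simp_all add: lie_def re_mat_def im_mat_def matrix_matrix_mult_def vec_eq_iff sum_subtractf sum.distrib)

lemma conj_mat_lie: "conj_mat (lie A B) = lie (conj_mat A) (conj_mat B)"
  by (simp add: lie_def conj_mat_def matrix_matrix_mult_def vec_eq_iff)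

lemma re_trace: "Re (trace A) = trace (re_mat A)" "Im (trace A) = trace (im_mat A)"
  by (simp_all add: trace_def re_mat_def im_mat_def)

lemma re_trace_mult:
  "Re (trace (A ** B)) = trace (re_mat A ** re_mat B) - trace (im_mat A ** im_mat B)"
  "Im (trace (A ** B)) = trace (re_mat A ** im_mat B) + trace (im_mat A ** re_mat B)"
  by (simp_all add: trace_def re_mat_def im_mat_def matrix_matrix_mult_def sum_subtractf sum.distrib)

lemma sl_re_im: "Z \<in> sl \<longleftrightarrow> re_mat Z \<in> sl \<and> im_mat Z \<in> sl"
  by (simp add: sl_def complex_eq_iff re_trace)

lemma lie_cscale [simp]: "lie A (cscale c B) = cscale c (lie A B)" "lie (cscale c A) B = cscale c (lie A B)"
  by (simp_all add: lie_scale[OF cscale_def])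

lemma lie_zero [simp]: "lie A 0 = 0" "lie 0 A = 0" for A :: "'a::comm_ring_1^'n^'n"
  by (simp_all add: lie_def matrix_matrix_mult_def vec_eq_iff)

lemma lie_minus [simp]: "lie A (- B) = - lie A B" "lie (- A) B = - lie A B" for A :: "'a::comm_ring_1^'n^'n"
  by (simp_all add: lie_def matrix_matrix_mult_def vec_eq_iff sum_negf)

lemma lie_anti: "lie B A = - lie A B" for A :: "'a::comm_ring_1^'n^'n"
  by (simp add: lie_def)

lemma lie_self [simp]: "lie A A = 0" for A :: "'a::comm_ring_1^'n^'n"
  by (simp add: lie_def)

lemma lie_sum: "lie A (\<Sum>k\<in>K. f k) = (\<Sum>k\<in>K. lie A (f k))" for A :: "'a::comm_ring_1^'n^'n"
  by (induction K rule: infinite_finite_induct) (simp_all add: lie_add)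

lemma lie_jacobi: "lie A (lie B C) = lie (lie A B) C + lie B (lie A C)" for A :: "'a::comm_ring_1^'n^'n"
  by (simp add: lie_def matrix_distrib matrix_mul_assoc)

lemma trace_lie_invariant: "trace (A ** lie B C) = trace (lie A B ** C)" for A :: "'a::comm_ring_1^'n^'n"
proof -
  have "trace (A ** (C ** B)) = trace (B ** A ** C)"
    using trace_mul_sym[of "A ** C" B] by (simp add: matrix_mul_assoc)
  then show ?thesis by (simp add: lie_def matrix_distrib trace_sub matrix_mul_assoc)
qed

lemma dim_sl: "dim (sl :: (real^'n^'n) set) = CARD('n) * CARD('n) - 1"
proof -
  have "(mat 1 :: real^'n^'n) \<bullet> A = trace A" for A
    by (simp add: inner_vec_def trace_def mat_def if_distrib[where f="\<lambda>x. x * _"] cong: if_cong)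
  then have "sl = {A :: real^'n^'n. mat 1 \<bullet> A = 0}" by (simp add: sl_def)
  moreover have "(mat 1 :: real^'n^'n) \<noteq> 0" by (simp add: mat_def vec_eq_iff)
  ultimately show ?thesis using dim_hyperplane[of "mat 1 :: real^'n^'n"] by simp
qed

lemma subspace_sl_real: "subspace (sl :: (real^'n^'n) set)"
  by (auto simp: subspace_def sl_def trace_def sum.distrib simp flip: sum_distrib_left)

lemma span_imageD:
  assumes "x \<in> span (f ` K)" "finite K"
  obtains r where "x = (\<Sum>k\<in>K. r k *\<^sub>R f k)"
proof -
  have "\<exists>r. x = (\<Sum>k\<in>K. r k *\<^sub>R f k)"
    using assms(1)
  proof (induction rule: span_induct_alt)
    case base
    show ?case by (intro exI[of _ "\<lambda>_. 0"]) simp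
  next
    case (step c x y)
    then obtain k r where k: "k \<in> K" "x = f k" and y: "y = (\<Sum>k\<in>K. r k *\<^sub>R f k)" by auto
    have "c *\<^sub>R x + y = (\<Sum>l\<in>K. (if l = k then c else 0) *\<^sub>R f l) + (\<Sum>l\<in>K. r l *\<^sub>R f l)"
      using k assms(2) by (simp add: y if_distrib[where f="\<lambda>c. c *\<^sub>R _"] cong: if_cong)
    also have "\<dots> = (\<Sum>l\<in>K. ((if l = k then c else 0) + r l) *\<^sub>R f l)"
      by (simp add: scaleR_add_left sum.distrib)
    finally show ?case by (intro exI[of _ "\<lambda>l. (if l = k then c else 0) + r l"])
  qed
  then show ?thesis using that by blast
qed

lemma spanning_family_independent:
  fixes f :: "'i \<Rightarrow> 'v::euclidean_space"
  assumes K: "finite K" and V: "V \<subseteq> span (f ` K)" "card K \<le> dim V"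
  shows "inj_on f K" "independent (f ` K)"
    and "(\<Sum>k\<in>K. r k *\<^sub>R f k) = 0 \<Longrightarrow> k \<in> K \<Longrightarrow> r k = 0"
proof -
  have 1: "dim V \<le> dim (f ` K)" using V(1) dim_subset[of V "span (f ` K)"] by simp
  have 2: "dim (f ` K) \<le> card (f ` K)" using K by (intro dim_le_card') simp
  have 3: "card (f ` K) \<le> card K" using K by (rule card_image_le)
  show inj: "inj_on f K" using K 1 2 3 V(2) by (intro eq_card_imp_inj_on) auto
  show ind: "independent (f ` K)"
    by (rule card_le_dim_spanning[of _ "span (f ` K)"])
      (use K 1 3 V(2) in \<open>auto simp: span_base subset_iff\<close>)
  assume s: "(\<Sum>k\<in>K. r k *\<^sub>R f k) = 0" and k: "k \<in> K"
  have "(\<Sum>v\<in>f ` K. r (inv_into K f v) *\<^sub>R v) = 0"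
    using s by (subst sum.reindex[OF inj]) (simp add: inj cong: sum.cong)
  then have "r (inv_into K f (f k)) = 0"
    using independentD[OF ind _ order.refl, of "\<lambda>v. r (inv_into K f v)" "f k"] K k by auto
  then show "r k = 0" using inj k by simp
qed

section \<open>Complex families whose real and imaginary parts span sl\<close>

definition re_im :: "('i \<Rightarrow> complex^'n^'n) \<Rightarrow> 'i \<times> bool \<Rightarrow> real^'n^'n" where
  "re_im Z x = (if snd x then re_mat (Z (fst x)) else im_mat (Z (fst x)))"

lemma sum_times_bool: "finite K \<Longrightarrow> (\<Sum>x\<in>K \<times> UNIV. f x) = (\<Sum>k\<in>K. f (k, True) + f (k, False))"
proof -
  have "(\<Sum>x\<in>K \<times> UNIV. f x) = (\<Sum>k\<in>K. \<Sum>b\<in>UNIV. f (k, b))" by (simp add: sum.cartesian_product)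
  then show ?thesis by (simp add: UNIV_bool add.commute)
qed

text \<open>The real and the imaginary part of a vanishing combination are two relations among
  vectors that the dimension forces to be independent. They kill \<open>Re c + Re d\<close>,
  \<open>Im d - Im c\<close>, \<open>Im c + Im d\<close> and \<open>Re c - Re d\<close>.\<close>

lemma conj_family_independent:
  fixes Z :: "'i \<Rightarrow> complex^'n^'n"
  assumes K: "finite K" "sl \<subseteq> span (re_im Z ` (K \<times> UNIV))" "2 * card K \<le> dim (sl :: (real^'n^'n) set)"
    and s: "(\<Sum>k\<in>K. cscale (c k) (Z k) + cscale (d k) (conj_mat (Z k))) = 0" and k: "k \<in> K"
  shows "c k = 0" "d k = 0"
proof -
  have fin: "finite (K \<times> (UNIV :: bool set))" using K by simp
  have card: "card (K \<times> (UNIV :: bool set)) \<le> dim (sl :: (real^'n^'n) set)"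
    using K(3) by (simp add: card_cartesian_product mult.commute)
  note ind = spanning_family_independent(3)[OF fin K(2) card]
  have "re_mat (\<Sum>k\<in>K. cscale (c k) (Z k) + cscale (d k) (conj_mat (Z k)))
    = (\<Sum>x\<in>K \<times> UNIV. (if snd x then Re (c (fst x)) + Re (d (fst x)) else Im (d (fst x)) - Im (c (fst x))) *\<^sub>R re_im Z x)"
    unfolding sum_times_bool[OF K(1)] re_mat_sum
    by (intro sum.cong refl) (simp add: re_im_def algebra_simps)
  then have r: "(if b then Re (c k) + Re (d k) else Im (d k) - Im (c k)) = 0" for b
    using ind[of "\<lambda>x. if snd x then Re (c (fst x)) + Re (d (fst x)) else Im (d (fst x)) - Im (c (fst x))" "(k, b)"] s k
    by (cases b) auto
  have "im_mat (\<Sum>k\<in>K. cscale (c k) (Z k) + cscale (d k) (conj_mat (Z k)))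
    = (\<Sum>x\<in>K \<times> UNIV. (if snd x then Im (c (fst x)) + Im (d (fst x)) else Re (c (fst x)) - Re (d (fst x))) *\<^sub>R re_im Z x)"
    unfolding sum_times_bool[OF K(1)] re_mat_sum
    by (intro sum.cong refl) (simp add: re_im_def algebra_simps)
  then have i: "(if b then Im (c k) + Im (d k) else Re (c k) - Re (d k)) = 0" for b
    using ind[of "\<lambda>x. if snd x then Im (c (fst x)) + Im (d (fst x)) else Re (c (fst x)) - Re (d (fst x))" "(k, b)"] s k
    by (cases b) auto
  show "c k = 0" "d k = 0"
    using r[of True] r[of False] i[of True] i[of False] by (simp_all add: complex_eq_iff)
qed

lemma conj_family_span:
  fixes Z :: "'i \<Rightarrow> complex^'n^'n"
  assumes K: "finite K" "sl \<subseteq> span (re_im Z ` (K \<times> UNIV))" and V: "V \<in> sl"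
  obtains c d where "V = (\<Sum>k\<in>K. cscale (c k) (Z k) + cscale (d k) (conj_mat (Z k)))"
proof -
  have "\<exists>c d. cmat_of X = (\<Sum>k\<in>K. cscale (c k) (Z k) + cscale (d k) (conj_mat (Z k)))" if "X \<in> sl" for X
  proof -
    have "X \<in> span (re_im Z ` (K \<times> UNIV))" using K(2) that by blast
    then obtain r where X: "X = (\<Sum>x\<in>K \<times> UNIV. r x *\<^sub>R re_im Z x)"
      using span_imageD[of X "re_im Z" "K \<times> UNIV"] K(1) by auto
    \<comment> \<open>Chosen so that twice the real part of \<open>cscale (?c k) (Z k)\<close> is
      the given combination of \<open>re_mat (Z k)\<close> and \<open>im_mat (Z k)\<close>.\<close>
    let ?c = "\<lambda>k. Complex (r (k, True) / 2) (- r (k, False) / 2)"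
    have "cmat_of X = (\<Sum>k\<in>K. cscale (?c k) (Z k) + cscale (cnj (?c k)) (conj_mat (Z k)))"
      unfolding X sum_times_bool[OF K(1)] mat_eq_re_im re_mat_sum re_mat_simps
    proof
      show "(\<Sum>k\<in>K. r (k, True) *\<^sub>R re_im Z (k, True) + r (k, False) *\<^sub>R re_im Z (k, False)) =
        (\<Sum>k\<in>K. Re (?c k) *\<^sub>R re_mat (Z k) - Im (?c k) *\<^sub>R im_mat (Z k)
          + (Re (cnj (?c k)) *\<^sub>R re_mat (Z k) - Im (cnj (?c k)) *\<^sub>R - im_mat (Z k)))"
        by (intro sum.cong refl) (simp add: re_im_def vec_eq_iff)
    qed (rule sum.neutral[symmetric], simp)
    then show ?thesis by (intro exI[of _ ?c] exI[of _ "\<lambda>k. cnj (?c k)"])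
  qed
  note real = this
  have V': "re_mat V \<in> sl" "im_mat V \<in> sl" using V sl_re_im by auto
  obtain c d where 1: "cmat_of (re_mat V) = (\<Sum>k\<in>K. cscale (c k) (Z k) + cscale (d k) (conj_mat (Z k)))"
    using real[OF V'(1)] by (elim exE)
  obtain c' d' where 2: "cmat_of (im_mat V) = (\<Sum>k\<in>K. cscale (c' k) (Z k) + cscale (d' k) (conj_mat (Z k)))"
    using real[OF V'(2)] by (elim exE)
  have "V = cmat_of (re_mat V) + cscale \<i> (cmat_of (im_mat V))" by (simp add: mat_eq_re_im)
  also have "\<dots> = (\<Sum>k\<in>K. cscale (c k + \<i> * c' k) (Z k) + cscale (d k + \<i> * d' k) (conj_mat (Z k)))"
    unfolding 1 2 cmat.scale_sum_right sum.distrib[symmetric]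
    by (intro sum.cong refl) (simp add: cscale_def vec_eq_iff algebra_simps)
  finally show ?thesis by (rule that)
qed

section \<open>Cartan subalgebra and roots\<close>

locale sl_cartan =
  fixes \<theta> :: "real^'n^'n \<Rightarrow> real^'n^'n" and h0 :: "(real^'n^'n) set" and h :: "(complex^'n^'n) set"
  assumes theta: "cartan_involution \<theta>" and stable: "stable_cartan \<theta> h0" and h: "h = complexification h0"
begin

lemma h0_subalgebra: "subspace h0" "h0 \<subseteq> sl" "\<And>X Y. X \<in> h0 \<Longrightarrow> Y \<in> h0 \<Longrightarrow> lie X Y \<in> h0"
  using stable unfolding stable_cartan_def cartan_subalgebra_def lie_subalgebra_def subspace_raw_def by auto

text \<open>\<open>\<theta>\<close> preserves \<open>h0\<close> and
  \<open>- killing_R X (\<theta> X)\<close> is positive, so a nonzero \<open>X\<close> pairs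
  nontrivially with \<open>\<theta> X\<close>.\<close>

lemma h0_nondegenerate:
  assumes X: "X \<in> h0" and zero: "\<And>Y. Y \<in> h0 \<Longrightarrow> trace (Y ** X) = 0"
  shows "X = 0"
proof (rule ccontr)
  assume "X \<noteq> 0"
  have X': "\<theta> X \<in> h0" using stable X by (auto simp: stable_cartan_def)
  have "killing_R X (\<theta> X) = 2 * of_nat CARD('n) * trace (X ** \<theta> X)"
    by (rule killing_R_eq) (use X X' h0_subalgebra in auto)
  moreover have "trace (X ** \<theta> X) = 0" using zero[OF X'] trace_mul_sym[of X "\<theta> X"] by simp
  moreover have "- killing_R X (\<theta> X) > 0"
    using theta X \<open>X \<noteq> 0\<close> h0_subalgebra(2) unfolding cartan_involution_def by blast
  ultimately show False by simp
qed

text \<open>\<open>S\<close> records the pairings of \<open>X\<close> with a basis of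
  \<open>h0\<close>. Nondegeneracy makes it injective on \<open>h0\<close>, and equality of
  dimensions makes it surjective.\<close>

lemma h0_represent:
  assumes lin: "\<And>X Y. X \<in> h0 \<Longrightarrow> Y \<in> h0 \<Longrightarrow> \<phi> (X + Y) = \<phi> X + \<phi> Y"
    "\<And>c X. X \<in> h0 \<Longrightarrow> \<phi> (c *\<^sub>R X) = c * \<phi> X"
  obtains X where "X \<in> h0" "\<And>Y. Y \<in> h0 \<Longrightarrow> trace (Y ** X) = \<phi> Y"
proof -
  obtain B where B: "B \<subseteq> h0" "independent B" "h0 \<subseteq> span B" "finite B"
    using basis_exists[of h0] independent_imp_finite by metis
  have sB: "span B = h0" using B h0_subalgebra(1) by (metis span_minimal subset_antisym)
  have tr_add: "trace (A ** (X + Y)) = trace (A ** X) + trace (A ** Y)"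
    "trace ((X + Y) ** A) = trace (X ** A) + trace (Y ** A)" for A X Y :: "real^'n^'n"
    by (simp_all add: matrix_distrib trace_add)
  have tr_scale: "trace (A ** (c *\<^sub>R X)) = c * trace (A ** X)" "trace ((c *\<^sub>R X) ** A) = c * trace (X ** A)"
    for c and A X :: "real^'n^'n"
    by (simp_all add: trace_def matrix_matrix_mult_def sum_distrib_left algebra_simps)
  define S where "S X = (\<Sum>b\<in>B. trace (b ** X) *\<^sub>R b)" for X
  have S: "linear S"
    by (rule linearI) (simp_all add: S_def tr_add tr_scale scaleR_add_left sum.distrib scaleR_sum_right)
  have ext: "trace (Y ** X) = \<phi> Y" if "\<And>b. b \<in> B \<Longrightarrow> trace (b ** X) = \<phi> b" "Y \<in> h0"
    "\<And>X Y. X \<in> h0 \<Longrightarrow> Y \<in> h0 \<Longrightarrow> \<phi> (X + Y) = \<phi> X + \<phi> Y"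
    "\<And>c X. X \<in> h0 \<Longrightarrow> \<phi> (c *\<^sub>R X) = c * \<phi> X" for X Y and \<phi> :: "_ \<Rightarrow> real"
  proof -
    have \<phi>0: "\<phi> 0 = 0" using that(4)[of 0 0] subspace_0[OF h0_subalgebra(1)] by simp
    have "Y \<in> span B" using sB that(2) by simp
    then have "Y \<in> h0 \<and> trace (Y ** X) = \<phi> Y"
    proof (induction rule: span_induct_alt)
      case base
      then show ?case using \<phi>0 subspace_0[OF h0_subalgebra(1)] by (simp add: trace_def)
    next
      case (step c b Z)
      have "c *\<^sub>R b \<in> h0" using step B(1) subspace_scale[OF h0_subalgebra(1)] by blast
      then show ?case using step that(1)[of b] that(3)[of "c *\<^sub>R b" Z] that(4)[of b c] B(1)
        subspace_add[OF h0_subalgebra(1)] by (auto simp: tr_add tr_scale)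
    qed
    then show ?thesis by simp
  qed
  have coeff: "r b = s b" if "(\<Sum>b\<in>B. r b *\<^sub>R b) = (\<Sum>b\<in>B. s b *\<^sub>R b)" "b \<in> B" for r s b
  proof -
    have "(\<Sum>b\<in>B. (r b - s b) *\<^sub>R b) = 0" using that(1) by (simp add: scaleR_diff_left sum_subtractf)
    then show ?thesis using independentD[OF B(2,4) order.refl, of "\<lambda>b. r b - s b" b] that(2) by simp
  qed
  have inj: "inj_on S (span h0)"
  proof (rule inj_onI)
    fix X Y assume XY: "X \<in> span h0" "Y \<in> span h0" "S X = S Y"
    then have V: "X - Y \<in> h0" using h0_subalgebra(1) by (metis span_diff span_eq_iff)
    have "trace (b ** (X - Y)) = 0" if "b \<in> B" for b
      using coeff[OF XY(3)[unfolded S_def] that] by (simp add: matrix_distrib trace_sub)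
    then have "trace (Z ** (X - Y)) = 0" if "Z \<in> h0" for Z
      using ext[of "X - Y" "\<lambda>_. 0" Z] that by simp
    then show "X = Y" using h0_nondegenerate[OF V] by simp
  qed
  have "S ` h0 \<subseteq> h0"
    using B(1) by (auto simp: S_def intro!: subspace_sum subspace_scale h0_subalgebra)
  moreover have "dim (S ` h0) = dim h0" by (rule dim_image_eq[OF S inj])
  ultimately have "S ` h0 = h0"
    by (intro subspace_dim_equal linear_subspace_image S h0_subalgebra) auto
  moreover have "(\<Sum>b\<in>B. \<phi> b *\<^sub>R b) \<in> h0"
    using B(1) by (auto intro!: subspace_sum subspace_scale h0_subalgebra)
  ultimately have "(\<Sum>b\<in>B. \<phi> b *\<^sub>R b) \<in> S ` h0" by simp
  then obtain X where X: "X \<in> h0" "S X = (\<Sum>b\<in>B. \<phi> b *\<^sub>R b)" by (elim imageE) simp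
  have "trace (b ** X) = \<phi> b" if "b \<in> B" for b using coeff[OF X(2)[unfolded S_def] that] .
  then show ?thesis using that[OF X(1)] ext[of X \<phi>] lin by blast
qed

lemma h_iff: "Z \<in> h \<longleftrightarrow> re_mat Z \<in> h0 \<and> im_mat Z \<in> h0"
  by (simp add: h complexification_def)

lemma h_closed:
  "0 \<in> h" "X \<in> h \<Longrightarrow> Y \<in> h \<Longrightarrow> X + Y \<in> h" "X \<in> h \<Longrightarrow> cscale c X \<in> h"
  "X \<in> h \<Longrightarrow> Y \<in> h \<Longrightarrow> lie X Y \<in> h" "X \<in> h \<Longrightarrow> conj_mat X \<in> h" "X \<in> h \<Longrightarrow> X \<in> sl"
  "A \<in> h0 \<Longrightarrow> cmat_of A \<in> h"
  using h0_subalgebra by (auto simp: h_iff re_mat_lie sl_re_im subspace_0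
      intro: subspace_add subspace_diff subspace_scale subspace_neg)

lemma h_nondegenerate:
  assumes Z: "Z \<in> h" and zero: "\<And>Y. Y \<in> h \<Longrightarrow> trace (Y ** Z) = 0"
  shows "Z = 0"
proof -
  have tr: "trace (Y ** re_mat Z) = 0" "trace (Y ** im_mat Z) = 0" if "Y \<in> h0" for Y
    using zero[OF h_closed(7)[OF that]] re_trace_mult[of "cmat_of Y" Z]
    by (simp_all add: matrix_matrix_mult_def trace_def)
  have "re_mat Z = 0" "im_mat Z = 0"
    using Z tr by (auto simp: h_iff intro!: h0_nondegenerate)
  then show ?thesis by (simp add: mat_eq_re_im)
qed

lemma h_represent:
  assumes "\<phi> \<in> dual_space h"
  obtains H where "H \<in> h" "\<And>K. K \<in> h \<Longrightarrow> trace (K ** H) = \<phi> K"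
proof -
  have \<phi>: "\<And>X Y. X \<in> h \<Longrightarrow> Y \<in> h \<Longrightarrow> \<phi> (X + Y) = \<phi> X + \<phi> Y"
    "\<And>c X. X \<in> h \<Longrightarrow> \<phi> (cscale c X) = c * \<phi> X"
    using assms by (auto simp: dual_space_def linear_on_def)
  obtain A where A: "A \<in> h0" "\<And>Y. Y \<in> h0 \<Longrightarrow> trace (Y ** A) = Re (\<phi> (cmat_of Y))"
    by (rule h0_represent[of "\<lambda>Y. Re (\<phi> (cmat_of Y))"]) (auto simp: \<phi> h_closed)
  obtain B where B: "B \<in> h0" "\<And>Y. Y \<in> h0 \<Longrightarrow> trace (Y ** B) = Im (\<phi> (cmat_of Y))"
    by (rule h0_represent[of "\<lambda>Y. Im (\<phi> (cmat_of Y))"]) (auto simp: \<phi> h_closed)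
  let ?H = "cmat_of A + cscale \<i> (cmat_of B)"
  show ?thesis
  proof
    show "?H \<in> h" using A(1) B(1) by (auto intro!: h_closed)
    fix K assume K: "K \<in> h"
    then have K0: "re_mat K \<in> h0" "im_mat K \<in> h0" by (simp_all add: h_iff)
    have "K = cmat_of (re_mat K) + cscale \<i> (cmat_of (im_mat K))" by (simp add: mat_eq_re_im)
    then have "\<phi> K = \<phi> (cmat_of (re_mat K)) + \<i> * \<phi> (cmat_of (im_mat K))"
      using \<phi> K0 h_closed by metis
    then show "trace (K ** ?H) = \<phi> K"
      using A(2)[OF K0(1)] A(2)[OF K0(2)] B(2)[OF K0(1)] B(2)[OF K0(2)]
      by (simp add: complex_eq_iff re_trace_mult)
  qed
qed

lemma killing_dual:
  assumes "\<phi> \<in> dual_space h"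
  shows "killing_dual h \<phi> \<in> h" "K \<in> h \<Longrightarrow> killing_C K (killing_dual h \<phi>) = \<phi> K"
    "K \<in> h \<Longrightarrow> 2 * of_nat CARD('n) * trace (K ** killing_dual h \<phi>) = \<phi> K"
proof -
  obtain H where H: "H \<in> h" "\<And>K. K \<in> h \<Longrightarrow> trace (K ** H) = \<phi> K" using h_represent[OF assms] by blast
  \<comment> \<open>The factor undoes the constant between the Killing form and the trace
    form.\<close>
  define H' where "H' = cscale (1 / (2 * of_nat CARD('n))) H"
  have H'h: "H' \<in> h" using H(1) by (simp add: H'_def h_closed)
  have H': "killing_C K H' = \<phi> K" if "K \<in> h" for K
  proof -
    have "trace (K ** H') = 1 / (2 * of_nat CARD('n)) * trace (K ** H)"
      by (simp add: H'_def trace_def matrix_matrix_mult_def cscale_def sum_distrib_left algebra_simps)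
    then show ?thesis using killing_C_eq[of K H'] that H'h H(2)[OF that] h_closed(6) by simp
  qed
  have "\<exists>!H. H \<in> h \<and> (\<forall>K\<in>h. killing_C K H = \<phi> K)"
  proof (rule ex1I[of _ H'])
    fix G assume G: "G \<in> h \<and> (\<forall>K\<in>h. killing_C K G = \<phi> K)"
    have D: "G - H' = G + cscale (-1) H'" by (simp add: cscale_def vec_eq_iff)
    have "trace (K ** (G - H')) = 0" if "K \<in> h" for K
    proof -
      have "killing_C K G = killing_C K H'" using G H' that by simp
      then have "trace (K ** G) = trace (K ** H')"
        using killing_C_eq[of K G] killing_C_eq[of K H'] that G H'h h_closed(6) by simp
      then show ?thesis by (simp add: matrix_distrib trace_sub)
    qed
    moreover have "G - H' \<in> h" unfolding D by (intro h_closed(2,3)) (use G H'h in auto)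
    ultimately show "G = H'" using h_nondegenerate[of "G - H'"] by simp
  qed (use H' H'h in auto)
  from theI'[OF this, folded killing_dual_def]
  show *: "killing_dual h \<phi> \<in> h" and **: "K \<in> h \<Longrightarrow> killing_C K (killing_dual h \<phi>) = \<phi> K" for K by auto
  then show "K \<in> h \<Longrightarrow> 2 * of_nat CARD('n) * trace (K ** killing_dual h \<phi>) = \<phi> K"
    using killing_C_eq[of K "killing_dual h \<phi>"] h_closed(6) by simp
qed

text \<open>A root vector is killed by \<open>[K, K']\<close>, so the root vanishes on \<open>[h, h]\<close>; by invariance of the
  Killing form, the dual of a root is then central in \<open>h\<close>.\<close>

lemma killing_dual_central:
  assumes \<phi>: "\<phi> \<in> dual_space h" and X: "X \<in> root_space h \<phi>" "X \<noteq> 0" and K: "K \<in> h"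
  shows "lie K (killing_dual h \<phi>) = 0"
proof (rule h_nondegenerate)
  let ?H = "killing_dual h \<phi>"
  show "lie K ?H \<in> h" using K killing_dual(1)[OF \<phi>] by (rule h_closed)
  fix K' assume K': "K' \<in> h"
  have eig: "lie G X = cscale (\<phi> G) X" if "G \<in> h" for G using X(1) that by (simp add: root_space_def)
  have "lie (lie K' K) X = lie K' (lie K X) - lie K (lie K' X)" using lie_jacobi[of K' K X] by simp
  then have "cscale (\<phi> (lie K' K)) X = 0"
    using eig[OF K] eig[OF K'] eig[OF h_closed(4)[OF K' K]] by (simp add: mult.commute)
  then have "\<phi> (lie K' K) = 0" using X(2) by simp
  then have "2 * of_nat CARD('n) * trace (lie K' K ** ?H) = 0"
    using killing_dual(3)[OF \<phi> h_closed(4)[OF K' K]] by simp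
  then show "trace (K' ** lie K ?H) = 0" by (simp add: trace_lie_invariant)
qed

end

section \<open>Conjugation on roots and the grading by height\<close>

locale sl_roots = sl_cartan \<theta> h0 h
  for \<theta> :: "real^'n^'n \<Rightarrow> real^'n^'n" and h0 :: "(real^'n^'n) set" and h :: "(complex^'n^'n) set" +
  fixes m :: nat and \<alpha> :: "nat \<Rightarrow> 'n functional" and e :: "'n functional \<Rightarrow> complex^'n^'n"
  assumes m: "m \<ge> 2"
    and alpha_dual: "\<And>j. j \<in> {1..2*m-2} \<Longrightarrow> \<alpha> j \<in> dual_space h"
    and cartan_matrix: "\<And>i j. i \<in> {1..2*m-2} \<Longrightarrow> j \<in> {1..2*m-2} \<Longrightarrow>
          cartan_matrix_entry h (\<alpha> i) (\<alpha> j) = type_A_entry i j"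
    and sigma_simple: "\<And>j. j \<in> {1..2*m-2} \<Longrightarrow>
          conj_mat ` root_space h (\<alpha> j) = root_space h (\<lambda>Z. - \<alpha> (2*m-1-j) Z)"
    and e_root: "\<And>j k. (j, k) \<in> chain_indices m \<Longrightarrow> e (chain \<alpha> j k) \<in> root_space h (chain \<alpha> j k)"
    and e_nonzero: "\<And>j k. (j, k) \<in> chain_indices m \<Longrightarrow> e (chain \<alpha> j k) \<noteq> 0"
begin

abbreviation E :: "nat \<Rightarrow> nat \<Rightarrow> complex^'n^'n" where "E j k \<equiv> e (chain \<alpha> j k)"

abbreviation H :: "nat \<Rightarrow> complex^'n^'n" where "H j \<equiv> killing_dual h (\<alpha> j)"

lemma chain_1: "chain \<alpha> j (Suc 0) = \<alpha> j"
  by (simp add: chain_def)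

lemma chain_indices_1: "j \<in> {1..2*m-2} \<Longrightarrow> (j, 1) \<in> chain_indices m"
  using m by (auto simp: chain_indices_def)

lemma alpha_linear:
  assumes "j \<in> {1..2*m-2}"
  shows "X \<in> h \<Longrightarrow> Y \<in> h \<Longrightarrow> \<alpha> j (X + Y) = \<alpha> j X + \<alpha> j Y" "X \<in> h \<Longrightarrow> \<alpha> j (cscale c X) = c * \<alpha> j X"
    "Z \<notin> h \<Longrightarrow> \<alpha> j Z = 0"
  using alpha_dual[OF assms] by (auto simp: dual_space_def linear_on_def)

lemma E_eigen: "(j, k) \<in> chain_indices m \<Longrightarrow> K \<in> h \<Longrightarrow> lie K (E j k) = cscale (chain \<alpha> j k K) (E j k)"
  using e_root by (auto simp: root_space_def)

lemma conj_eq_0 [simp]: "conj_mat X = 0 \<longleftrightarrow> X = 0"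
  using conj_mat_simps(3,4) by metis

text \<open>The assumption on \<open>\<sigma>\<close> concerns root spaces; testing it on the
  nonzero vector \<open>E j 1\<close> turns it into an identity of values. The outer
  \<open>cnj\<close> reflects that \<open>conj_mat\<close> is antilinear.\<close>

lemma sigma_alpha:
  assumes j: "j \<in> {1..2*m-2}" and K: "K \<in> h"
  shows "cnj (\<alpha> j (conj_mat K)) = - \<alpha> (2*m-1-j) K"
proof -
  let ?X = "E j 1"
  have X: "?X \<in> root_space h (\<alpha> j)" "?X \<noteq> 0"
    using e_root[OF chain_indices_1[OF j]] e_nonzero[OF chain_indices_1[OF j]] by (simp_all add: chain_1)
  then have "conj_mat ?X \<in> root_space h (\<lambda>Z. - \<alpha> (2*m-1-j) Z)" using sigma_simple[OF j] by blast
  then have 1: "lie K (conj_mat ?X) = cscale (- \<alpha> (2*m-1-j) K) (conj_mat ?X)"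
    using K by (auto simp: root_space_def)
  have "lie (conj_mat K) ?X = cscale (\<alpha> j (conj_mat K)) ?X"
    using X(1) h_closed(5)[OF K] by (auto simp: root_space_def)
  then have "lie K (conj_mat ?X) = cscale (cnj (\<alpha> j (conj_mat K))) (conj_mat ?X)"
    using conj_mat_lie[of "conj_mat K" ?X] by simp
  with 1 have "cscale (cnj (\<alpha> j (conj_mat K))) (conj_mat ?X) = cscale (- \<alpha> (2*m-1-j) K) (conj_mat ?X)" by simp
  then show ?thesis using X(2) by (subst (asm) cmat.scale_cancel_right) simp
qed

text \<open>The reversal \<open>i \<mapsto> 2*m-1-i\<close> sends the block
  \<open>j, ..., j+k-1\<close> to the block of length \<open>k\<close> starting at
  \<open>2*m-j-k\<close>.\<close>

lemma sigma_chain: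
  assumes jk: "(j, k) \<in> chain_indices m" and K: "K \<in> h"
  shows "cnj (chain \<alpha> j k (conj_mat K)) = - chain \<alpha> (2*m-j-k) k K"
proof -
  have "cnj (chain \<alpha> j k (conj_mat K)) = (\<Sum>i=j..<j+k. - \<alpha> (2*m-1-i) K)"
    unfolding chain_def cnj_sum
    by (intro sum.cong refl sigma_alpha K) (use jk in \<open>auto simp: chain_indices_def\<close>)
  also have "\<dots> = (\<Sum>i=2*m-j-k..<2*m-j-k+k. - \<alpha> i K)"
    by (rule sum.reindex_bij_witness[of _ "\<lambda>i. 2*m-1-i" "\<lambda>i. 2*m-1-i"])
      (use jk m in \<open>auto simp: chain_indices_def\<close>)
  finally show ?thesis by (simp add: chain_def sum_negf)
qed

lemma conj_E_eigen:
  assumes jk: "(j, k) \<in> chain_indices m" and K: "K \<in> h"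
  shows "lie K (conj_mat (E j k)) = cscale (- chain \<alpha> (2*m-j-k) k K) (conj_mat (E j k))"
proof -
  have "lie K (conj_mat (E j k)) = conj_mat (lie (conj_mat K) (E j k))" by (simp add: conj_mat_lie)
  then show ?thesis using E_eigen[OF jk h_closed(5)[OF K]] sigma_chain[OF jk K] by simp
qed

text \<open>\<open>h\<close> is given as a nilpotent self-normalising subalgebra, so commutativity
  is not part of its definition. Working in its centre, which contains the Killing duals of the
  simple roots, supplies the commutators needed below.\<close>

definition center :: "(complex^'n^'n) set" where
  "center = {V \<in> h. \<forall>K\<in>h. lie K V = 0}"

lemma center_closed:
  "0 \<in> center" "X \<in> center \<Longrightarrow> Y \<in> center \<Longrightarrow> X + Y \<in> center" "X \<in> center \<Longrightarrow> cscale c X \<in> center"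
  "X \<in> center \<Longrightarrow> conj_mat X \<in> center" "X \<in> center \<Longrightarrow> X \<in> h"
  unfolding center_def using h_closed by (auto simp: lie_add) (metis conj_mat_lie conj_mat_simps(3,4))

lemma center_sum: "(\<And>k. k \<in> K \<Longrightarrow> f k \<in> center) \<Longrightarrow> (\<Sum>k\<in>K. f k) \<in> center"
  by (induction K rule: infinite_finite_induct) (auto intro: center_closed)

lemma H_center: "j \<in> {1..2*m-2} \<Longrightarrow> H j \<in> center"
  unfolding center_def using killing_dual(1)[OF alpha_dual] killing_dual_central[OF alpha_dual, of j "E j 1"]
    e_root[OF chain_indices_1, of j] e_nonzero[OF chain_indices_1, of j] by (auto simp: chain_1)

lemma alpha_H:
  assumes "i \<in> {1..2*m-2}" "k \<in> {1..2*m-2}"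
  shows "\<alpha> i (H k) = killing_C (H k) (H i)"
  using killing_dual(2)[OF alpha_dual[OF assms(1)] killing_dual(1)[OF alpha_dual[OF assms(2)]]] by simp

lemma alpha_H_sym:
  assumes "i \<in> {1..2*m-2}" "k \<in> {1..2*m-2}"
  shows "\<alpha> i (H k) = \<alpha> k (H i)"
proof -
  have "H i \<in> sl" "H k \<in> sl" using assms killing_dual(1)[OF alpha_dual] h_closed(6) by auto
  then show ?thesis using assms by (simp add: alpha_H killing_C_eq trace_mul_sym[of "H k"])
qed

text \<open>The squared Killing length of a simple root, the same for all of them by
  \<open>alpha_H_diag\<close>.\<close>

definition b :: complex where "b = \<alpha> 1 (H 1)"

lemma alpha_H_entry:
  assumes "i \<in> {1..2*m-2}" "k \<in> {1..2*m-2}"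
  shows "2 * \<alpha> k (H i) / \<alpha> i (H i) = type_A_entry i k"
  using cartan_matrix[OF assms] assms by (simp add: cartan_matrix_entry_def alpha_H)

text \<open>Neighbouring simple roots have equal length because \<open>\<alpha> i (H k)\<close> is
  symmetric while both off-diagonal Cartan entries are -1.\<close>

lemma alpha_H_diag:
  assumes "i \<in> {1..2*m-2}"
  shows "\<alpha> i (H i) = b" "b \<noteq> 0"
proof -
  \<comment> \<open>Division by 0 would give 0, but the diagonal entry is 2.\<close>
  have nz: "\<alpha> i (H i) \<noteq> 0" if "i \<in> {1..2*m-2}" for i
    using alpha_H_entry[OF that that] by (auto simp: type_A_entry_def)
  show "b \<noteq> 0" using nz[of 1] m by (simp add: b_def)
  have "1 \<le> i" "i \<le> 2*m-2" using assms by auto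
  then show "\<alpha> i (H i) = b"
  proof (induction i rule: dec_induct)
    case base
    show ?case by (simp add: b_def)
  next
    case (step i)
    then have i: "i \<in> {1..2*m-2}" "Suc i \<in> {1..2*m-2}" by auto
    have "2 * \<alpha> (Suc i) (H i) / \<alpha> i (H i) = -1" "2 * \<alpha> i (H (Suc i)) / \<alpha> (Suc i) (H (Suc i)) = -1"
      using alpha_H_entry[OF i] alpha_H_entry[OF i(2,1)] by (simp_all add: type_A_entry_def)
    then have "2 * \<alpha> (Suc i) (H i) = - \<alpha> i (H i)" "2 * \<alpha> i (H (Suc i)) = - \<alpha> (Suc i) (H (Suc i))"
      using nz[OF i(1)] nz[OF i(2)] by (simp_all add: divide_eq_eq)
    then have "\<alpha> (Suc i) (H (Suc i)) = \<alpha> i (H i)" using alpha_H_sym[OF i] by simp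
    then show ?case using step i by simp
  qed
qed

lemma alpha_H_eq:
  assumes "i \<in> {1..2*m-2}" "k \<in> {1..2*m-2}"
  shows "\<alpha> k (H i) = b / 2 * type_A_entry i k"
  using alpha_H_entry[OF assms] alpha_H_diag[OF assms(1)] by (auto simp: field_simps)

lemma alpha_sum:
  assumes j: "j \<in> {1..2*m-2}" and "finite K" "\<And>k. k \<in> K \<Longrightarrow> f k \<in> h"
  shows "\<alpha> j (\<Sum>k\<in>K. cscale (c k) (f k)) = (\<Sum>k\<in>K. c k * \<alpha> j (f k)) \<and> (\<Sum>k\<in>K. cscale (c k) (f k)) \<in> h"
  using assms(2,3)
proof (induction K rule: finite_induct)
  case empty
  have "\<alpha> j (cscale 0 0) = 0 * \<alpha> j 0" by (rule alpha_linear(2)[OF j h_closed(1)])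
  then show ?case by (simp add: h_closed(1))
qed (simp add: alpha_linear[OF j] h_closed)

text \<open>Proportional to the half sum of the positive coroots.\<close>

definition \<rho> :: "complex^'n^'n" where
  "\<rho> = (\<Sum>k\<in>{1..2*m-2}. cscale (of_nat (k * (2*m-1-k))) (H k))"

lemma rho_center: "\<rho> \<in> center"
  unfolding \<rho>_def by (intro center_sum center_closed H_center)

text \<open>The Cartan matrix of type A acts as the negated second difference, and
  \<open>k * (2*m-1-k)\<close> has constant second difference -2. So all simple roots agree on
  \<open>\<rho>\<close>, which makes it a grading element.\<close>

lemma alpha_rho:
  assumes i: "i \<in> {1..2*m-2}"
  shows "\<alpha> i \<rho> = b"
proof -
  define g :: "nat \<Rightarrow> complex" where "g k = of_nat k * (of_nat (2*m-1) - of_nat k)" for k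
  have g: "of_nat (k * (2*m-1-k)) = g k" if "k \<le> 2*m-1" for k
    unfolding g_def of_nat_mult of_nat_diff[OF that] ..
  have "\<alpha> i \<rho> = (\<Sum>k\<in>{1..2*m-2}. of_nat (k * (2*m-1-k)) * \<alpha> i (H k))"
    unfolding \<rho>_def using alpha_sum[OF i, of "{1..2*m-2}" H] killing_dual(1)[OF alpha_dual] by simp
  also have "\<dots> = (\<Sum>k\<in>{1..2*m-2}. g k * (b / 2 * type_A_entry k i))"
    using i by (intro sum.cong refl arg_cong2[where f="(*)"] g alpha_H_eq) auto
  \<comment> \<open>The indices 0 and \<open>2*m-1\<close> are added with weight
    \<open>g k = 0\<close>, so that every \<open>i\<close> has two neighbours in the range.\<close>
  also have "\<dots> = (\<Sum>k\<in>{0..2*m-1}. g k * (b / 2 * type_A_entry k i))"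
  proof (rule sum.mono_neutral_left)
    show "\<forall>k\<in>{0..2*m-1} - {1..2*m-2}. g k * (b / 2 * type_A_entry k i) = 0"
    proof
      fix k assume "k \<in> {0..2*m-1} - {1..2*m-2}"
      then have "k = 0 \<or> k = 2*m-1" by auto
      then show "g k * (b / 2 * type_A_entry k i) = 0" by (auto simp: g_def)
    qed
  qed auto
  also have "\<dots> = (\<Sum>k\<in>{0..2*m-1}. b / 2 * ((if k = i then 2 * g k else 0) - (if k = i - 1 then g k else 0) - (if k = i + 1 then g k else 0)))"
    using i by (intro sum.cong refl) (auto simp: type_A_entry_def)
  also have "\<dots> = b / 2 * (2 * g i - g (i - 1) - g (i + 1))"
  proof -
    have "i \<le> 2*m-1" "i - 1 \<le> 2*m-1" "i + 1 \<le> 2*m-1" using i by auto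
    then show ?thesis unfolding sum_distrib_left[symmetric] sum_subtractf by simp
  qed
  also have "2 * g i - g (i - 1) - g (i + 1) = 2"
  proof -
    have "of_nat (i - 1) = (of_nat i - 1 :: complex)" "of_nat (i + 1) = (of_nat i + 1 :: complex)"
      using i of_nat_diff[of 1 i, where ?'a=complex] by simp_all
    moreover have "2 * (x * (y - x)) - (x - 1) * (y - (x - 1)) - (x + 1) * (y - (x + 1)) = 2" for x y :: complex
      by (simp add: algebra_simps)
    ultimately show ?thesis unfolding g_def by presburger
  qed
  finally show ?thesis by simp
qed

lemma chain_rho:
  assumes "(j, k) \<in> chain_indices m"
  shows "chain \<alpha> j k \<rho> = of_nat k * b"
proof -
  have "chain \<alpha> j k \<rho> = (\<Sum>i=j..<j+k. b)"
    unfolding chain_def by (intro sum.cong refl alpha_rho) (use assms in \<open>auto simp: chain_indices_def\<close>)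
  then show ?thesis by simp
qed

lemma chain_dual_0: "(j, k) \<in> chain_indices m \<Longrightarrow> Z \<notin> h \<Longrightarrow> chain \<alpha> j k Z = 0"
  unfolding chain_def by (intro sum.neutral) (auto simp: chain_indices_def alpha_linear(3))

lemma mirror_index: "(j, k) \<in> chain_indices m \<Longrightarrow> (2*m-j-k, k) \<in> chain_indices m"
  by (auto simp: chain_indices_def)

text \<open>Mirror roots have equal height, so conjugation reverses the grading exactly.\<close>

lemma rho_E:
  assumes jk: "(j, k) \<in> chain_indices m"
  shows "lie \<rho> (E j k) = cscale (of_nat k * b) (E j k)"
    "lie \<rho> (conj_mat (E j k)) = cscale (- (of_nat k * b)) (conj_mat (E j k))"
  using E_eigen[OF jk, of \<rho>] conj_E_eigen[OF jk, of \<rho>] center_closed(5)[OF rho_center]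
  unfolding chain_rho[OF jk] chain_rho[OF mirror_index[OF jk]] by auto

end

section \<open>The subalgebra q and a balanced basis\<close>

lemma eigenspace_C_i:
  assumes "Z \<in> eigenspace_C J \<i>"
  shows "re_mat Z \<in> sl" "im_mat Z \<in> sl" "J (re_mat Z) = - im_mat Z"
proof -
  show "re_mat Z \<in> sl" "im_mat Z \<in> sl" using assms sl_re_im by (auto simp: eigenspace_C_def)
  have "complexify_map J Z = cscale \<i> Z" using assms by (simp add: eigenspace_C_def)
  then have "re_mat (complexify_map J Z) = re_mat (cscale \<i> Z)" by simp
  then show "J (re_mat Z) = - im_mat Z" by (simp add: complexify_map_def)
qed

text \<open>A real \<open>X\<close> is the real part of \<open>X - \<i> J X\<close>, which belongs
  to the eigenspace for \<open>\<i>\<close>; expanding that vector and taking real parts expresses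
  \<open>X\<close>.\<close>

lemma eigenspace_C_i_span:
  fixes J :: "real^'n^'n \<Rightarrow> real^'n^'n"
  assumes J: "complex_structure J" and span: "eigenspace_C J \<i> \<subseteq> cmat.span (Z ` K)"
  shows "sl \<subseteq> span (re_im Z ` (K \<times> UNIV))"
proof
  fix X :: "real^'n^'n" assume X: "X \<in> sl"
  let ?U = "span (re_im Z ` (K \<times> UNIV))"
  have JX: "J X \<in> sl" "J (J X) = - X" using J X by (auto simp: complex_structure_def)
  have "J ((-1) *\<^sub>R J X) = (-1) *\<^sub>R J (J X)"
    using J JX(1) unfolding complex_structure_def linear_on_def by blast
  then have JJ: "J (- J X) = X" using JX by simp
  define V where "V = cmat_of X + cscale (- \<i>) (cmat_of (J X))"
  have re: "re_mat V = X" "im_mat V = - J X" by (simp_all add: V_def)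
  have "- J X \<in> sl" using JX(1) subspace_neg[OF subspace_sl_real] by blast
  then have "V \<in> sl" using X by (simp add: sl_re_im re)
  moreover have "complexify_map J V = cscale \<i> V" by (simp add: complexify_map_def mat_eq_re_im re JJ)
  ultimately have "V \<in> cmat.span (Z ` K)" using span by (auto simp: eigenspace_C_def)
  then have "re_mat V \<in> ?U \<and> im_mat V \<in> ?U"
  proof (induction rule: cmat.span_induct_alt)
    case base
    show ?case by (simp add: span_zero)
  next
    case (step c x y)
    then obtain k where k: "k \<in> K" "x = Z k" by auto
    have "re_im Z (k, True) \<in> ?U" "re_im Z (k, False) \<in> ?U" using k(1) by (auto intro!: span_base)
    then have "re_mat x \<in> ?U" "im_mat x \<in> ?U" by (simp_all add: re_im_def k(2))
    then show ?case using step by (auto intro!: span_add span_diff span_scale)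
  qed
  then show "X \<in> ?U" by (simp add: re)
qed

lemma card_chain_indices: "card (chain_indices m) = (m - 1) * (2*m-1)" "finite (chain_indices m)"
proof -
  have eq: "chain_indices m = prod.swap ` (SIGMA k:{1..2*m-2}. {1..2*m-1-k})"
    by (auto simp: chain_indices_def image_iff)
  show "finite (chain_indices m)" unfolding eq by simp
  have "card (chain_indices m) = (\<Sum>k\<in>{1..2*m-2}. 2*m-1-k)"
    unfolding eq by (subst card_image) auto
  also have "\<dots> = (\<Sum>k\<in>{1..2*m-2}. k)"
    by (rule sum.reindex_bij_witness[of _ "\<lambda>k. 2*m-1-k" "\<lambda>k. 2*m-1-k"]) auto
  also have "\<dots> = (m - 1) * (2*m-1)"
  proof (cases m)
    case (Suc n)
    have "(\<Sum>k\<in>{1..2*n}. k) = n * (2*n+1)" by (induction n) auto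
    then show ?thesis using Suc by simp
  qed simp
  finally show "card (chain_indices m) = (m - 1) * (2*m-1)" .
qed

section \<open>Dimension count and the centralizer of the grading element\<close>

locale sl_q = sl_roots \<theta> h0 h m \<alpha> e
  for \<theta> :: "real^'n^'n \<Rightarrow> real^'n^'n" and h0 :: "(real^'n^'n) set" and h :: "(complex^'n^'n) set"
    and m :: nat and \<alpha> :: "nat \<Rightarrow> 'n functional" and e :: "'n functional \<Rightarrow> complex^'n^'n" +
  fixes J :: "real^'n^'n \<Rightarrow> real^'n^'n"
  assumes size: "CARD('n) = 2 * m - 1"
    and J: "complex_structure J"
    and q: "eigenspace_C J \<i> = q_algebra m h ((\<lambda>(j, k). chain \<alpha> j k) ` chain_indices m) \<alpha> e"
    and e_bracket: "\<And>j. j \<in> {1..m-1} \<Longrightarrow> lie (E j (m-j)) (E m (m-j)) = E j (2*(m-j))"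
begin

lemma dim_sl_m: "dim (sl :: (real^'n^'n) set) = 4 * (m * (m - 1))"
proof -
  obtain n where "m = Suc n" using m by (cases m) auto
  then show ?thesis unfolding dim_sl size by (simp add: algebra_simps)
qed

text \<open>The real and imaginary parts of the generators of \<open>q\<close> span
  \<open>sl\<close>, so at least \<open>2 * (m * (m - 1))\<close> generators are needed. If two
  chains coincided, there would be fewer.\<close>

lemma inj_chain: "inj_on (\<lambda>(j, k). chain \<alpha> j k) (chain_indices m)"
proof -
  let ?P = "(\<lambda>(j, k). chain \<alpha> j k) ` chain_indices m"
  let ?A = "H_tilde m H ` {1..m-1}" and ?B = "e ` (?P - {\<alpha> (m-1)})" and ?C = "{E (m-1) 1 + conj_mat (E m 1)}"
  let ?G = "?A \<union> ?B \<union> ?C"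
  have finP: "finite ?P" using card_chain_indices by simp
  have fin: "finite ?G" using finP by simp
  have "sl \<subseteq> span (re_im (\<lambda>Z. Z) ` (?G \<times> UNIV))"
    by (rule eigenspace_C_i_span[OF J]) (simp add: q q_algebra_def chain_1)
  then have "dim (sl :: (real^'n^'n) set) \<le> card (re_im (\<lambda>Z. Z) ` (?G \<times> (UNIV :: bool set)))"
    using fin by (intro dim_le_card) auto
  also have "\<dots> \<le> card (?G \<times> (UNIV :: bool set))" using fin by (intro card_image_le) auto
  also have "\<dots> = 2 * card ?G" by (simp add: card_cartesian_product)
  finally have 1: "4 * (m * (m - 1)) \<le> 2 * card ?G" by (simp add: dim_sl_m)
  have "(m - 1, 1) \<in> chain_indices m" using m by (intro chain_indices_1) auto
  then have "\<alpha> (m-1) \<in> ?P" by (auto simp: chain_1 intro!: image_eqI[of _ _ "(m-1,1)"])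
  then have 2: "card (?P - {\<alpha> (m-1)}) + 1 = card ?P"
    using finP card_Suc_Diff1[of ?P "\<alpha> (m-1)"] by simp
  have "card ?G \<le> card ?A + card ?B + card ?C"
    using card_Un_le[of "?A \<union> ?B" ?C] card_Un_le[of ?A ?B] by linarith
  also have "\<dots> \<le> (m - 1) + card (?P - {\<alpha> (m-1)}) + 1"
    using card_image_le[of "{1..m-1}" "H_tilde m H"] card_image_le[of "?P - {\<alpha> (m-1)}" e] finP by simp
  finally have "2 * (m * (m - 1)) \<le> (m - 1) + card ?P" using 1 2 by simp
  moreover have "2 * (m * (m - 1)) = (m - 1) + (m - 1) * (2 * m - 1)" using m by (cases m) (simp_all add: algebra_simps)
  ultimately have "card (chain_indices m) \<le> card ?P" using card_chain_indices by simp
  then show ?thesis using card_chain_indices card_image_le[of "chain_indices m" "\<lambda>(j, k). chain \<alpha> j k"]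
    by (intro eq_card_imp_inj_on) auto
qed

lemma center_diff: "X \<in> center \<Longrightarrow> Y \<in> center \<Longrightarrow> X - Y \<in> center"
  using center_closed(2)[of X "cscale (-1) Y"] center_closed(3)[of Y "-1"] by simp

lemma H_tilde_center: "k \<in> {1..m-1} \<Longrightarrow> H_tilde m H k \<in> center"
proof -
  assume k: "k \<in> {1..m-1}"
  have two: "2 *\<^sub>R A = cscale 2 A" for A :: "complex^'n^'n"
    by (simp_all add: cscale_def vec_eq_iff scaleR_conv_of_real)
  show ?thesis
    unfolding H_tilde_def two using k m by (auto intro!: center_closed(2,3) center_diff H_center)
qed

text \<open>The index \<open>(j, 0)\<close> stands for the \<open>j\<close>-th element of the Cartan part; \<open>(j, k)\<close> with \<open>k \<ge> 1\<close>
  for the positive root \<open>chain \<alpha> j k\<close>.\<close>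

definition idx :: "(nat \<times> nat) set" where
  "idx = (\<lambda>j. (j, 0)) ` {1..m-1} \<union> chain_indices m"

text \<open>\<open>W\<close> below lists the given basis of \<open>q\<close>. \<open>F\<close> has
  the root vector \<open>E (m-1) 1\<close> in the place of \<open>e\<^sub>0\<close>: it leaves
  \<open>q\<close>, but consists of eigenvectors of \<open>lie \<rho>\<close>.\<close>

definition F :: "nat \<times> nat \<Rightarrow> complex^'n^'n" where
  "F x = (if snd x = 0 then H_tilde m H (fst x) else E (fst x) (snd x))"

definition W :: "nat \<times> nat \<Rightarrow> complex^'n^'n" where
  "W x = (if x = (m-1, 1) then F (m-1, 1) + conj_mat (F (m, 1)) else F x)"

lemma finite_idx: "finite idx" and card_idx: "card idx = 2 * (m * (m - 1))"
proof -
  show "finite idx" using card_chain_indices by (simp add: idx_def)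
  have "card idx = card ((\<lambda>j. (j, 0::nat)) ` {1..m-1}) + card (chain_indices m)"
    unfolding idx_def using card_chain_indices by (intro card_Un_disjoint) (auto simp: chain_indices_def)
  also have "\<dots> = (m - 1) + (m - 1) * (2 * m - 1)"
    using card_chain_indices by (subst card_image) (auto intro: inj_onI)
  also have "\<dots> = 2 * (m * (m - 1))" using m by (cases m) (simp_all add: algebra_simps)
  finally show "card idx = 2 * (m * (m - 1))" .
qed

lemma idx_cases:
  assumes "x \<in> idx"
  obtains j where "x = (j, 0)" "j \<in> {1..m-1}" | "x \<in> chain_indices m" "snd x \<noteq> 0"
  using assms by (auto simp: idx_def chain_indices_def)

lemma idx_pq: "(m-1, 1) \<in> idx" "(m, 1) \<in> idx" "(m-1, 1) \<in> chain_indices m" "(m, 1) \<in> chain_indices m"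
  using m by (auto simp: idx_def chain_indices_def)

lemma q_eq_span_W: "eigenspace_C J \<i> = cmat.span (W ` idx)"
proof -
  let ?p = "(m - 1, 1::nat)"
  have "idx = (\<lambda>j. (j, 0)) ` {1..m-1} \<union> (chain_indices m - {?p}) \<union> {?p}"
    using idx_pq by (auto simp: idx_def)
  then have "W ` idx = W ` (\<lambda>j. (j, 0)) ` {1..m-1} \<union> W ` (chain_indices m - {?p}) \<union> {W ?p}"
    by (simp only: image_Un image_insert image_empty)
  moreover have "W ` (\<lambda>j. (j, 0)) ` {1..m-1} = H_tilde m H ` {1..m-1}"
    unfolding image_image by (simp add: W_def F_def)
  moreover have "W ` (chain_indices m - {?p}) = e ` ((\<lambda>(j, k). chain \<alpha> j k) ` chain_indices m - {\<alpha> (m-1)})"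
  proof -
    have diff: "(\<lambda>(j, k). chain \<alpha> j k) ` chain_indices m - {\<alpha> (m-1)} = (\<lambda>(j, k). chain \<alpha> j k) ` (chain_indices m - {?p})"
      using inj_on_image_set_diff[OF inj_chain, of "chain_indices m" "{?p}"] idx_pq(3) by (simp add: chain_1)
    show ?thesis unfolding diff image_image
      by (intro image_cong refl) (auto simp: W_def F_def chain_indices_def)
  qed
  moreover have "W ?p = e (\<alpha> (m-1)) + conj_mat (e (\<alpha> m))"
    by (simp add: W_def F_def chain_1)
  ultimately show ?thesis unfolding q q_algebra_def by simp
qed

text \<open>\<open>W\<close> and \<open>F\<close> differ by the conjugate of
  \<open>F (m, 1)\<close>, whose real and imaginary parts are, up to sign, those of
  \<open>F (m, 1)\<close> itself.\<close>

lemma sl_span_F: "sl \<subseteq> span (re_im F ` (idx \<times> UNIV))"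
proof -
  have F: "re_im F (x, c) \<in> span (re_im F ` (idx \<times> UNIV))" if "x \<in> idx" for x c
    using that by (intro span_base) auto
  have "re_im W (x, c) \<in> span (re_im F ` (idx \<times> UNIV))" if "x \<in> idx" for x c
  proof (cases "x = (m-1, 1)")
    case True
    have "re_im W (x, c) = re_im F ((m-1, 1), c) + (if c then 1 else - 1) *\<^sub>R re_im F ((m, 1), c)"
      by (simp add: re_im_def True W_def)
    then show ?thesis using F[OF idx_pq(1), of c] F[OF idx_pq(2), of c] by (simp only: span_add span_scale)
  next
    case False
    then have "re_im W (x, c) = re_im F (x, c)" by (simp add: re_im_def W_def)
    then show ?thesis using F[OF that] by simp
  qed
  then have "re_im W ` (idx \<times> UNIV) \<subseteq> span (re_im F ` (idx \<times> UNIV))" by auto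
  then have "span (re_im W ` (idx \<times> UNIV)) \<subseteq> span (re_im F ` (idx \<times> UNIV))"
    by (simp add: span_minimal)
  moreover have "sl \<subseteq> span (re_im W ` (idx \<times> UNIV))"
    by (rule eigenspace_C_i_span[OF J]) (simp add: q_eq_span_W)
  ultimately show ?thesis by blast
qed

lemma rho_F:
  assumes "x \<in> idx"
  shows "lie \<rho> (F x) = cscale (of_nat (snd x) * b) (F x)"
    "lie \<rho> (conj_mat (F x)) = cscale (- (of_nat (snd x) * b)) (conj_mat (F x))"
proof -
  have "lie \<rho> (F x) = cscale (of_nat (snd x) * b) (F x) \<and>
    lie \<rho> (conj_mat (F x)) = cscale (- (of_nat (snd x) * b)) (conj_mat (F x))"
    using assms
  proof (cases rule: idx_cases)
    case (1 j)
    have "lie K \<rho> = 0" if "K \<in> h" for K using rho_center that by (simp add: center_def)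
    then have "lie \<rho> K = 0" if "K \<in> h" for K using lie_anti[of \<rho> K] that by simp
    moreover have "H_tilde m H j \<in> h" "conj_mat (H_tilde m H j) \<in> h"
      using H_tilde_center[OF 1(2)] center_closed(5) h_closed(5) by auto
    ultimately show ?thesis by (simp add: 1(1) F_def)
  next
    case 2
    then show ?thesis using rho_E[of "fst x" "snd x"] by (simp add: F_def)
  qed
  then show "lie \<rho> (F x) = cscale (of_nat (snd x) * b) (F x)"
    "lie \<rho> (conj_mat (F x)) = cscale (- (of_nat (snd x) * b)) (conj_mat (F x))" by auto
qed

text \<open>Independence kills every coefficient of nonzero degree, as \<open>b\<close> is nonzero.
  What is left are the \<open>H_tilde\<close> and their conjugates, all of them central.\<close>

lemma rho_kernel:
  assumes V: "V \<in> sl" and zero: "lie \<rho> V = 0"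
  shows "V \<in> center"
proof -
  obtain c d where V: "V = (\<Sum>x\<in>idx. cscale (c x) (F x) + cscale (d x) (conj_mat (F x)))"
    using conj_family_span[OF finite_idx sl_span_F V] by blast
  have b: "b \<noteq> 0" using alpha_H_diag[of 1] m by simp
  have "lie \<rho> V = (\<Sum>x\<in>idx. cscale (c x * (of_nat (snd x) * b)) (F x)
      + cscale (- d x * (of_nat (snd x) * b)) (conj_mat (F x)))"
    unfolding V lie_sum by (intro sum.cong refl) (simp add: lie_add rho_F)
  with zero have s: "(\<Sum>x\<in>idx. cscale (c x * (of_nat (snd x) * b)) (F x)
      + cscale (- d x * (of_nat (snd x) * b)) (conj_mat (F x))) = 0" by simp
  have card: "2 * card idx \<le> dim (sl :: (real^'n^'n) set)" by (simp add: card_idx dim_sl_m)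
  show ?thesis unfolding V
  proof (rule center_sum)
    fix x assume x: "x \<in> idx"
    show "cscale (c x) (F x) + cscale (d x) (conj_mat (F x)) \<in> center"
      using x
    proof (cases rule: idx_cases)
      case (1 j)
      then show ?thesis using H_tilde_center[of j] by (auto simp: F_def intro!: center_closed(2-4))
    next
      case 2
      have "c x * (of_nat (snd x) * b) = 0" "- d x * (of_nat (snd x) * b) = 0"
        using conj_family_independent[OF finite_idx sl_span_F card s x] by auto
      then show ?thesis using b 2(2) center_closed(1) by simp
    qed
  qed
qed

end

section \<open>Brackets of basis vectors with conjugates\<close>

context sl_q
begin

lemma weight_bracket:
  assumes jk: "(j, k) \<in> chain_indices m" and il: "(i, l) \<in> chain_indices m" and K: "K \<in> h"
  shows "lie K (lie (E j k) (conj_mat (E i l))) =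
    cscale (chain \<alpha> j k K - chain \<alpha> (2*m-i-l) l K) (lie (E j k) (conj_mat (E i l)))"
  unfolding lie_jacobi[of K "E j k"] E_eigen[OF jk K] conj_E_eigen[OF il K] lie_cscale
  by (simp only: cmat.scale_left_distrib[symmetric] add_uminus_conv_diff)

lemma bracket_center:
  assumes jk: "(j, k) \<in> chain_indices m" and il: "(i, k) \<in> chain_indices m"
  shows "lie (E j k) (conj_mat (E i k)) \<in> center"
proof (rule rho_kernel[OF lie_in_sl])
  show "lie \<rho> (lie (E j k) (conj_mat (E i k))) = 0"
    unfolding weight_bracket[OF jk il center_closed(5)[OF rho_center]] chain_rho[OF jk] chain_rho[OF mirror_index[OF il]]
    by simp
qed

text \<open>The bracket is central, hence of weight 0 if nonzero. Then the chain equals its mirror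
  image, and injectivity of chains gives \<open>2 * j + k = 2 * m\<close>.\<close>

lemma bracket_conj_self:
  assumes jk: "(j, k) \<in> chain_indices m" and ne: "2 * j + k \<noteq> 2 * m"
  shows "lie (E j k) (conj_mat (E j k)) = 0"
proof (rule ccontr)
  let ?V = "lie (E j k) (conj_mat (E j k))" and ?i = "2*m-j-k"
  assume V: "?V \<noteq> 0"
  \<comment> \<open>Injectivity speaks of functions on all matrices, so arguments outside
    \<open>h\<close>, where both chains are 0 by convention, are covered as well.\<close>
  have "chain \<alpha> j k K = chain \<alpha> ?i k K" for K
  proof (cases "K \<in> h")
    case True
    then have "lie K ?V = 0" using bracket_center[OF jk jk] by (simp add: center_def)
    then have "cscale (chain \<alpha> j k K - chain \<alpha> ?i k K) ?V = 0" using weight_bracket[OF jk jk True] by simp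
    then have "chain \<alpha> j k K - chain \<alpha> ?i k K = 0" using V by (simp only: cmat.scale_eq_0_iff) simp
    then show ?thesis by simp
  next
    case False
    then show ?thesis using chain_dual_0[OF jk False] chain_dual_0[OF mirror_index[OF jk] False] by (simp only:)
  qed
  then have "(\<lambda>(j, k). chain \<alpha> j k) (j, k) = (\<lambda>(j, k). chain \<alpha> j k) (?i, k)" by auto
  then have "(j, k) = (?i, k)" using inj_onD[OF inj_chain _ jk mirror_index[OF jk]] by blast
  then show False using ne jk by (auto simp: chain_indices_def)
qed

definition A :: "nat \<Rightarrow> complex^'n^'n" where
  "A j = lie (E j (m-j)) (conj_mat (E m (m-j)))"

definition s :: "nat \<Rightarrow> complex" where
  "s j = chain \<alpha> m (m-j) (A j)"

lemma gamma_idx: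
  assumes "j \<in> {1..m-1}"
  shows "(j, m-j) \<in> chain_indices m" "(m, m-j) \<in> chain_indices m" "(j, 2*(m-j)) \<in> chain_indices m"
  using assms by (auto simp: chain_indices_def)

lemma gamma_brackets:
  assumes j: "j \<in> {1..m-1}"
  defines "X \<equiv> E j (m-j)" and "Y \<equiv> E m (m-j)"
  shows "lie X (conj_mat X) = 0" "lie Y (conj_mat Y) = 0" "lie X (conj_mat Y) = A j"
    "lie Y (conj_mat X) = - conj_mat (A j)" "A j \<in> center"
    "lie (A j) Y = cscale (s j) Y" "lie (conj_mat (A j)) X = cscale (- cnj (s j)) X"
proof -
  show "lie X (conj_mat X) = 0" "lie Y (conj_mat Y) = 0"
    unfolding X_def Y_def using j by (auto intro!: bracket_conj_self gamma_idx)
  show "lie X (conj_mat Y) = A j" by (simp add: A_def X_def Y_def)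
  show "lie Y (conj_mat X) = - conj_mat (A j)"
    using lie_anti[of Y "conj_mat X"] by (simp add: A_def X_def Y_def conj_mat_lie)
  show A: "A j \<in> center" unfolding A_def using j by (intro bracket_center gamma_idx)
  then have Ah: "A j \<in> h" by (rule center_closed(5))
  show "lie (A j) Y = cscale (s j) Y"
    using E_eigen[OF gamma_idx(2)[OF j] Ah] by (simp add: s_def Y_def)
  \<comment> \<open>The mirror image of the block \<open>j, ..., m-1\<close> starts at
    \<open>m\<close>; this exchanges the roots of \<open>X\<close> and \<open>Y\<close>.\<close>
  have "2*m-j-(m-j) = m" using j by auto
  then have "cnj (chain \<alpha> j (m-j) (conj_mat (A j))) = - s j"
    using sigma_chain[OF gamma_idx(1)[OF j] Ah] by (simp add: s_def)
  then have "chain \<alpha> j (m-j) (conj_mat (A j)) = - cnj (s j)" by (metis complex_cnj_cnj complex_cnj_minus)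
  then show "lie (conj_mat (A j)) X = cscale (- cnj (s j)) X"
    using E_eigen[OF gamma_idx(1)[OF j] h_closed(5)[OF Ah]] by (simp add: X_def)
qed

text \<open>The root vector is \<open>[X, Y]\<close>. Because \<open>X\<close> and \<open>Y\<close>
  commute with their own conjugates, bracketing \<open>[X, Y]\<close> with \<open>conj_mat X\<close>
  or \<open>conj_mat Y\<close> returns a multiple of \<open>X\<close> or of \<open>Y\<close>, and
  only the mixed brackets \<open>A j\<close> and its conjugate remain.\<close>

lemma bracket_beta:
  assumes j: "j \<in> {1..m-1}"
  shows "lie (E j (2*(m-j))) (conj_mat (E j (2*(m-j)))) = cscale (- cnj (s j)) (A j) + cscale (s j) (conj_mat (A j))"
proof -
  let ?X = "E j (m-j)" and ?Y = "E m (m-j)"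
  note g = gamma_brackets[OF j]
  have 1: "lie (lie ?X ?Y) (conj_mat ?X) = cscale (- cnj (s j)) ?X"
  proof -
    have "lie ?X (lie ?Y (conj_mat ?X)) = lie (lie ?X ?Y) (conj_mat ?X) + lie ?Y (lie ?X (conj_mat ?X))"
      by (rule lie_jacobi)
    then show ?thesis using g(1,4,7) lie_anti[of ?X "conj_mat (A j)"] by simp
  qed
  have 2: "lie (lie ?X ?Y) (conj_mat ?Y) = cscale (s j) ?Y"
  proof -
    have "lie ?X (lie ?Y (conj_mat ?Y)) = lie (lie ?X ?Y) (conj_mat ?Y) + lie ?Y (lie ?X (conj_mat ?Y))"
      by (rule lie_jacobi)
    then show ?thesis using g(2,3,6) lie_anti[of ?Y "A j"] by (simp add: eq_neg_iff_add_eq_0)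
  qed
  have "lie (lie ?X ?Y) (conj_mat (lie ?X ?Y)) =
    lie (lie (lie ?X ?Y) (conj_mat ?X)) (conj_mat ?Y) + lie (conj_mat ?X) (lie (lie ?X ?Y) (conj_mat ?Y))"
    unfolding conj_mat_lie by (rule lie_jacobi)
  also have "\<dots> = cscale (- cnj (s j)) (lie ?X (conj_mat ?Y)) + cscale (s j) (lie (conj_mat ?X) ?Y)"
    unfolding 1 2 lie_cscale ..
  also have "lie (conj_mat ?X) ?Y = conj_mat (A j)" using g(4) lie_anti[of ?Y "conj_mat ?X"] by simp
  finally show ?thesis using g(3) e_bracket[OF j] by simp
qed

text \<open>Again only the mixed terms survive. At \<open>c = s j\<close> the value is the negative
  of the one in \<open>bracket_beta\<close>.\<close>

lemma bracket_gamma: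
  assumes j: "j \<in> {1..m-1}"
  shows "lie (E j (m-j) + cscale c (E m (m-j))) (conj_mat (E j (m-j) + cscale c (E m (m-j))))
    = cscale (cnj c) (A j) - cscale c (conj_mat (A j))"
  using gamma_brackets[OF j] by (simp add: lie_add)

text \<open>Compared with \<open>bracket_gamma\<close>, the summand \<open>conj_mat Y\<close> adds
  \<open>[X, Y]\<close> and its counterpart \<open>[conj_mat Y, conj_mat X]\<close>; its other
  pairings are of \<open>Y\<close> with its conjugate or of a vector with itself, and
  vanish.\<close>

lemma bracket_e0:
  fixes c
  defines "X \<equiv> E (m-1) 1" and "Y \<equiv> E m 1" and "B \<equiv> E (m-1) 2"
  shows "lie (X + conj_mat Y + cscale c Y) (conj_mat (X + conj_mat Y + cscale c Y))
    = B - conj_mat B + cscale (cnj c) (A (m-1)) - cscale c (conj_mat (A (m-1)))"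
proof -
  have j: "m - 1 \<in> {1..m-1}" "m - (m - 1) = 1" "2 * (m - (m - 1)) = 2" using m by auto
  note g = gamma_brackets[OF j(1), unfolded j(2), folded X_def Y_def]
  have XY: "lie X Y = B" using e_bracket[OF j(1)] unfolding j(2) mult_1_right X_def Y_def B_def .
  have "lie (conj_mat X) (conj_mat Y) = conj_mat B" by (simp add: XY[symmetric] conj_mat_lie)
  moreover have "lie (conj_mat Y) Y = 0" using g(2) lie_anti[of "conj_mat Y" Y] by simp
  ultimately show ?thesis
    using g(1-4) XY lie_anti[of "conj_mat Y" "conj_mat X"] by (simp add: lie_add)
qed

text \<open>On this vector \<open>\<alpha> (m-1)\<close> vanishes and \<open>\<alpha> m\<close>
  equals \<open>3 * b / 2\<close>. Up to conjugation and sign this is the denominator of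
  \<open>t\<close>.\<close>

lemma beta_H_tilde: "chain \<alpha> (m-1) 2 (H_tilde m H (m-1)) \<noteq> 0"
proof -
  have i: "m - 1 \<in> {1..2*m-2}" "m \<in> {1..2*m-2}" using m by auto
  have Hh: "H (m-1) \<in> h" "H m \<in> h" using i killing_dual(1)[OF alpha_dual] by auto
  have "H_tilde m H (m-1) = H (m-1) + cscale 2 (H m)"
    by (simp add: H_tilde_def cscale_def vec_eq_iff scaleR_conv_of_real)
  moreover have "\<alpha> i (H (m-1) + cscale 2 (H m)) = \<alpha> i (H (m-1)) + 2 * \<alpha> i (H m)" if "i \<in> {1..2*m-2}" for i
    using that Hh by (simp add: alpha_linear h_closed)
  moreover have "\<alpha> (m-1) (H (m-1)) = b" "\<alpha> m (H m) = b" "\<alpha> (m-1) (H m) = - b / 2" "\<alpha> m (H (m-1)) = - b / 2"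
  proof -
    have "type_A_entry (m-1) m = -1" "type_A_entry m (m-1) = -1" using m by (auto simp: type_A_entry_def)
    then show "\<alpha> (m-1) (H (m-1)) = b" "\<alpha> m (H m) = b" "\<alpha> (m-1) (H m) = - b / 2" "\<alpha> m (H (m-1)) = - b / 2"
      using alpha_H_eq[OF i] alpha_H_eq[OF i(2,1)] i by (simp_all add: alpha_H_diag(1))
  qed
  moreover have "chain \<alpha> (m-1) 2 K = \<alpha> (m-1) K + \<alpha> m K" for K
  proof -
    have "{m-1..<m-1+2} = {m-1, m}" using m by auto
    then show ?thesis using m by (simp add: chain_def)
  qed
  ultimately show ?thesis using i alpha_H_diag(2)[OF i(1)] by simp
qed

text \<open>Normalised so that the cross terms in the bracket of \<open>X + cscale t B\<close> with
  its conjugate are exactly \<open>conj_mat B - B\<close>, the negative of the surplus left by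
  \<open>e\<^sub>0\<close>.\<close>

definition t :: complex where
  "t = 1 / chain \<alpha> (m-1) 2 (conj_mat (H_tilde m H (m-1)))"

lemma bracket_H_tilde:
  defines "X \<equiv> H_tilde m H (m-1)" and "B \<equiv> E (m-1) 2"
  shows "lie (X + cscale t B) (conj_mat (X + cscale t B))
    = conj_mat B - B + cscale (t * cnj t) (lie B (conj_mat B))"
proof -
  have idx: "(m-1, 2) \<in> chain_indices m" "2*m-(m-1)-2 = m-1" using m by (auto simp: chain_indices_def)
  have X: "X \<in> center" unfolding X_def using m by (intro H_tilde_center) auto
  then have Xh: "X \<in> h" "conj_mat X \<in> h" using center_closed(5) h_closed(5) by auto
  define w where "w = chain \<alpha> (m-1) 2 (conj_mat X)"
  \<comment> \<open>This root is its own mirror image, so its values on \<open>X\<close> and on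
    \<open>conj_mat X\<close> determine each other.\<close>
  have w: "chain \<alpha> (m-1) 2 X = - cnj w"
    using sigma_chain[OF idx(1) Xh(1)] unfolding idx(2) w_def by simp
  have w0: "w \<noteq> 0" using w beta_H_tilde unfolding X_def by auto
  have t: "t * w = 1" "cnj t * cnj w = 1" using w0 by (simp_all add: t_def w_def X_def flip: complex_cnj_mult)
  have "lie X (conj_mat B) = cscale (cnj w) (conj_mat B)"
    using conj_E_eigen[OF idx(1) Xh(1)] unfolding idx(2) w B_def by simp
  moreover have "lie B (conj_mat X) = - cscale w B"
    using E_eigen[OF idx(1) Xh(2)] lie_anti[of B "conj_mat X"] by (simp add: B_def w_def)
  moreover have "lie X (conj_mat X) = 0"
    using X Xh lie_anti[of X "conj_mat X"] by (simp add: center_def)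
  ultimately show ?thesis using t by (simp add: lie_add cmat.scale_right_distrib mult.commute[of "cnj t" t])
qed

text \<open>At \<open>j = m - 1\<close> the bracket of \<open>B\<close> with its conjugate occurs
  once from \<open>B\<close> itself and once, weighted by \<open>t * cnj t\<close>, from the sheared
  Cartan generator; the factor accounts for both.\<close>

definition coef :: "nat \<Rightarrow> complex" where
  "coef j = (if j = m - 1 then s j * (1 + t * cnj t) else s j)"

text \<open>The basis of \<open>q\<close> obtained from \<open>W\<close> by the shears that make the brackets with the conjugates cancel.\<close>

definition Z :: "nat \<times> nat \<Rightarrow> complex^'n^'n" where
  "Z x = (if x = (m-1, 0) then W x + cscale t (W (m-1, 2))
     else if snd x \<noteq> 0 \<and> fst x + snd x = m then W x + cscale (coef (fst x)) (W (m, snd x))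
     else W x)"

text \<open>The vectors added by the shears, \<open>W (m-1, 2)\<close> and \<open>W (m, k)\<close>,
  are themselves left unchanged, so every shear is undone by a subtraction.\<close>

lemma q_eq_span_Z: "eigenspace_C J \<i> = cmat.span (Z ` idx)"
proof -
  have idx: "(m-1, 2) \<in> idx" using m by (auto simp: idx_def chain_indices_def)
  have idx': "(m, k) \<in> idx" if "(j, k) \<in> idx" "k \<noteq> 0" "j + k = m" for j k
    using that m by (auto simp: idx_def chain_indices_def)
  have W: "W x \<in> cmat.span (W ` idx)" if "x \<in> idx" for x using that by (intro cmat.span_base) auto
  have Z: "Z x \<in> cmat.span (Z ` idx)" if "x \<in> idx" for x using that by (intro cmat.span_base) auto
  have W1: "W (m-1, 2) = Z (m-1, 2)" using m by (simp add: Z_def)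
  have W2: "W (m, k) = Z (m, k)" if "k \<noteq> 0" for k using that by (simp add: Z_def)
  have "Z x \<in> cmat.span (W ` idx)" if x: "x \<in> idx" for x
    unfolding Z_def using W[OF x] W[OF idx] W[OF idx'[of "fst x" "snd x"]] x
    by (auto intro!: cmat.span_add cmat.span_scale)
  moreover have "W x \<in> cmat.span (Z ` idx)" if x: "x \<in> idx" for x
  proof -
    consider "x = (m-1, 0)" | "x \<noteq> (m-1, 0)" "snd x \<noteq> 0" "fst x + snd x = m"
      | "x \<noteq> (m-1, 0)" "\<not> (snd x \<noteq> 0 \<and> fst x + snd x = m)" by blast
    then show ?thesis
    proof cases
      case 1
      then have "W x = Z x - cscale t (Z (m-1, 2))" unfolding W1[symmetric] by (simp add: Z_def)
      then show ?thesis using Z[OF x] Z[OF idx] by (auto intro!: cmat.span_diff cmat.span_scale)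
    next
      case 2
      then have "W x = Z x - cscale (coef (fst x)) (Z (m, snd x))" unfolding W2[OF 2(2), symmetric] by (simp add: Z_def)
      then show ?thesis using Z[OF x] Z[OF idx'[of "fst x" "snd x"]] x 2 by (auto intro!: cmat.span_diff cmat.span_scale)
    next
      case 3
      then have "W x = Z x" by (auto simp: Z_def)
      then show ?thesis using Z[OF x] by simp
    qed
  qed
  ultimately show ?thesis unfolding q_eq_span_W
    by (intro subset_antisym cmat.span_minimal cmat.subspace_span) auto
qed

lemma sum_bracket_Z: "(\<Sum>x\<in>idx. lie (Z x) (conj_mat (Z x))) = 0"
proof -
  define f where "f x = lie (Z x) (conj_mat (Z x))" for x
  \<comment> \<open>The only indices with a bracket that can be nonzero: the sheared Cartan
    generator, the roots \<open>\<gamma>\<^sub>j\<close>, and the symmetric roots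
    \<open>\<beta>\<^sub>j\<close>.\<close>
  let ?T1 = "{(m-1, 0::nat)}" and ?T2 = "(\<lambda>j. (j, m-j)) ` {1..m-1}" and ?T3 = "(\<lambda>j. (j, 2*(m-j))) ` {1..m-1}"
  let ?T = "?T1 \<union> ?T2 \<union> ?T3"
  have sub: "?T \<subseteq> idx" using m gamma_idx by (auto simp: idx_def)
  have zero: "f x = 0" if x: "x \<in> idx - ?T" for x
  proof -
    obtain j k where jk: "x = (j, k)" by (cases x)
    have "x \<in> idx" using x by simp
    then show ?thesis
    proof (cases rule: idx_cases)
      case (1 i)
      then have "Z x = H_tilde m H i" using x by (auto simp: Z_def W_def F_def)
      moreover have c: "H_tilde m H i \<in> center" using 1 by (intro H_tilde_center)
      moreover have "lie (conj_mat (H_tilde m H i)) (H_tilde m H i) = 0"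
      proof -
        have "conj_mat (H_tilde m H i) \<in> h" using c center_closed(5) h_closed(5) by blast
        with c show ?thesis unfolding center_def by blast
      qed
      ultimately show ?thesis using lie_anti[of "H_tilde m H i" "conj_mat (H_tilde m H i)"] by (simp add: f_def)
    next
      case 2
      then have C: "(j, k) \<in> chain_indices m" "k \<noteq> 0" by (simp_all add: jk)
      have 3: "j + k \<noteq> m"
      proof
        assume "j + k = m"
        then have "x = (j, m-j)" "j \<in> {1..m-1}" using C jk by (auto simp: chain_indices_def)
        then show False using x by auto
      qed
      have 4: "2 * j + k \<noteq> 2 * m"
      proof
        assume "2 * j + k = 2 * m"
        then have "x = (j, 2*(m-j))" "j \<in> {1..m-1}" using C jk by (auto simp: chain_indices_def)
        then show False using x by auto
      qed
      have "x \<noteq> (m-1, 1)" using 3 m jk by auto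
      then have "Z x = E j k" using 3 C(2) by (auto simp: Z_def W_def F_def jk)
      then show ?thesis using bracket_conj_self[OF C(1) 4] by (simp add: f_def)
    qed
  qed
  have "(\<Sum>x\<in>idx. f x) = (\<Sum>x\<in>?T. f x)"
    by (rule sum.mono_neutral_right[OF finite_idx sub]) (use zero in blast)
  also have "\<dots> = (\<Sum>x\<in>?T1 \<union> ?T2. f x) + (\<Sum>x\<in>?T3. f x)"
    by (rule sum.union_disjoint) auto
  also have "(\<Sum>x\<in>?T1 \<union> ?T2. f x) = (\<Sum>x\<in>?T1. f x) + (\<Sum>x\<in>?T2. f x)"
    by (rule sum.union_disjoint) auto
  also have "(\<Sum>x\<in>?T2. f x) = (\<Sum>j\<in>{1..m-1}. f (j, m-j))"
    by (subst sum.reindex) (auto intro: inj_onI)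
  also have "(\<Sum>x\<in>?T3. f x) = (\<Sum>j\<in>{1..m-1}. f (j, 2*(m-j)))"
    by (subst sum.reindex) (auto intro: inj_onI)
  finally have 1: "(\<Sum>x\<in>idx. f x) = f (m-1, 0) + (\<Sum>j\<in>{1..m-1}. f (j, m-j) + f (j, 2*(m-j)))"
    by (simp add: sum.distrib)
  have T3: "f (j, 2*(m-j)) = cscale (- cnj (s j)) (A j) + cscale (s j) (conj_mat (A j))" if j: "j \<in> {1..m-1}" for j
  proof -
    have "Z (j, 2*(m-j)) = E j (2*(m-j))" using j by (auto simp: Z_def W_def F_def)
    then show ?thesis using bracket_beta[OF j] by (simp add: f_def)
  qed
  \<comment> \<open>Away from the middle each \<open>\<gamma>\<^sub>j\<close> cancels against its
    \<open>\<beta>\<^sub>j\<close>; the three brackets at \<open>m - 1\<close> cancel only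
    together.\<close>
  have "f (j, m-j) + f (j, 2*(m-j)) = 0" if j: "j \<in> {1..m-1} - {m-1}" for j
  proof -
    have "Z (j, m-j) = E j (m-j) + cscale (s j) (E m (m-j))"
      using j m by (auto simp: Z_def W_def F_def coef_def)
    then have "f (j, m-j) = cscale (cnj (s j)) (A j) - cscale (s j) (conj_mat (A j))"
      using bracket_gamma[of j "s j"] j by (simp add: f_def)
    then show ?thesis using T3[of j] j by simp
  qed
  then have 2: "(\<Sum>j\<in>{1..m-1}. f (j, m-j) + f (j, 2*(m-j))) = f (m-1, 1) + f (m-1, 2)"
    using m by (subst sum.remove[of _ "m-1"]) auto
  let ?B = "E (m-1) 2" and ?s = "s (m-1)" and ?A = "A (m-1)"
  have "m - 1 \<in> {1..m-1}" "m - (m - 1) = 1" using m by auto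
  then have 3: "f (m-1, 2) = cscale (- cnj ?s) ?A + cscale ?s (conj_mat ?A)"
    using T3[of "m-1"] by simp
  have 4: "f (m-1, 0) = conj_mat ?B - ?B + cscale (t * cnj t) (f (m-1, 2))"
  proof -
    have "Z (m-1, 0) = H_tilde m H (m-1) + cscale t ?B" "Z (m-1, 2) = ?B"
      using m by (simp_all add: Z_def W_def F_def)
    then show ?thesis using bracket_H_tilde by (simp add: f_def)
  qed
  let ?c = "?s * (1 + t * cnj t)"
  have 5: "f (m-1, 1) = ?B - conj_mat ?B + cscale (cnj ?c) ?A - cscale ?c (conj_mat ?A)"
  proof -
    have "Z (m-1, 1) = E (m-1) 1 + conj_mat (E m 1) + cscale ?c (E m 1)"
      using m by (simp add: Z_def W_def F_def coef_def)
    then show ?thesis using bracket_e0[of ?c] by (simp only: f_def)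
  qed
  have "f (m-1, 0) + (f (m-1, 1) + f (m-1, 2)) = 0"
    unfolding 5 4 3 by (simp add: cscale_def vec_eq_iff conj_mat_def algebra_simps)
  then show ?thesis using 1 2 by (simp add: f_def)
qed

end

section \<open>Balanced metric\<close>

text \<open>Coordinates are picked by choice. The bound on the cardinality makes them unique, and
  uniqueness yields both linearity and duality.\<close>

lemma spanning_family_coordinates:
  fixes f :: "'i \<Rightarrow> 'v::euclidean_space"
  assumes K: "finite K" and V: "subspace V" "V \<subseteq> span (f ` K)" "card K \<le> dim V" "\<And>k. k \<in> K \<Longrightarrow> f k \<in> V"
  obtains c where "\<And>x. x \<in> V \<Longrightarrow> x = (\<Sum>k\<in>K. c k x *\<^sub>R f k)"
    "\<And>k x y r s. k \<in> K \<Longrightarrow> x \<in> V \<Longrightarrow> y \<in> V \<Longrightarrow> c k (r *\<^sub>R x + s *\<^sub>R y) = r * c k x + s * c k y"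
    "\<And>k l. k \<in> K \<Longrightarrow> l \<in> K \<Longrightarrow> c k (f l) = (if k = l then 1 else 0)"
proof -
  define d where "d x = (SOME r. x = (\<Sum>k\<in>K. r k *\<^sub>R f k))" for x
  have d: "x = (\<Sum>k\<in>K. d x k *\<^sub>R f k)" if "x \<in> V" for x
  proof -
    have "x \<in> span (f ` K)" using that V(2) by blast
    then obtain r where "x = (\<Sum>k\<in>K. r k *\<^sub>R f k)" using span_imageD[OF _ K] by blast
    then show ?thesis unfolding d_def by (rule someI[of "\<lambda>r. x = (\<Sum>k\<in>K. r k *\<^sub>R f k)"])
  qed
  have uniq: "r k = d x k" if "x \<in> V" "x = (\<Sum>k\<in>K. r k *\<^sub>R f k)" "k \<in> K" for x r k
  proof -
    have "(\<Sum>k\<in>K. (r k - d x k) *\<^sub>R f k) = 0"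
      using d[OF that(1)] that(2) by (simp add: scaleR_diff_left sum_subtractf)
    then have "r k - d x k = 0" by (rule spanning_family_independent(3)[OF K V(2,3)]) (rule that(3))
    then show ?thesis by simp
  qed
  show ?thesis
  proof (rule that[of "\<lambda>k x. d x k"])
    fix k x y r s assume k: "k \<in> K" and x: "x \<in> V" and y: "y \<in> V"
    have "r *\<^sub>R x + s *\<^sub>R y = (\<Sum>k\<in>K. (r * d x k + s * d y k) *\<^sub>R f k)"
      unfolding scaleR_add_left sum.distrib scaleR_scaleR[symmetric] scaleR_sum_right[symmetric]
      using d[OF x] d[OF y] by simp
    moreover have "r *\<^sub>R x + s *\<^sub>R y \<in> V" using x y V(1) by (simp add: subspace_add subspace_scale)
    ultimately show "d (r *\<^sub>R x + s *\<^sub>R y) k = r * d x k + s * d y k"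
      using uniq[of "r *\<^sub>R x + s *\<^sub>R y" "\<lambda>k. r * d x k + s * d y k" k] k by (simp only:)
  next
    fix k l assume k: "k \<in> K" "l \<in> K"
    have "f l = (\<Sum>k\<in>K. (if k = l then 1 else 0) *\<^sub>R f k)"
      using k K by (simp add: if_distrib[where f="\<lambda>c. c *\<^sub>R _"] cong: if_cong)
    then show "d (f l) k = (if k = l then 1 else 0)"
      using uniq[OF V(4)[OF k(2)], of "\<lambda>k. if k = l then 1 else 0" k] k(1) by (simp only:)
  qed (rule d)
qed

text \<open>The frame consists of \<open>re_mat (Z x)\<close> and its image under \<open>J\<close>,
  which is \<open>- im_mat (Z x)\<close>; the metric is the one for which it is orthonormal.\<close>

lemma (in sl_q) balanced_metric: "\<exists>g. compatible_metric J g \<and> balanced J g"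
proof -
  define n where "n = card idx"
  obtain i :: "nat \<Rightarrow> nat \<times> nat" where i: "bij_betw i {..<n} idx"
    using ex_bij_betw_nat_finite[OF finite_idx] by (auto simp: n_def atLeast0LessThan)
  have Z: "Z x \<in> eigenspace_C J \<i>" if "x \<in> idx" for x
    unfolding q_eq_span_Z using that by (intro cmat.span_base) auto
  have J_lin: "J (X + Y) = J X + J Y" "J (c *\<^sub>R X) = c *\<^sub>R J X" if "X \<in> sl" "Y \<in> sl" for X Y c
    using J that unfolding complex_structure_def linear_on_def by auto
  have J_sl: "J X \<in> sl" "J (J X) = - X" if "X \<in> sl" for X
    using J that unfolding complex_structure_def by auto
  define u where "u k = re_mat (Z (i k))" for k
  define v where "v k = (if even k then u (k div 2) else J (u (k div 2)))" for k
  have i_idx: "i k \<in> idx" if "k < n" for k using i that by (auto simp: bij_betw_def)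
  have u: "u k \<in> sl" "J (u k) = - im_mat (Z (i k))" if "k < n" for k
    using eigenspace_C_i[OF Z[OF i_idx[OF that]]] by (simp_all add: u_def)
  have v: "v k \<in> sl" if "k < 2 * n" for k
    using that u(1)[of "k div 2"] J_sl(1) by (simp add: v_def)
  have even_odd: "v (2 * k) = u k" "v (Suc (2 * k)) = J (u k)" for k by (simp_all add: v_def)
  have n: "2 * n = dim (sl :: (real^'n^'n) set)" by (simp add: n_def card_idx dim_sl_m)
  have "sl \<subseteq> span (re_im Z ` (idx \<times> UNIV))"
    by (rule eigenspace_C_i_span[OF J]) (simp add: q_eq_span_Z)
  also have "\<dots> \<subseteq> span (v ` {..<2*n})"
  proof (rule span_minimal)
    show "re_im Z ` (idx \<times> UNIV) \<subseteq> span (v ` {..<2*n})"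
    proof
      fix X assume "X \<in> re_im Z ` (idx \<times> UNIV)"
      then obtain x c where x: "x \<in> idx" "X = re_im Z (x, c)" by auto
      then obtain k where k: "k < n" "x = i k" using i by (auto simp: bij_betw_def)
      have "v (2 * k) \<in> span (v ` {..<2*n})" "v (Suc (2 * k)) \<in> span (v ` {..<2*n})"
        using k(1) by (auto intro!: span_base)
      then have "u k \<in> span (v ` {..<2*n})" "J (u k) \<in> span (v ` {..<2*n})" by (simp_all add: even_odd)
      moreover have "X = (if c then u k else - J (u k))"
        using u(2)[OF k(1)] by (simp add: x(2) k(2) re_im_def u_def)
      ultimately show "X \<in> span (v ` {..<2*n})" by (auto intro: span_neg)
    qed
  qed simp
  finally obtain c where
    expand: "\<And>x. x \<in> sl \<Longrightarrow> x = (\<Sum>k<2*n. c k x *\<^sub>R v k)" and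
    c_lin: "\<And>k x y r s. k \<in> {..<2*n} \<Longrightarrow> x \<in> sl \<Longrightarrow> y \<in> sl \<Longrightarrow> c k (r *\<^sub>R x + s *\<^sub>R y) = r * c k x + s * c k y" and
    c_v: "\<And>k l. k \<in> {..<2*n} \<Longrightarrow> l \<in> {..<2*n} \<Longrightarrow> c k (v l) = (if k = l then 1 else 0)"
    using spanning_family_coordinates[of "{..<2*n}" sl v] subspace_sl_real n v by auto
  have c_linear: "linear_on (*\<^sub>R) (*) sl (c k)" if "k < 2*n" for k
    unfolding linear_on_def
  proof (intro conjI ballI allI)
    fix x y :: "real^'n^'n" and r assume x: "x \<in> sl"
    show "c k (r *\<^sub>R x) = r * c k x" using c_lin[of k x x r 0] that x by simp
    assume "y \<in> sl"
    then show "c k (x + y) = c k x + c k y" using c_lin[of k x y 1 1] that x by simp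
  qed
  have "(\<Sum>k<n. lie (u k) (J (u k))) = 0"
  proof -
    \<comment> \<open>For \<open>Z = u + \<i> y\<close> the bracket with the conjugate is
      \<open>- 2 \<i> [u, y]\<close>, and \<open>J u = - y\<close>, so its imaginary part is
      \<open>2 [u, J u]\<close>.\<close>
    have "2 *\<^sub>R lie (u k) (J (u k)) = im_mat (lie (Z (i k)) (conj_mat (Z (i k))))" if "k < n" for k
      using u(2)[OF that] lie_anti[of "u k" "im_mat (Z (i k))"]
      by (simp add: re_mat_lie u_def scaleR_2)
    then have "2 *\<^sub>R (\<Sum>k<n. lie (u k) (J (u k))) = im_mat (\<Sum>k<n. lie (Z (i k)) (conj_mat (Z (i k))))"
      by (simp add: scaleR_sum_right re_mat_sum)
    also have "(\<Sum>k<n. lie (Z (i k)) (conj_mat (Z (i k)))) = (\<Sum>x\<in>idx. lie (Z x) (conj_mat (Z x)))"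
      by (rule sum.reindex_bij_betw[OF i])
    finally show ?thesis by (simp add: sum_bracket_Z)
  qed
  then have br0: "(\<Sum>k<n. lie (v (2 * k)) (v (Suc (2 * k)))) = 0" by (simp add: even_odd)
  interpret frame: hermitian_frame sl n v c J lie
  proof unfold_locales
    show "subspace (sl :: (real^'n^'n) set)" by (rule subspace_sl_real)
    fix x y z :: "real^'n^'n" and r s assume "x \<in> sl" "y \<in> sl"
    then show "J (r *\<^sub>R x + s *\<^sub>R y) = r *\<^sub>R J x + s *\<^sub>R J y"
      by (simp add: J_lin subspace_scale[OF subspace_sl_real])
    show "lie z (r *\<^sub>R x + s *\<^sub>R y) = r *\<^sub>R lie z x + s *\<^sub>R lie z y"
      by (simp add: lie_add lie_scale[OF scaleR_mat])
  next
    fix x :: "real^'n^'n" assume "x \<in> sl"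
    show "(\<Sum>k<2*n. c k (lie x (v k))) = 0"
      by (rule sum_coord_lie) (use v c_linear expand in auto)
  next
    fix k assume "k < n"
    then show "J (v (Suc (2 * k))) = - v (2 * k)" by (simp add: even_odd J_sl(2)[OF u(1)])
  next
    show "(\<Sum>k<n. lie (v (2 * k)) (v (Suc (2 * k)))) = 0" by (rule br0)
  qed (use v c_lin c_v expand J_sl lie_in_sl lie_anti in \<open>auto simp: even_odd\<close>)
  have "n > 0" using m by (simp add: n_def card_idx)
  have "compatible_metric J frame.metric"
    unfolding compatible_metric_def linear_on_def
  proof (intro conjI ballI allI impI)
    fix X Y Z :: "real^'n^'n" and r assume X: "X \<in> sl"
    show "X \<noteq> 0 \<Longrightarrow> frame.metric X X > 0" using frame.metric_pos X by blast
    assume Y: "Y \<in> sl"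
    show "frame.metric X Y = frame.metric Y X" by (rule frame.metric_sym)
    show "frame.metric (J X) (J Y) = frame.metric X Y" using X Y by (rule frame.metric_J)
    show "frame.metric X (r *\<^sub>R Y) = r * frame.metric X Y"
      using frame.metric_lincomb(1)[OF Y Y X, of r 0] by simp
    assume "Z \<in> sl"
    then show "frame.metric X (Y + Z) = frame.metric X Y + frame.metric X Z"
      using frame.metric_lincomb(1)[OF Y _ X, of Z 1 1] by simp
  qed
  moreover have "balanced J frame.metric"
  proof -
    have "dim (sl :: (real^'n^'n) set) div 2 = n" using n by simp
    then show ?thesis
      unfolding balanced_def Let_def
      using frame.ce_differential_omega_power[OF \<open>n > 0\<close>] by simp
  qed
  ultimately show ?thesis by blast
qed

theorem theorem5p3:
  fixes m :: nat
    and \<theta> J :: "real^'n^'n \<Rightarrow> real^'n^'n"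
    and h0 t0 a0 :: "(real^'n^'n) set"
    and h q :: "(complex^'n^'n) set"
    and us vs :: "(complex^'n^'n) list"
    and P :: "'n functional set"
    and \<alpha> :: "nat \<Rightarrow> 'n functional"
    and e :: "'n functional \<Rightarrow> complex^'n^'n"
  assumes m: "m \<ge> 2"
    and size: "CARD('n) = 2 * m - 1"
    and theta: "cartan_involution \<theta>"
    and h0: "maximally_compact_cartan \<theta> h0"
    and t0: "t0 = h0 \<inter> fixed_part \<theta>"
    and a0: "a0 = h0 \<inter> antifixed_part \<theta>"
    and h: "h = complexification h0"
    and us: "real_basis us (cscale \<i> ` cmat_of ` t0)"
    and vs: "real_basis vs (cmat_of ` a0)"
    and P: "P = positive_roots h (us @ vs)"
    and simple: "bij_betw \<alpha> {1..2*m-2} (simple_roots P)"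
    and cartan_matrix: "\<And>i j. i \<in> {1..2*m-2} \<Longrightarrow> j \<in> {1..2*m-2} \<Longrightarrow>
          cartan_matrix_entry h (\<alpha> i) (\<alpha> j) = type_A_entry i j"
    and P_chains: "P = (\<lambda>(j, k). chain \<alpha> j k) ` chain_indices m"
    and theta_simple: "\<And>j Z. j \<in> {1..2*m-2} \<Longrightarrow> Z \<in> h \<Longrightarrow>
          \<alpha> j (complexify_map \<theta> Z) = \<alpha> (2*m-1-j) Z"
    and sigma_simple: "\<And>j. j \<in> {1..2*m-2} \<Longrightarrow>
          conj_mat ` root_space h (\<alpha> j) = root_space h (\<lambda>Z. - \<alpha> (2*m-1-j) Z)"
    and e_root: "\<And>\<beta>. \<beta> \<in> P \<Longrightarrow> e \<beta> \<in> root_space h \<beta> \<and> e \<beta> \<noteq> 0"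
    and e_bracket: "\<And>j k i l. (j, k) \<in> chain_indices m \<Longrightarrow> (i, l) \<in> chain_indices m \<Longrightarrow>
          (\<lambda>Z. chain \<alpha> j k Z + chain \<alpha> i l Z) \<in> P \<Longrightarrow> j < i \<or> (j = i \<and> k < l) \<Longrightarrow>
          lie (e (chain \<alpha> j k)) (e (chain \<alpha> i l)) = e (\<lambda>Z. chain \<alpha> j k Z + chain \<alpha> i l Z)"
    and q: "q = q_algebra m h P \<alpha> e"
    and J: "complex_structure J"
    and J_10: "eigenspace_C J \<i> = q"
    and J_01: "eigenspace_C J (- \<i>) = conj_mat ` q"
  shows "\<exists>g. compatible_metric J g \<and> balanced J g"
proof -
  interpret sl_cartan \<theta> h0 h
    by unfold_locales (use theta h0 h in \<open>auto simp: maximally_compact_cartan_def\<close>)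
  have chain_P: "chain \<alpha> j k \<in> P" if "(j, k) \<in> chain_indices m" for j k
    using that unfolding P_chains by force
  have dual: "\<alpha> j \<in> dual_space h" if "j \<in> {1..2*m-2}" for j
    using bij_betw_apply[OF simple that] by (auto simp: simple_roots_def P positive_roots_def roots_def)
  have bracket: "lie (e (chain \<alpha> j (m-j))) (e (chain \<alpha> m (m-j))) = e (chain \<alpha> j (2*(m-j)))"
    if j: "j \<in> {1..m-1}" for j
  proof -
    have eq: "j + (m - j) = m" "j + 2 * (m - j) = m + (m - j)" using j by auto
    \<comment> \<open>The first block of simple roots ends where the second begins, so the two root
      sums concatenate; the order condition of \<open>e_bracket\<close> is then
      \<open>j < m\<close>.\<close>
    have sum: "(\<lambda>Z. chain \<alpha> j (m-j) Z + chain \<alpha> m (m-j) Z) = chain \<alpha> j (2*(m-j))"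
      unfolding chain_def eq by (rule ext, rule sum.atLeastLessThan_concat) (use j in auto)
    have idx: "(j, m-j) \<in> chain_indices m" "(m, m-j) \<in> chain_indices m" "(j, 2*(m-j)) \<in> chain_indices m"
      using j by (auto simp: chain_indices_def)
    show ?thesis
      using e_bracket[OF idx(1,2), unfolded sum, OF chain_P[OF idx(3)]] j by auto
  qed
  interpret sl_q \<theta> h0 h m \<alpha> e J
    by unfold_locales
      (use m dual cartan_matrix sigma_simple e_root[OF chain_P] size J J_10 q P_chains bracket in auto)
  show ?thesis by (rule balanced_metric)
qed

end
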